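(* Let $k$ be a field. (1) There is a bicategory $\check{\mathrm{Alg}}$ whose objects are $k$-algebras and in which the category of morphisms from $A$ to $B$ is the category $\check{\mathrm{Alg}}(A,B)$ of measuring coalgebras $\rho:H\to \mathrm{Hom}_k(A,B)$. (2) There is a bicategory $\widehat{\mathrm{Alg}}$ whose objects are $k$-algebras and in which the category of morphisms from $A$ to $B$ is the category $\widehat{\mathrm{Alg}}(A,B)$ of extensions $\sigma:A\to S\otimes B$.
   Context: Everything is over an arbitrary field $k$; algebras are associative and unital, coalgebras coassociative and counital, $\otimes=\otimes_k$. Sweedler notation: $\triangle h=\sum_{(h)}h_{(2)}\otimes h_{(1)}$, counit $\epsilon$. $\langle\cdot,\cdot\rangle$ denotes evaluation. For algebras $A,B$ and a coalgebra $H$, a linear map $\rho:H\to\mathrm{Hom}_k(A,B)$ measures if $\langle\rho(h),aa'\rangle=\sum_{(h)}\langle\rho(h_{(2)}),a\rangle\langle\rho(h_{(1)}),a'\rangle$ and $\langle\rho(h),1_A\rangle=\epsilon(h)1_B$ for all $h\in H$, $a,a'\in A$; then $(H,\rho)$ is a measuring coalgebra. A map of measuring coalgebras $(H_1,\rho_1)\to(H_2,\rho_2)$ is a coalgebra map $\tau:H_1\to H_2$ with $\rho_2\circ\tau=\rho_1$. An extension from $A$ to $B$ is a pair $(S,\sigma)$ with $S$ an algebra and $\sigma:A\to S\otimes B$ an algebra homomorphism. A map of extensions $(S_1,\sigma_1)\to(S_2,\sigma_2)$ is an algebra homomorphism $\theta:S_1\to S_2$ with $(\theta\otimes 1_B)\circ\sigma_1=\sigma_2$.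 Horizontal composition in $\check{\mathrm{Alg}}$: the composite of $\phi:H\to\mathrm{Hom}_k(A,B)$ with $\psi:K\to\mathrm{Hom}_k(B,C)$ is the coalgebra $K\otimes H$ with the map $y\otimes h\mapsto\psi(y)\circ\phi(h)$; the unit at $A$ is the one-dimensional coalgebra $ke$, $\triangle e=e\otimes e$, $\epsilon(e)=1$, with $e\mapsto 1_A$ (the identity map of $A$). Horizontal composition in $\widehat{\mathrm{Alg}}$: the composite of $(S,\sigma)$ from $A$ to $B$ with $(T,\tau)$ from $B$ to $C$ is $S\otimes T$ with $(1_S\otimes\tau)\circ\sigma:A\to S\otimes T\otimes C$; the unit at $A$ is $k$ with the canonical isomorphism $A\cong k\otimes A$. Horizontal composition of $2$-cells is the tensor product of maps in both cases. *)

theory Defs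
  imports "HOL-Algebra.Module" "HOL-Library.FuncSet"
begin

section \<open>Categories and bicategories\<close>

text \<open>
  The structure maps take the relevant objects as explicit arguments, and hom-sets need not be
  disjoint: \<open>cmp C x y z g f\<close> is the composite of \<open>f : x \<rightarrow> y\<close> with \<open>g : y \<rightarrow> z\<close>.
\<close>

record ('x, 'f) category =
  ob :: "'x set"
  mor :: "'x \<Rightarrow> 'x \<Rightarrow> 'f set"
  idn :: "'x \<Rightarrow> 'f"
  cmp :: "'x \<Rightarrow> 'x \<Rightarrow> 'x \<Rightarrow> 'f \<Rightarrow> 'f \<Rightarrow> 'f"

locale category =
  fixes C :: "('x, 'f) category"
  assumes idn_closed: "x \<in> ob C \<Longrightarrow> idn C x \<in> mor C x x"
    and cmp_closed:
      "\<lbrakk>x \<in> ob C; y \<in> ob C; z \<in> ob C; f \<in> mor C x y; g \<in> mor C y z\<rbrakk>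
        \<Longrightarrow> cmp C x y z g f \<in> mor C x z"
    and idn_left: "\<lbrakk>x \<in> ob C; y \<in> ob C; f \<in> mor C x y\<rbrakk> \<Longrightarrow> cmp C x y y (idn C y) f = f"
    and idn_right: "\<lbrakk>x \<in> ob C; y \<in> ob C; f \<in> mor C x y\<rbrakk> \<Longrightarrow> cmp C x x y f (idn C x) = f"
    and cmp_assoc:
      "\<lbrakk>w \<in> ob C; x \<in> ob C; y \<in> ob C; z \<in> ob C; f \<in> mor C w x; g \<in> mor C x y; h \<in> mor C y z\<rbrakk>
        \<Longrightarrow> cmp C w x z (cmp C x y z h g) f = cmp C w y z h (cmp C w x y g f)"

definition isos :: "('x, 'f) category \<Rightarrow> 'x \<Rightarrow> 'x \<Rightarrow> 'f set" where
  "isos C x y =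
    {f \<in> mor C x y. \<exists>g \<in> mor C y x. cmp C x y x g f = idn C x \<and> cmp C y x y f g = idn C y}"

definition prod_cat ::
    "('x, 'f) category \<Rightarrow> ('y, 'g) category \<Rightarrow> ('x \<times> 'y, 'f \<times> 'g) category" where
  "prod_cat C D =
    \<lparr>ob = ob C \<times> ob D,
     mor = (\<lambda>(x, y) (x', y'). mor C x x' \<times> mor D y y'),
     idn = (\<lambda>(x, y). (idn C x, idn D y)),
     cmp = (\<lambda>(x, y) (x', y') (x'', y'') (g, g') (f, f'). (cmp C x x' x'' g f, cmp D y y' y'' g' f'))\<rparr>"

definition is_functor ::
    "('x, 'f) category \<Rightarrow> ('y, 'g) category \<Rightarrow> ('x \<Rightarrow> 'y) \<Rightarrow> ('x \<Rightarrow> 'x \<Rightarrow> 'f \<Rightarrow> 'g) \<Rightarrow> bool" where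
  "is_functor C D F F' \<longleftrightarrow>
    (\<forall>x \<in> ob C. F x \<in> ob D) \<and>
    (\<forall>x \<in> ob C. \<forall>y \<in> ob C. \<forall>f \<in> mor C x y. F' x y f \<in> mor D (F x) (F y)) \<and>
    (\<forall>x \<in> ob C. F' x x (idn C x) = idn D (F x)) \<and>
    (\<forall>x \<in> ob C. \<forall>y \<in> ob C. \<forall>z \<in> ob C. \<forall>f \<in> mor C x y. \<forall>g \<in> mor C y z.
      F' x z (cmp C x y z g f) = cmp D (F x) (F y) (F z) (F' y z g) (F' x y f))"

text \<open>\<open>\<eta>\<close> is a natural isomorphism from the functor \<open>(F, F')\<close> to the functor \<open>(G, G')\<close>.\<close>

definition is_natural_iso ::
    "('x, 'f) category \<Rightarrow> ('y, 'g) category \<Rightarrow>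
     ('x \<Rightarrow> 'y) \<Rightarrow> ('x \<Rightarrow> 'x \<Rightarrow> 'f \<Rightarrow> 'g) \<Rightarrow> ('x \<Rightarrow> 'y) \<Rightarrow> ('x \<Rightarrow> 'x \<Rightarrow> 'f \<Rightarrow> 'g) \<Rightarrow>
     ('x \<Rightarrow> 'g) \<Rightarrow> bool" where
  "is_natural_iso C D F F' G G' \<eta> \<longleftrightarrow>
    (\<forall>x \<in> ob C. \<eta> x \<in> isos D (F x) (G x)) \<and>
    (\<forall>x \<in> ob C. \<forall>y \<in> ob C. \<forall>f \<in> mor C x y.
      cmp D (F x) (F y) (G y) (\<eta> y) (F' x y f) = cmp D (F x) (G x) (G y) (G' x y f) (\<eta> x))"

text \<open>
  For \<open>f : A \<rightarrow> B\<close> and \<open>g : B \<rightarrow> C\<close>, \<open>hcomp \<B> A B C (g, f)\<close> is the horizontal composite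
  \<open>g \<circ> f : A \<rightarrow> C\<close>, and \<open>hcomp2 \<B> A B C (g, f) (g', f') (\<beta>, \<alpha>)\<close> is the horizontal composite of
  \<open>\<alpha> : f \<Rightarrow> f'\<close> and \<open>\<beta> : g \<Rightarrow> g'\<close>.  The constraints are
  \<open>associator \<B> A B C D (h, g, f) : (h \<circ> g) \<circ> f \<Rightarrow> h \<circ> (g \<circ> f)\<close>,
  \<open>lunitor \<B> A B f : 1 \<circ> f \<Rightarrow> f\<close> and \<open>runitor \<B> A B f : f \<circ> 1 \<Rightarrow> f\<close>.
\<close>

record ('o, 'x, 'f) bicategory =
  obj :: "'o set"
  hom_cat :: "'o \<Rightarrow> 'o \<Rightarrow> ('x, 'f) category"
  one_cell :: "'o \<Rightarrow> 'x"
  hcomp :: "'o \<Rightarrow> 'o \<Rightarrow> 'o \<Rightarrow> 'x \<times> 'x \<Rightarrow> 'x"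
  hcomp2 :: "'o \<Rightarrow> 'o \<Rightarrow> 'o \<Rightarrow> 'x \<times> 'x \<Rightarrow> 'x \<times> 'x \<Rightarrow> 'f \<times> 'f \<Rightarrow> 'f"
  associator :: "'o \<Rightarrow> 'o \<Rightarrow> 'o \<Rightarrow> 'o \<Rightarrow> 'x \<times> 'x \<times> 'x \<Rightarrow> 'f"
  lunitor :: "'o \<Rightarrow> 'o \<Rightarrow> 'x \<Rightarrow> 'f"
  runitor :: "'o \<Rightarrow> 'o \<Rightarrow> 'x \<Rightarrow> 'f"

locale bicategory =
  fixes \<B> :: "('o, 'x, 'f) bicategory"
  assumes category_hom: "\<lbrakk>A \<in> obj \<B>; B \<in> obj \<B>\<rbrakk> \<Longrightarrow> category (hom_cat \<B> A B)"
    and one_cell_closed: "A \<in> obj \<B> \<Longrightarrow> one_cell \<B> A \<in> ob (hom_cat \<B> A A)"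
    and functor_hcomp:
      "\<lbrakk>A \<in> obj \<B>; B \<in> obj \<B>; C \<in> obj \<B>\<rbrakk> \<Longrightarrow>
        is_functor (prod_cat (hom_cat \<B> B C) (hom_cat \<B> A B)) (hom_cat \<B> A C)
          (hcomp \<B> A B C) (hcomp2 \<B> A B C)"
    and natural_iso_associator:
      "\<lbrakk>A \<in> obj \<B>; B \<in> obj \<B>; C \<in> obj \<B>; D \<in> obj \<B>\<rbrakk> \<Longrightarrow>
        is_natural_iso
          (prod_cat (hom_cat \<B> C D) (prod_cat (hom_cat \<B> B C) (hom_cat \<B> A B))) (hom_cat \<B> A D)
          (\<lambda>(h, g, f). hcomp \<B> A B D (hcomp \<B> B C D (h, g), f))
          (\<lambda>(h, g, f) (h', g', f') (\<gamma>, \<beta>, \<alpha>).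
            hcomp2 \<B> A B D (hcomp \<B> B C D (h, g), f) (hcomp \<B> B C D (h', g'), f')
              (hcomp2 \<B> B C D (h, g) (h', g') (\<gamma>, \<beta>), \<alpha>))
          (\<lambda>(h, g, f). hcomp \<B> A C D (h, hcomp \<B> A B C (g, f)))
          (\<lambda>(h, g, f) (h', g', f') (\<gamma>, \<beta>, \<alpha>).
            hcomp2 \<B> A C D (h, hcomp \<B> A B C (g, f)) (h', hcomp \<B> A B C (g', f'))
              (\<gamma>, hcomp2 \<B> A B C (g, f) (g', f') (\<beta>, \<alpha>)))
          (associator \<B> A B C D)"
    and natural_iso_lunitor:
      "\<lbrakk>A \<in> obj \<B>; B \<in> obj \<B>\<rbrakk> \<Longrightarrow>
        is_natural_iso (hom_cat \<B> A B) (hom_cat \<B> A B)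
          (\<lambda>f. hcomp \<B> A B B (one_cell \<B> B, f))
          (\<lambda>f f' \<alpha>. hcomp2 \<B> A B B (one_cell \<B> B, f) (one_cell \<B> B, f')
            (idn (hom_cat \<B> B B) (one_cell \<B> B), \<alpha>))
          (\<lambda>f. f) (\<lambda>f f' \<alpha>. \<alpha>)
          (lunitor \<B> A B)"
    and natural_iso_runitor:
      "\<lbrakk>A \<in> obj \<B>; B \<in> obj \<B>\<rbrakk> \<Longrightarrow>
        is_natural_iso (hom_cat \<B> A B) (hom_cat \<B> A B)
          (\<lambda>f. hcomp \<B> A A B (f, one_cell \<B> A))
          (\<lambda>f f' \<alpha>. hcomp2 \<B> A A B (f, one_cell \<B> A) (f', one_cell \<B> A)
            (\<alpha>, idn (hom_cat \<B> A A) (one_cell \<B> A)))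
          (\<lambda>f. f) (\<lambda>f f' \<alpha>. \<alpha>)
          (runitor \<B> A B)"
    and pentagon:
      "\<lbrakk>A \<in> obj \<B>; B \<in> obj \<B>; C \<in> obj \<B>; D \<in> obj \<B>; E \<in> obj \<B>;
        f \<in> ob (hom_cat \<B> A B); g \<in> ob (hom_cat \<B> B C);
        h \<in> ob (hom_cat \<B> C D); l \<in> ob (hom_cat \<B> D E)\<rbrakk> \<Longrightarrow>
        cmp (hom_cat \<B> A E)
          (hcomp \<B> A B E (hcomp \<B> B C E (hcomp \<B> C D E (l, h), g), f))
          (hcomp \<B> A C E (hcomp \<B> C D E (l, h), hcomp \<B> A B C (g, f)))
          (hcomp \<B> A D E (l, hcomp \<B> A C D (h, hcomp \<B> A B C (g, f))))
          (associator \<B> A C D E (l, h, hcomp \<B> A B C (g, f)))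
          (associator \<B> A B C E (hcomp \<B> C D E (l, h), g, f))
        =
        cmp (hom_cat \<B> A E)
          (hcomp \<B> A B E (hcomp \<B> B C E (hcomp \<B> C D E (l, h), g), f))
          (hcomp \<B> A D E (l, hcomp \<B> A B D (hcomp \<B> B C D (h, g), f)))
          (hcomp \<B> A D E (l, hcomp \<B> A C D (h, hcomp \<B> A B C (g, f))))
          (hcomp2 \<B> A D E
            (l, hcomp \<B> A B D (hcomp \<B> B C D (h, g), f))
            (l, hcomp \<B> A C D (h, hcomp \<B> A B C (g, f)))
            (idn (hom_cat \<B> D E) l, associator \<B> A B C D (h, g, f)))
          (cmp (hom_cat \<B> A E)
            (hcomp \<B> A B E (hcomp \<B> B C E (hcomp \<B> C D E (l, h), g), f))
            (hcomp \<B> A B E (hcomp \<B> B D E (l, hcomp \<B> B C D (h, g)), f))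
            (hcomp \<B> A D E (l, hcomp \<B> A B D (hcomp \<B> B C D (h, g), f)))
            (associator \<B> A B D E (l, hcomp \<B> B C D (h, g), f))
            (hcomp2 \<B> A B E
              (hcomp \<B> B C E (hcomp \<B> C D E (l, h), g), f)
              (hcomp \<B> B D E (l, hcomp \<B> B C D (h, g)), f)
              (associator \<B> B C D E (l, h, g), idn (hom_cat \<B> A B) f)))"
    and triangle:
      "\<lbrakk>A \<in> obj \<B>; B \<in> obj \<B>; C \<in> obj \<B>; f \<in> ob (hom_cat \<B> A B); g \<in> ob (hom_cat \<B> B C)\<rbrakk> \<Longrightarrow>
        cmp (hom_cat \<B> A C)
          (hcomp \<B> A B C (hcomp \<B> B B C (g, one_cell \<B> B), f))
          (hcomp \<B> A B C (g, hcomp \<B> A B B (one_cell \<B> B, f)))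
          (hcomp \<B> A B C (g, f))
          (hcomp2 \<B> A B C (g, hcomp \<B> A B B (one_cell \<B> B, f)) (g, f)
            (idn (hom_cat \<B> B C) g, lunitor \<B> A B f))
          (associator \<B> A B B C (g, one_cell \<B> B, f))
        =
        hcomp2 \<B> A B C (hcomp \<B> B B C (g, one_cell \<B> B), f) (g, f)
          (runitor \<B> B C g, idn (hom_cat \<B> A B) f)"


section \<open>Linear maps and tensor products\<close>

text \<open>
  Vector spaces over a field \<open>K\<close> are modules over \<open>K\<close> in the sense of HOL-Algebra; the fields
  \<open>mult\<close> and \<open>one\<close> of the record are ignored unless the space is an algebra.  All maps are
  extensional, so that maps which agree on the carrier are equal.
\<close>

definition lin_maps ::
    "('k, 'r) ring_scheme \<Rightarrow> ('k, 'u, 'm) module_scheme \<Rightarrow> ('k, 'v, 'n) module_scheme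
      \<Rightarrow> ('u \<Rightarrow> 'v) set" where
  "lin_maps K V W =
    {f \<in> carrier V \<rightarrow>\<^sub>E carrier W.
      (\<forall>x \<in> carrier V. \<forall>y \<in> carrier V. f (x \<oplus>\<^bsub>V\<^esub> y) = f x \<oplus>\<^bsub>W\<^esub> f y) \<and>
      (\<forall>c \<in> carrier K. \<forall>x \<in> carrier V. f (c \<odot>\<^bsub>V\<^esub> x) = c \<odot>\<^bsub>W\<^esub> f x)}"

definition hom_module ::
    "('k, 'r) ring_scheme \<Rightarrow> ('k, 'u, 'm) module_scheme \<Rightarrow> ('k, 'v, 'n) module_scheme
      \<Rightarrow> ('k, 'u \<Rightarrow> 'v) module" where
  "hom_module K V W =
    \<lparr>carrier = lin_maps K V W, monoid.mult = undefined, one = undefined,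
     zero = (\<lambda>v \<in> carrier V. \<zero>\<^bsub>W\<^esub>),
     add = (\<lambda>f g. \<lambda>v \<in> carrier V. f v \<oplus>\<^bsub>W\<^esub> g v),
     smult = (\<lambda>c f. \<lambda>v \<in> carrier V. c \<odot>\<^bsub>W\<^esub> f v)\<rparr>"

definition base_module :: "('k, 'r) ring_scheme \<Rightarrow> ('k, 'k) module" where
  "base_module K =
    \<lparr>carrier = carrier K, monoid.mult = monoid.mult K, one = \<one>\<^bsub>K\<^esub>,
     zero = \<zero>\<^bsub>K\<^esub>, add = add K, smult = monoid.mult K\<rparr>"

text \<open>
  A universe of elements closed under tensor products.  It contains the elements of an arbitrary
  type \<open>'a\<close>, a copy of the ground field, and formal sums \<open>\<Sum>\<^sub>i v\<^sub>i \<otimes> w\<^sub>i\<close>, written as the list of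
  the pairs \<open>(v\<^sub>i, w\<^sub>i)\<close>.  The algebras and coalgebras considered below have their carriers
  in such a universe.
\<close>

datatype ('k, 'a) univ = Elem 'a | Scal 'k | Tens "(('k, 'a) univ \<times> ('k, 'a) univ) list"

primrec formal_sum :: "('k, 'a) univ \<Rightarrow> (('k, 'a) univ \<times> ('k, 'a) univ) list" where
  "formal_sum (Tens xs) = xs"
| "formal_sum (Elem a) = undefined"
| "formal_sum (Scal c) = undefined"

primrec scalar :: "('k, 'a) univ \<Rightarrow> 'k" where
  "scalar (Scal c) = c"
| "scalar (Elem a) = undefined"
| "scalar (Tens xs) = undefined"

text \<open>
  The congruence on formal sums whose quotient is \<open>V \<otimes> W\<close>.  The rule \<open>zero\<close>, together with
  additivity, makes the quotient a group.
\<close>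

inductive tensor_rel ::
    "('k, 'r) ring_scheme \<Rightarrow> ('k, 'u, 'm) module_scheme \<Rightarrow> ('k, 'v, 'n) module_scheme
      \<Rightarrow> ('u \<times> 'v) list \<Rightarrow> ('u \<times> 'v) list \<Rightarrow> bool"
  for K V W where
    refl: "set xs \<subseteq> carrier V \<times> carrier W \<Longrightarrow> tensor_rel K V W xs xs"
  | sym: "tensor_rel K V W xs ys \<Longrightarrow> tensor_rel K V W ys xs"
  | trans: "\<lbrakk>tensor_rel K V W xs ys; tensor_rel K V W ys zs\<rbrakk> \<Longrightarrow> tensor_rel K V W xs zs"
  | append: "\<lbrakk>tensor_rel K V W xs xs'; tensor_rel K V W ys ys'\<rbrakk>
      \<Longrightarrow> tensor_rel K V W (xs @ ys) (xs' @ ys')"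
  | commute: "\<lbrakk>set xs \<subseteq> carrier V \<times> carrier W; set ys \<subseteq> carrier V \<times> carrier W\<rbrakk>
      \<Longrightarrow> tensor_rel K V W (xs @ ys) (ys @ xs)"
  | zero: "w \<in> carrier W \<Longrightarrow> tensor_rel K V W [(\<zero>\<^bsub>V\<^esub>, w)] []"
  | add_left: "\<lbrakk>v \<in> carrier V; v' \<in> carrier V; w \<in> carrier W\<rbrakk>
      \<Longrightarrow> tensor_rel K V W [(v \<oplus>\<^bsub>V\<^esub> v', w)] [(v, w), (v', w)]"
  | add_right: "\<lbrakk>v \<in> carrier V; w \<in> carrier W; w' \<in> carrier W\<rbrakk>
      \<Longrightarrow> tensor_rel K V W [(v, w \<oplus>\<^bsub>W\<^esub> w')] [(v, w), (v, w')]"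
  | balanced: "\<lbrakk>c \<in> carrier K; v \<in> carrier V; w \<in> carrier W\<rbrakk>
      \<Longrightarrow> tensor_rel K V W [(c \<odot>\<^bsub>V\<^esub> v, w)] [(v, c \<odot>\<^bsub>W\<^esub> w)]"

text \<open>The element of \<open>V \<otimes> W\<close> denoted by a formal sum: a chosen member of its equivalence class.\<close>

definition tclass ::
    "('k, 'r) ring_scheme \<Rightarrow> ('k, ('k, 'a) univ, 'm) module_scheme
      \<Rightarrow> ('k, ('k, 'a) univ, 'n) module_scheme
      \<Rightarrow> (('k, 'a) univ \<times> ('k, 'a) univ) list \<Rightarrow> ('k, 'a) univ" where
  "tclass K V W xs = Tens (SOME ys. tensor_rel K V W xs ys)"

definition pure ::
    "('k, 'r) ring_scheme \<Rightarrow> ('k, ('k, 'a) univ, 'm) module_scheme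
      \<Rightarrow> ('k, ('k, 'a) univ, 'n) module_scheme
      \<Rightarrow> ('k, 'a) univ \<Rightarrow> ('k, 'a) univ \<Rightarrow> ('k, 'a) univ" where
  "pure K V W v w = tclass K V W [(v, w)]"

text \<open>
  The tensor product of vector spaces and, with the product
  \<open>(v \<otimes> w)(v' \<otimes> w') = vv' \<otimes> ww'\<close> and unit \<open>1 \<otimes> 1\<close>, the tensor product of algebras.
\<close>

definition tensor ::
    "('k, 'r) ring_scheme \<Rightarrow> ('k, ('k, 'a) univ, 'm) module_scheme
      \<Rightarrow> ('k, ('k, 'a) univ, 'n) module_scheme \<Rightarrow> ('k, ('k, 'a) univ) module" where
  "tensor K V W =
    \<lparr>carrier = tclass K V W ` {xs. set xs \<subseteq> carrier V \<times> carrier W},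
     monoid.mult = (\<lambda>x y. tclass K V W
       [(v \<otimes>\<^bsub>V\<^esub> v', w \<otimes>\<^bsub>W\<^esub> w'). (v, w) \<leftarrow> formal_sum x, (v', w') \<leftarrow> formal_sum y]),
     one = pure K V W \<one>\<^bsub>V\<^esub> \<one>\<^bsub>W\<^esub>,
     zero = tclass K V W [],
     add = (\<lambda>x y. tclass K V W (formal_sum x @ formal_sum y)),
     smult = (\<lambda>c x. tclass K V W [(c \<odot>\<^bsub>V\<^esub> v, w). (v, w) \<leftarrow> formal_sum x])\<rparr>"

text \<open>\<open>\<Sum>\<^sub>i \<beta> v\<^sub>i w\<^sub>i \<in> M\<close> for \<open>x = \<Sum>\<^sub>i v\<^sub>i \<otimes> w\<^sub>i\<close>; independent of the representative if \<open>\<beta>\<close> is bilinear.\<close>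

definition tensor_sum ::
    "('k, 'w, 'm) module_scheme \<Rightarrow> (('k, 'a) univ \<Rightarrow> ('k, 'a) univ \<Rightarrow> 'w)
      \<Rightarrow> ('k, 'a) univ \<Rightarrow> 'w" where
  "tensor_sum M \<beta> x = foldr (\<lambda>(v, w) s. \<beta> v w \<oplus>\<^bsub>M\<^esub> s) (formal_sum x) \<zero>\<^bsub>M\<^esub>"

definition tensor_lift ::
    "('k, 'r) ring_scheme \<Rightarrow> ('k, ('k, 'a) univ, 'm) module_scheme
      \<Rightarrow> ('k, ('k, 'a) univ, 'n) module_scheme \<Rightarrow> ('k, 'w, 'p) module_scheme
      \<Rightarrow> (('k, 'a) univ \<Rightarrow> ('k, 'a) univ \<Rightarrow> 'w) \<Rightarrow> ('k, 'a) univ \<Rightarrow> 'w" where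
  "tensor_lift K V W M \<beta> = (\<lambda>x \<in> carrier (tensor K V W). tensor_sum M \<beta> x)"

text \<open>\<open>f \<otimes> g : V \<otimes> W \<rightarrow> V' \<otimes> W'\<close>\<close>

definition tensor_map ::
    "('k, 'r) ring_scheme \<Rightarrow> ('k, ('k, 'a) univ, 'm) module_scheme
      \<Rightarrow> ('k, ('k, 'a) univ, 'n) module_scheme \<Rightarrow> ('k, ('k, 'a) univ, 'm') module_scheme
      \<Rightarrow> ('k, ('k, 'a) univ, 'n') module_scheme
      \<Rightarrow> (('k, 'a) univ \<Rightarrow> ('k, 'a) univ) \<Rightarrow> (('k, 'a) univ \<Rightarrow> ('k, 'a) univ)
      \<Rightarrow> ('k, 'a) univ \<Rightarrow> ('k, 'a) univ" where
  "tensor_map K V W V' W' f g =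
    tensor_lift K V W (tensor K V' W') (\<lambda>v w. pure K V' W' (f v) (g w))"

text \<open>\<open>(U \<otimes> V) \<otimes> W \<rightarrow> U \<otimes> (V \<otimes> W)\<close> and its inverse\<close>

definition tensor_assoc ::
    "('k, 'r) ring_scheme \<Rightarrow> ('k, ('k, 'a) univ, 'l) module_scheme
      \<Rightarrow> ('k, ('k, 'a) univ, 'm) module_scheme \<Rightarrow> ('k, ('k, 'a) univ, 'n) module_scheme
      \<Rightarrow> ('k, 'a) univ \<Rightarrow> ('k, 'a) univ" where
  "tensor_assoc K U V W =
    tensor_lift K (tensor K U V) W (tensor K U (tensor K V W))
      (\<lambda>p w. tensor_lift K U V (tensor K U (tensor K V W))
        (\<lambda>u v. pure K U (tensor K V W) u (pure K V W v w)) p)"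

definition tensor_assoc_inv ::
    "('k, 'r) ring_scheme \<Rightarrow> ('k, ('k, 'a) univ, 'l) module_scheme
      \<Rightarrow> ('k, ('k, 'a) univ, 'm) module_scheme \<Rightarrow> ('k, ('k, 'a) univ, 'n) module_scheme
      \<Rightarrow> ('k, 'a) univ \<Rightarrow> ('k, 'a) univ" where
  "tensor_assoc_inv K U V W =
    tensor_lift K U (tensor K V W) (tensor K (tensor K U V) W)
      (\<lambda>u p. tensor_lift K V W (tensor K (tensor K U V) W)
        (\<lambda>v w. pure K (tensor K U V) W (pure K U V u v) w) p)"


section \<open>Algebras and coalgebras\<close>

locale k_algebra = module K A + A: ring A
  for K :: "('k, 'r) ring_scheme" (structure) and A :: "('k, 'u, 'm) module_scheme" (structure) +
  assumes smult_mult_left: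
      "\<lbrakk>c \<in> carrier K; x \<in> carrier A; y \<in> carrier A\<rbrakk>
        \<Longrightarrow> (c \<odot>\<^bsub>A\<^esub> x) \<otimes>\<^bsub>A\<^esub> y = c \<odot>\<^bsub>A\<^esub> (x \<otimes>\<^bsub>A\<^esub> y)"
    and smult_mult_right:
      "\<lbrakk>c \<in> carrier K; x \<in> carrier A; y \<in> carrier A\<rbrakk>
        \<Longrightarrow> x \<otimes>\<^bsub>A\<^esub> (c \<odot>\<^bsub>A\<^esub> y) = c \<odot>\<^bsub>A\<^esub> (x \<otimes>\<^bsub>A\<^esub> y)"

definition alg_homs ::
    "('k, 'r) ring_scheme \<Rightarrow> ('k, 'u, 'm) module_scheme \<Rightarrow> ('k, 'v, 'n) module_scheme
      \<Rightarrow> ('u \<Rightarrow> 'v) set" where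
  "alg_homs K A B = lin_maps K A B \<inter> ring_hom A B"

text \<open>The ground field, as an algebra in the universe.\<close>

definition unit_algebra :: "('k, 'r) ring_scheme \<Rightarrow> ('k, ('k, 'a) univ) module" where
  "unit_algebra K =
    \<lparr>carrier = Scal ` carrier K,
     monoid.mult = (\<lambda>x y. Scal (scalar x \<otimes>\<^bsub>K\<^esub> scalar y)), one = Scal \<one>\<^bsub>K\<^esub>,
     zero = Scal \<zero>\<^bsub>K\<^esub>, add = (\<lambda>x y. Scal (scalar x \<oplus>\<^bsub>K\<^esub> scalar y)),
     smult = (\<lambda>c x. Scal (c \<otimes>\<^bsub>K\<^esub> scalar x))\<rparr>"

record ('k, 'u) coalgebra = "('k, 'u) module" +
  comul :: "'u \<Rightarrow> 'u"
  counit :: "'u \<Rightarrow> 'k"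

locale coalgebra = module K H
  for K :: "('k, 'r) ring_scheme" (structure) and H :: "('k, ('k, 'a) univ) coalgebra" (structure) +
  assumes comul_linear:
      "restrict (comul H) (carrier H) \<in> lin_maps K H (tensor K H H)"
    and counit_linear:
      "restrict (counit H) (carrier H) \<in> lin_maps K H (base_module K)"
    and coassoc:
      "h \<in> carrier H \<Longrightarrow>
        tensor_assoc K H H H (tensor_map K H H (tensor K H H) H (comul H) id (comul H h)) =
        tensor_map K H H H (tensor K H H) id (comul H) (comul H h)"
    and counit_left:
      "h \<in> carrier H \<Longrightarrow> tensor_sum H (\<lambda>x y. counit H x \<odot>\<^bsub>H\<^esub> y) (comul H h) = h"
    and counit_right:
      "h \<in> carrier H \<Longrightarrow> tensor_sum H (\<lambda>x y. counit H y \<odot>\<^bsub>H\<^esub> x) (comul H h) = h"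

definition coalg_homs ::
    "('k, 'r) ring_scheme \<Rightarrow> ('k, ('k, 'a) univ) coalgebra \<Rightarrow> ('k, ('k, 'a) univ) coalgebra
      \<Rightarrow> (('k, 'a) univ \<Rightarrow> ('k, 'a) univ) set" where
  "coalg_homs K H H' =
    {\<tau> \<in> lin_maps K H H'.
      (\<forall>h \<in> carrier H. comul H' (\<tau> h) = tensor_map K H H H' H' \<tau> \<tau> (comul H h)) \<and>
      (\<forall>h \<in> carrier H. counit H' (\<tau> h) = counit H h)}"

text \<open>
  If \<open>\<triangle>x = \<Sum> x\<^sub>1 \<otimes> x\<^sub>2\<close> and \<open>\<triangle>y = \<Sum> y\<^sub>1 \<otimes> y\<^sub>2\<close>, then
  \<open>\<triangle>(x \<otimes> y) = \<Sum> (x\<^sub>1 \<otimes> y\<^sub>1) \<otimes> (x\<^sub>2 \<otimes> y\<^sub>2)\<close> and \<open>\<epsilon>(x \<otimes> y) = \<epsilon>(x)\<epsilon>(y)\<close>.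
\<close>

definition coalg_tensor ::
    "('k, 'r) ring_scheme \<Rightarrow> ('k, ('k, 'a) univ) coalgebra \<Rightarrow> ('k, ('k, 'a) univ) coalgebra
      \<Rightarrow> ('k, ('k, 'a) univ) coalgebra" where
  "coalg_tensor K C D =
    (let T = tensor K C D; TT = tensor K T T in
     module.extend T (coalgebra.fields
       (tensor_lift K C D TT (\<lambda>x y.
          tensor_sum TT (\<lambda>x1 x2.
            tensor_sum TT (\<lambda>y1 y2. pure K T T (pure K C D x1 y1) (pure K C D x2 y2))
              (comul D y))
            (comul C x)))
       (tensor_lift K C D (base_module K) (\<lambda>x y. counit C x \<otimes>\<^bsub>K\<^esub> counit D y))))"

text \<open>The coalgebra \<open>ke\<close>, with \<open>ce\<close> represented by \<open>Scal c\<close>.\<close>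

definition unit_coalgebra :: "('k, 'r) ring_scheme \<Rightarrow> ('k, ('k, 'a) univ) coalgebra" where
  "unit_coalgebra K =
    (let I = unit_algebra K in
     module.extend I (coalgebra.fields (\<lambda>x. pure K I I x (Scal \<one>\<^bsub>K\<^esub>)) scalar))"


section \<open>The bicategory of measuring coalgebras\<close>

text \<open>
  In Sweedler notation \<open>\<triangle>h = \<Sum> h\<^sub>(\<^sub>2\<^sub>) \<otimes> h\<^sub>(\<^sub>1\<^sub>)\<close>, so in \<open>\<rho>(h)(aa')\<close> the left tensor factor of \<open>\<triangle>h\<close>
  acts on \<open>a\<close> and the right one on \<open>a'\<close>.
\<close>

definition measures ::
    "('k, 'r) ring_scheme \<Rightarrow> ('k, 'u, 'm) module_scheme \<Rightarrow> ('k, 'v, 'n) module_scheme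
      \<Rightarrow> ('k, ('k, 'a) univ) coalgebra \<Rightarrow> (('k, 'a) univ \<Rightarrow> 'u \<Rightarrow> 'v) \<Rightarrow> bool" where
  "measures K A B H \<rho> \<longleftrightarrow>
    \<rho> \<in> lin_maps K H (hom_module K A B) \<and>
    (\<forall>h \<in> carrier H. \<forall>a \<in> carrier A. \<forall>a' \<in> carrier A.
      \<rho> h (a \<otimes>\<^bsub>A\<^esub> a') = tensor_sum B (\<lambda>x y. \<rho> x a \<otimes>\<^bsub>B\<^esub> \<rho> y a') (comul H h)) \<and>
    (\<forall>h \<in> carrier H. \<rho> h \<one>\<^bsub>A\<^esub> = counit H h \<odot>\<^bsub>B\<^esub> \<one>\<^bsub>B\<^esub>)"

type_synonym ('k, 'a) meas_cell =
  "('k, ('k, 'a) univ) coalgebra \<times> (('k, 'a) univ \<Rightarrow> ('k, 'a) univ \<Rightarrow> ('k, 'a) univ)"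

definition meas_cat ::
    "('k, 'r) ring_scheme \<Rightarrow> ('k, ('k, 'a) univ) module \<Rightarrow> ('k, ('k, 'a) univ) module
      \<Rightarrow> (('k, 'a) meas_cell, ('k, 'a) univ \<Rightarrow> ('k, 'a) univ) category" where
  "meas_cat K A B =
    \<lparr>ob = {(H, \<rho>). coalgebra K H \<and> measures K A B H \<rho>},
     mor = (\<lambda>(H1, \<rho>1) (H2, \<rho>2). {\<tau> \<in> coalg_homs K H1 H2. compose (carrier H1) \<rho>2 \<tau> = \<rho>1}),
     idn = (\<lambda>(H, \<rho>). \<lambda>h \<in> carrier H. h),
     cmp = (\<lambda>(H1, \<rho>1) (H2, \<rho>2) (H3, \<rho>3) \<tau>' \<tau>. compose (carrier H1) \<tau>' \<tau>)\<rparr>"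

type_synonym ('k, 'a) meas_bicategory =
  "(('k, ('k, 'a) univ) module, ('k, 'a) meas_cell, ('k, 'a) univ \<Rightarrow> ('k, 'a) univ) bicategory"

definition Alg_check :: "('k, 'r) ring_scheme \<Rightarrow> ('k, 'a) meas_bicategory" where
  "Alg_check K =
    \<lparr>obj = {A. k_algebra K A},
     hom_cat = meas_cat K,
     one_cell = (\<lambda>A. (unit_coalgebra K,
       \<lambda>x \<in> carrier (unit_coalgebra K). \<lambda>a \<in> carrier A. scalar x \<odot>\<^bsub>A\<^esub> a)),
     hcomp = (\<lambda>A B C ((L, \<psi>), (H, \<phi>)). (coalg_tensor K L H,
       tensor_lift K L H (hom_module K A C) (\<lambda>y h. compose (carrier A) (\<psi> y) (\<phi> h)))),
     hcomp2 = (\<lambda>A B C ((L, \<psi>), (H, \<phi>)) ((L', \<psi>'), (H', \<phi>')) (\<beta>, \<alpha>).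
       tensor_map K L H L' H' \<beta> \<alpha>),
     associator = (\<lambda>A B C D ((M, \<chi>), (L, \<psi>), (H, \<phi>)). tensor_assoc K M L H),
     lunitor = (\<lambda>A B (H, \<phi>). tensor_lift K (unit_coalgebra K) H H (\<lambda>x h. scalar x \<odot>\<^bsub>H\<^esub> h)),
     runitor = (\<lambda>A B (H, \<phi>). tensor_lift K H (unit_coalgebra K) H (\<lambda>h x. scalar x \<odot>\<^bsub>H\<^esub> h))\<rparr>"


section \<open>The bicategory of extensions\<close>

type_synonym ('k, 'a) ext_cell =
  "('k, ('k, 'a) univ) module \<times> (('k, 'a) univ \<Rightarrow> ('k, 'a) univ)"

definition ext_cat ::
    "('k, 'r) ring_scheme \<Rightarrow> ('k, ('k, 'a) univ) module \<Rightarrow> ('k, ('k, 'a) univ) module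
      \<Rightarrow> (('k, 'a) ext_cell, ('k, 'a) univ \<Rightarrow> ('k, 'a) univ) category" where
  "ext_cat K A B =
    \<lparr>ob = {(S, \<sigma>). k_algebra K S \<and> \<sigma> \<in> alg_homs K A (tensor K S B)},
     mor = (\<lambda>(S1, \<sigma>1) (S2, \<sigma>2).
       {\<theta> \<in> alg_homs K S1 S2. compose (carrier A) (tensor_map K S1 B S2 B \<theta> id) \<sigma>1 = \<sigma>2}),
     idn = (\<lambda>(S, \<sigma>). \<lambda>s \<in> carrier S. s),
     cmp = (\<lambda>(S1, \<sigma>1) (S2, \<sigma>2) (S3, \<sigma>3) \<theta>' \<theta>. compose (carrier S1) \<theta>' \<theta>)\<rparr>"

type_synonym ('k, 'a) ext_bicategory =
  "(('k, ('k, 'a) univ) module, ('k, 'a) ext_cell, ('k, 'a) univ \<Rightarrow> ('k, 'a) univ) bicategory"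

text \<open>
  The composite of \<open>(S, \<sigma>) : A \<rightarrow> B\<close> with \<open>(T, \<tau>) : B \<rightarrow> C\<close> is \<open>S \<otimes> T\<close>, with the tensor factors in
  diagrammatic order; \<open>(1 \<otimes> \<tau>) \<circ> \<sigma>\<close> takes values in \<open>S \<otimes> (T \<otimes> C)\<close> and is followed by the
  identification with \<open>(S \<otimes> T) \<otimes> C\<close>.
\<close>

definition Alg_hat :: "('k, 'r) ring_scheme \<Rightarrow> ('k, 'a) ext_bicategory" where
  "Alg_hat K =
    \<lparr>obj = {A. k_algebra K A},
     hom_cat = ext_cat K,
     one_cell = (\<lambda>A. (unit_algebra K, \<lambda>a \<in> carrier A. pure K (unit_algebra K) A (Scal \<one>\<^bsub>K\<^esub>) a)),
     hcomp = (\<lambda>A B C ((T, \<tau>), (S, \<sigma>)). (tensor K S T,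
       compose (carrier A) (tensor_assoc_inv K S T C)
         (compose (carrier A) (tensor_map K S B S (tensor K T C) id \<tau>) \<sigma>))),
     hcomp2 = (\<lambda>A B C ((T, \<tau>), (S, \<sigma>)) ((T', \<tau>'), (S', \<sigma>')) (\<beta>, \<alpha>).
       tensor_map K S T S' T' \<alpha> \<beta>),
     associator = (\<lambda>A B C D ((U, \<upsilon>), (T, \<tau>), (S, \<sigma>)). tensor_assoc_inv K S T U),
     lunitor = (\<lambda>A B (S, \<sigma>). tensor_lift K S (unit_algebra K) S (\<lambda>s x. scalar x \<odot>\<^bsub>S\<^esub> s)),
     runitor = (\<lambda>A B (S, \<sigma>). tensor_lift K (unit_algebra K) S S (\<lambda>x s. scalar x \<odot>\<^bsub>S\<^esub> s))\<rparr>"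

end

theory Submission
  imports Defs
begin

text \<open>
  A linear map out of \<open>V \<otimes> W\<close> is determined by its values on pure tensors, so both sides of every
  coherence law, of every naturality square and of every compatibility condition are linear maps which
  need only be compared on pure tensors, where the values are explicit.  For measuring coalgebras the
  comultiplication of an element is a sum of pure tensors; \<open>tensor_sum M \<beta> (comul H h)\<close> is the
  Sweedler sum \<open>\<Sum> \<beta>(h\<^sub>1, h\<^sub>2)\<close>, which commutes with linear maps and with other such sums.
  Invertibility of the constraints is only needed linearly, because the linear inverse of a
  morphism of (co)algebras is again one.
\<close>

section \<open>Linear and bilinear maps\<close>

text \<open>Two encodings shape the work. An element of V \<otimes> W is a chosen list of pairs, so
  \<open>tensor_sum\<close> and the product of \<open>tensor\<close> compute on one representative
  among many; bilinearity is what makes the result independent of it, and linearity conditions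
  therefore accompany almost every step and have introduction rules of their own. The laws of a
  bicategory are equations between functions, and the 2-cells of both bicategories are extensional
  linear maps composed by \<open>compose\<close>, so each coherence law can be proved once, for
  tensor products, before any multiplication or comultiplication enters. The two bicategories then
  differ in the order of the factors: a composite of measuring coalgebras puts the later 1-cell on
  the left, a composite of extensions on the right. This inverts the associator and exchanges the
  unitors, whence the paired statements for \<open>tensor_assoc\<close> and
  \<open>tensor_assoc_inv\<close>. Peculiar to extensions is that \<sigma>(a) is an arbitrary
  element of S \<otimes> B, which has to be generalised to a variable before linearity
  applies.\<close>

definition linear_map ::
    "('k, 'r) ring_scheme \<Rightarrow> ('k, 'u, 'm) module_scheme \<Rightarrow> ('k, 'v, 'n) module_scheme
      \<Rightarrow> ('u \<Rightarrow> 'v) \<Rightarrow> bool" where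
  "linear_map K V W f \<longleftrightarrow>
    (\<forall>x \<in> carrier V. f x \<in> carrier W) \<and>
    (\<forall>x \<in> carrier V. \<forall>y \<in> carrier V. f (x \<oplus>\<^bsub>V\<^esub> y) = f x \<oplus>\<^bsub>W\<^esub> f y) \<and>
    (\<forall>c \<in> carrier K. \<forall>x \<in> carrier V. f (c \<odot>\<^bsub>V\<^esub> x) = c \<odot>\<^bsub>W\<^esub> f x)"

definition bilinear_map ::
    "('k, 'r) ring_scheme \<Rightarrow> ('k, 'u, 'm) module_scheme \<Rightarrow> ('k, 'v, 'n) module_scheme
      \<Rightarrow> ('k, 'w, 'p) module_scheme \<Rightarrow> ('u \<Rightarrow> 'v \<Rightarrow> 'w) \<Rightarrow> bool" where
  "bilinear_map K V W M \<beta> \<longleftrightarrow>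
    (\<forall>v \<in> carrier V. linear_map K W M (\<beta> v)) \<and>
    (\<forall>w \<in> carrier W. linear_map K V M (\<lambda>v. \<beta> v w))"

lemma linear_mapI:
  assumes "\<And>x. x \<in> carrier V \<Longrightarrow> f x \<in> carrier W"
    and "\<And>x y. \<lbrakk>x \<in> carrier V; y \<in> carrier V\<rbrakk> \<Longrightarrow> f (x \<oplus>\<^bsub>V\<^esub> y) = f x \<oplus>\<^bsub>W\<^esub> f y"
    and "\<And>c x. \<lbrakk>c \<in> carrier K; x \<in> carrier V\<rbrakk> \<Longrightarrow> f (c \<odot>\<^bsub>V\<^esub> x) = c \<odot>\<^bsub>W\<^esub> f x"
  shows "linear_map K V W f"
  using assms by (simp add: linear_map_def)

lemma linear_map_closed: "linear_map K V W f \<Longrightarrow> x \<in> carrier V \<Longrightarrow> f x \<in> carrier W"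
  and linear_map_add:
    "\<lbrakk>linear_map K V W f; x \<in> carrier V; y \<in> carrier V\<rbrakk> \<Longrightarrow> f (x \<oplus>\<^bsub>V\<^esub> y) = f x \<oplus>\<^bsub>W\<^esub> f y"
  and linear_map_smult:
    "\<lbrakk>linear_map K V W f; c \<in> carrier K; x \<in> carrier V\<rbrakk> \<Longrightarrow> f (c \<odot>\<^bsub>V\<^esub> x) = c \<odot>\<^bsub>W\<^esub> f x"
  by (simp_all add: linear_map_def)

lemma linear_map_cong:
  assumes "module K V" "\<And>x. x \<in> carrier V \<Longrightarrow> f x = g x" "linear_map K V W f"
  shows "linear_map K V W g"
proof -
  interpret module K V by fact
  show ?thesis using assms(2,3) by (simp add: linear_map_def)
qed

text \<open>\<open>linear_map\<close> leaves out extensionality so that \<open>id\<close> and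
  arbitrary lambda terms count as linear; this is the bridge back to the extensional maps that serve
  as 2-cells.\<close>

lemma lin_maps_iff: "f \<in> lin_maps K V W \<longleftrightarrow> linear_map K V W f \<and> f \<in> extensional (carrier V)"
  by (auto simp: lin_maps_def linear_map_def PiE_def)

lemma linear_map_zero:
  assumes "module K V" "module K W" "linear_map K V W f"
  shows "f \<zero>\<^bsub>V\<^esub> = \<zero>\<^bsub>W\<^esub>"
proof -
  interpret V: module K V by fact
  interpret W: module K W by fact
  have "f (\<zero>\<^bsub>K\<^esub> \<odot>\<^bsub>V\<^esub> \<zero>\<^bsub>V\<^esub>) = \<zero>\<^bsub>K\<^esub> \<odot>\<^bsub>W\<^esub> f \<zero>\<^bsub>V\<^esub>"
    by (rule linear_map_smult[OF assms(3)]) auto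
  then show ?thesis using linear_map_closed[OF assms(3), of "\<zero>\<^bsub>V\<^esub>"] by simp
qed

lemma bilinear_mapI:
  assumes "\<And>v. v \<in> carrier V \<Longrightarrow> linear_map K W M (\<lambda>w. \<beta> v w)"
    and "\<And>w. w \<in> carrier W \<Longrightarrow> linear_map K V M (\<lambda>v. \<beta> v w)"
  shows "bilinear_map K V W M \<beta>"
  using assms by (simp add: bilinear_map_def)

lemma bilinear_map_left: "bilinear_map K V W M \<beta> \<Longrightarrow> w \<in> carrier W \<Longrightarrow> linear_map K V M (\<lambda>v. \<beta> v w)"
  and bilinear_map_right: "bilinear_map K V W M \<beta> \<Longrightarrow> v \<in> carrier V \<Longrightarrow> linear_map K W M (\<lambda>w. \<beta> v w)"
  by (simp_all add: bilinear_map_def)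

lemma bilinear_map_closed:
  "\<lbrakk>bilinear_map K V W M \<beta>; v \<in> carrier V; w \<in> carrier W\<rbrakk> \<Longrightarrow> \<beta> v w \<in> carrier M"
  by (meson bilinear_map_right linear_map_closed)

section \<open>Tensor products of modules\<close>

text \<open>The computation behind \<open>tensor_sum\<close>, taken on an explicit list, where
  induction is available and the choice of a representative does not intervene.\<close>

definition list_sum :: "('k, 'w, 'm) module_scheme \<Rightarrow> ('u \<Rightarrow> 'v \<Rightarrow> 'w) \<Rightarrow> ('u \<times> 'v) list \<Rightarrow> 'w" where
  "list_sum M \<beta> xs = foldr (\<lambda>(v, w) s. \<beta> v w \<oplus>\<^bsub>M\<^esub> s) xs \<zero>\<^bsub>M\<^esub>"

lemma list_sum_Nil [simp]: "list_sum M \<beta> [] = \<zero>\<^bsub>M\<^esub>"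
  and list_sum_Cons [simp]: "list_sum M \<beta> (p # xs) = \<beta> (fst p) (snd p) \<oplus>\<^bsub>M\<^esub> list_sum M \<beta> xs"
  by (simp_all add: list_sum_def case_prod_beta)

lemma tensor_sum_eq: "tensor_sum M \<beta> x = list_sum M \<beta> (formal_sum x)"
  by (simp add: tensor_sum_def list_sum_def)

locale linear_calculus =
  fixes K :: "('k, 'r) ring_scheme"
  assumes cring_K: "cring K"
begin

text \<open>The module laws as conditional rewrite rules. The premise \<open>module K V\<close> is
  discharged by the simplifier, later also for nested tensor products, so that no interpretation per
  space is required.\<close>

lemma module_simps [simp]:
  assumes "module K V"
  shows "\<zero>\<^bsub>V\<^esub> \<in> carrier V"
    and "\<lbrakk>x \<in> carrier V; y \<in> carrier V\<rbrakk> \<Longrightarrow> x \<oplus>\<^bsub>V\<^esub> y \<in> carrier V"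
    and "\<lbrakk>c \<in> carrier K; x \<in> carrier V\<rbrakk> \<Longrightarrow> c \<odot>\<^bsub>V\<^esub> x \<in> carrier V"
    and "x \<in> carrier V \<Longrightarrow> \<zero>\<^bsub>V\<^esub> \<oplus>\<^bsub>V\<^esub> x = x"
    and "x \<in> carrier V \<Longrightarrow> x \<oplus>\<^bsub>V\<^esub> \<zero>\<^bsub>V\<^esub> = x"
    and "x \<in> carrier V \<Longrightarrow> \<one>\<^bsub>K\<^esub> \<odot>\<^bsub>V\<^esub> x = x"
proof -
  interpret module K V by fact
  show "\<zero>\<^bsub>V\<^esub> \<in> carrier V"
    and "\<lbrakk>x \<in> carrier V; y \<in> carrier V\<rbrakk> \<Longrightarrow> x \<oplus>\<^bsub>V\<^esub> y \<in> carrier V"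
    and "\<lbrakk>c \<in> carrier K; x \<in> carrier V\<rbrakk> \<Longrightarrow> c \<odot>\<^bsub>V\<^esub> x \<in> carrier V"
    and "x \<in> carrier V \<Longrightarrow> \<zero>\<^bsub>V\<^esub> \<oplus>\<^bsub>V\<^esub> x = x"
    and "x \<in> carrier V \<Longrightarrow> x \<oplus>\<^bsub>V\<^esub> \<zero>\<^bsub>V\<^esub> = x"
    and "x \<in> carrier V \<Longrightarrow> \<one>\<^bsub>K\<^esub> \<odot>\<^bsub>V\<^esub> x = x" by simp_all
qed

lemma module_add_assoc:
  assumes "module K V" "x \<in> carrier V" "y \<in> carrier V" "z \<in> carrier V"
  shows "(x \<oplus>\<^bsub>V\<^esub> y) \<oplus>\<^bsub>V\<^esub> z = x \<oplus>\<^bsub>V\<^esub> (y \<oplus>\<^bsub>V\<^esub> z)"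
proof -
  interpret module K V by fact
  show ?thesis using assms(2-) by (rule M.a_assoc)
qed

lemma module_add_comm:
  assumes "module K V" "x \<in> carrier V" "y \<in> carrier V"
  shows "x \<oplus>\<^bsub>V\<^esub> y = y \<oplus>\<^bsub>V\<^esub> x"
proof -
  interpret module K V by fact
  show ?thesis using assms(2-) by (rule M.a_comm)
qed

lemma module_add_lcomm:
  assumes "module K V" "x \<in> carrier V" "y \<in> carrier V" "z \<in> carrier V"
  shows "x \<oplus>\<^bsub>V\<^esub> (y \<oplus>\<^bsub>V\<^esub> z) = y \<oplus>\<^bsub>V\<^esub> (x \<oplus>\<^bsub>V\<^esub> z)"
proof -
  interpret module K V by fact
  show ?thesis using assms(2-) by (rule M.a_lcomm)
qed

lemmas module_add_ac = module_add_assoc module_add_comm module_add_lcomm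

section \<open>Finite sums over lists of pairs\<close>

lemma list_sum_closed:
  assumes "module K M" "\<And>v w. (v, w) \<in> set xs \<Longrightarrow> \<beta> v w \<in> carrier M"
  shows "list_sum M \<beta> xs \<in> carrier M"
  using assms by (induction xs) auto

lemma list_sum_append:
  assumes "module K M" "\<And>v w. (v, w) \<in> set (xs @ ys) \<Longrightarrow> \<beta> v w \<in> carrier M"
  shows "list_sum M \<beta> (xs @ ys) = list_sum M \<beta> xs \<oplus>\<^bsub>M\<^esub> list_sum M \<beta> ys"
  using assms by (induction xs) (auto simp: module_add_assoc list_sum_closed)

lemma list_sum_cong:
  assumes "\<And>v w. (v, w) \<in> set xs \<Longrightarrow> \<beta> v w = \<beta>' v w"
  shows "list_sum M \<beta> xs = list_sum M \<beta>' xs"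
  using assms by (induction xs) auto

lemma list_sum_linear:
  assumes "module K M" "module K N" "linear_map K M N f"
    and "\<And>v w. (v, w) \<in> set xs \<Longrightarrow> \<beta> v w \<in> carrier M"
  shows "f (list_sum M \<beta> xs) = list_sum N (\<lambda>v w. f (\<beta> v w)) xs"
  using assms
  by (induction xs) (auto simp: linear_map_zero linear_map_add list_sum_closed)

lemma list_sum_map:
  "list_sum M \<beta> (map (\<lambda>p. (f (fst p) (snd p), g (fst p) (snd p))) xs) = list_sum M (\<lambda>v w. \<beta> (f v w) (g v w)) xs"
  by (induction xs) auto

lemma list_sum_add:
  assumes "module K M" "\<And>v w. (v, w) \<in> set xs \<Longrightarrow> \<beta> v w \<in> carrier M"
    "\<And>v w. (v, w) \<in> set xs \<Longrightarrow> \<gamma> v w \<in> carrier M"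
  shows "list_sum M (\<lambda>v w. \<beta> v w \<oplus>\<^bsub>M\<^esub> \<gamma> v w) xs = list_sum M \<beta> xs \<oplus>\<^bsub>M\<^esub> list_sum M \<gamma> xs"
  using assms
  by (induction xs) (auto simp: module_add_ac list_sum_closed)

lemma list_sum_zero:
  assumes "module K M"
  shows "list_sum M (\<lambda>v w. \<zero>\<^bsub>M\<^esub>) xs = \<zero>\<^bsub>M\<^esub>"
  using assms by (induction xs) auto

lemma list_sum_smult:
  assumes "module K M" "\<And>v w. (v, w) \<in> set xs \<Longrightarrow> \<beta> v w \<in> carrier M" "c \<in> carrier K"
  shows "list_sum M (\<lambda>v w. c \<odot>\<^bsub>M\<^esub> \<beta> v w) xs = c \<odot>\<^bsub>M\<^esub> list_sum M \<beta> xs"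
proof -
  have "linear_map K M M (\<lambda>x. c \<odot>\<^bsub>M\<^esub> x)"
  proof -
    interpret module K M by fact
    show ?thesis using assms(3)
      by (intro linear_mapI) (auto simp: smult_r_distr smult_assoc1[symmetric] R.m_comm)
  qed
  from list_sum_linear[OF assms(1,1) this, of xs \<beta>] show ?thesis using assms(2) by simp
qed

text \<open>Finite Fubini, by induction on the outer list with \<open>list_sum_add\<close> read from
  right to left. It is what later permits the exchange of two Sweedler sums.\<close>

lemma list_sum_swap:
  assumes "module K M"
    "\<And>v w v' w'. \<lbrakk>(v, w) \<in> set xs; (v', w') \<in> set ys\<rbrakk> \<Longrightarrow> \<beta> v w v' w' \<in> carrier M"
  shows "list_sum M (\<lambda>v w. list_sum M (\<lambda>v' w'. \<beta> v w v' w') ys) xs =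
    list_sum M (\<lambda>v' w'. list_sum M (\<lambda>v w. \<beta> v w v' w') xs) ys"
  using assms
proof (induction xs)
  case Nil
  then show ?case by (simp add: list_sum_zero)
next
  case (Cons p xs)
  then show ?case
    by (simp add: list_sum_add[symmetric] list_sum_closed)
qed

text \<open>Reflexivity is restricted to lists over the carriers, so the relation is a partial
  equivalence on all lists. This guarantees that a representative selected by \<open>tclass\<close>
  again has its entries in the carriers.\<close>

lemma tensor_rel_set:
  assumes "module K V" "module K W" "tensor_rel K V W xs ys"
  shows "set xs \<subseteq> carrier V \<times> carrier W \<and> set ys \<subseteq> carrier V \<times> carrier W"
  using assms(3) by induction (use assms(1,2) in auto)

text \<open>Well-definedness in the universal property: every generating rule of the congruence is
  an identity respected by a bilinear \<beta>, while \<open>append\<close> and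
  \<open>commute\<close> hold because addition in M is associative and commutative.\<close>

lemma list_sum_tensor_rel:
  assumes "module K V" "module K W" "module K M" "bilinear_map K V W M \<beta>" "tensor_rel K V W xs ys"
  shows "list_sum M \<beta> xs = list_sum M \<beta> ys"
  using assms(5)
proof induction
  case (append xs xs' ys ys')
  then show ?case
    using tensor_rel_set[OF assms(1,2) append.hyps(1)] tensor_rel_set[OF assms(1,2) append.hyps(2)]
      bilinear_map_closed[OF assms(4)] assms(3)
    by (subst (1 2) list_sum_append) auto
next
  case (commute xs ys)
  then show ?case
    using bilinear_map_closed[OF assms(4)] assms(3)
    by (subst (1 2) list_sum_append) (auto intro!: module_add_comm list_sum_closed)
next
  case (zero w)
  have "\<beta> \<zero>\<^bsub>V\<^esub> w = \<zero>\<^bsub>M\<^esub>"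
    using linear_map_zero[OF assms(1,3) bilinear_map_left[OF assms(4) zero]] .
  then show ?case using assms(3) by simp
next
  case (add_left v v' w)
  then show ?case
    using linear_map_add[OF bilinear_map_left[OF assms(4)]] bilinear_map_closed[OF assms(4)] assms(1,3)
    by (simp add: module_add_assoc)
next
  case (add_right v w w')
  then show ?case
    using linear_map_add[OF bilinear_map_right[OF assms(4)]] bilinear_map_closed[OF assms(4)] assms(2,3)
    by (simp add: module_add_assoc)
next
  case (balanced c v w)
  then show ?case
    using linear_map_smult[OF bilinear_map_left[OF assms(4)]]
      linear_map_smult[OF bilinear_map_right[OF assms(4)]] by simp
qed auto

text \<open>By symmetry and transitivity the predicates \<open>tensor_rel K V W xs\<close> and
  \<open>tensor_rel K V W ys\<close> coincide, so \<open>SOME\<close> selects the same list for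
  both.\<close>

lemma tclass_eqI: "tensor_rel K V W xs ys \<Longrightarrow> tclass K V W xs = tclass K V W ys"
proof -
  assume "tensor_rel K V W xs ys"
  then have "tensor_rel K V W xs = tensor_rel K V W ys"
    by (intro ext) (metis tensor_rel.sym tensor_rel.trans)
  then show ?thesis by (simp add: tclass_def)
qed

lemma tensor_rel_formal_sum:
  "set xs \<subseteq> carrier V \<times> carrier W \<Longrightarrow> tensor_rel K V W xs (formal_sum (tclass K V W xs))"
  unfolding tclass_def formal_sum.simps by (rule someI) (rule tensor_rel.refl)

text \<open>Makes scalar multiplication well defined on classes. In the case \<open>balanced\<close>
  commutativity of K enters, as c(dv) = d(cv).\<close>

lemma tensor_rel_scale:
  assumes "module K V" "module K W" "c \<in> carrier K" "tensor_rel K V W xs ys"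
  shows "tensor_rel K V W (map (\<lambda>(v, w). (c \<odot>\<^bsub>V\<^esub> v, w)) xs) (map (\<lambda>(v, w). (c \<odot>\<^bsub>V\<^esub> v, w)) ys)"
  using assms(4)
proof induction
  case (refl xs)
  then show ?case using assms by (intro tensor_rel.refl) auto
next
  case (sym xs ys)
  from sym.IH show ?case by (rule tensor_rel.sym)
next
  case (trans xs ys zs)
  then show ?case by (blast intro: tensor_rel.trans)
next
  case (append xs xs' ys ys')
  then show ?case by (simp add: tensor_rel.append)
next
  case (commute xs ys)
  then show ?case unfolding map_append using assms by (intro tensor_rel.commute) auto
next
  case (zero w)
  interpret module K V by fact
  show ?case using zero assms(3) by (simp add: tensor_rel.zero)
next
  case (add_left v v' w)
  interpret module K V by fact
  show ?case using add_left assms(3) by (simp add: smult_r_distr tensor_rel.add_left)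
next
  case (add_right v w w')
  then show ?case using assms by (simp add: tensor_rel.add_right)
next
  case (balanced d v w)
  interpret module K V by fact
  have "c \<odot>\<^bsub>V\<^esub> (d \<odot>\<^bsub>V\<^esub> v) = d \<odot>\<^bsub>V\<^esub> (c \<odot>\<^bsub>V\<^esub> v)"
    using balanced assms(3) by (simp add: smult_assoc1[symmetric] R.m_comm)
  then show ?case using balanced assms by (simp add: tensor_rel.balanced)
qed

section \<open>The module structure of the tensor product\<close>

lemma carrier_tensor:
  "carrier (tensor K V W) = tclass K V W ` {xs. set xs \<subseteq> carrier V \<times> carrier W}"
  by (simp add: tensor_def)

lemma pure_closed [simp]:
  "\<lbrakk>v \<in> carrier V; w \<in> carrier W\<rbrakk> \<Longrightarrow> pure K V W v w \<in> carrier (tensor K V W)"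
  by (auto simp: carrier_tensor pure_def)

lemma formal_sum_set:
  assumes "module K V" "module K W" "x \<in> carrier (tensor K V W)"
  shows "set (formal_sum x) \<subseteq> carrier V \<times> carrier W"
proof -
  from assms(3) obtain xs where "x = tclass K V W xs" "set xs \<subseteq> carrier V \<times> carrier W"
    by (auto simp: carrier_tensor)
  then show ?thesis using tensor_rel_set[OF assms(1,2) tensor_rel_formal_sum] by blast
qed

lemma tclass_formal_sum:
  assumes "x \<in> carrier (tensor K V W)"
  shows "tclass K V W (formal_sum x) = x"
proof -
  from assms obtain xs where xs: "x = tclass K V W xs" "set xs \<subseteq> carrier V \<times> carrier W"
    by (auto simp: carrier_tensor)
  from tclass_eqI[OF tensor_rel_formal_sum[OF xs(2)]] xs(1) show ?thesis by simp
qed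

text \<open>Frees addition from the stored representatives: any lists over the carriers may be
  appended. With \<open>smult_tclass\<close> this reduces the module axioms to facts about
  lists.\<close>

lemma add_tclass:
  assumes "set xs \<subseteq> carrier V \<times> carrier W" "set ys \<subseteq> carrier V \<times> carrier W"
  shows "tclass K V W xs \<oplus>\<^bsub>tensor K V W\<^esub> tclass K V W ys = tclass K V W (xs @ ys)"
  using assms by (auto simp: tensor_def intro!: tclass_eqI tensor_rel.append tensor_rel.sym[OF tensor_rel_formal_sum])

lemma smult_tclass:
  assumes "module K V" "module K W" "c \<in> carrier K" "set xs \<subseteq> carrier V \<times> carrier W"
  shows "c \<odot>\<^bsub>tensor K V W\<^esub> tclass K V W xs = tclass K V W (map (\<lambda>(v, w). (c \<odot>\<^bsub>V\<^esub> v, w)) xs)"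
  using assms by (auto simp: tensor_def intro!: tclass_eqI tensor_rel_scale tensor_rel.sym[OF tensor_rel_formal_sum])

lemma zero_tensor: "\<zero>\<^bsub>tensor K V W\<^esub> = tclass K V W []"
  by (simp add: tensor_def)

lemma tensor_rel_Cons:
  "\<lbrakk>tensor_rel K V W [p] ps; tensor_rel K V W xs ys\<rbrakk> \<Longrightarrow> tensor_rel K V W (p # xs) (ps @ ys)"
  using tensor_rel.append[of K V W "[p]" ps xs ys] by simp

lemma tensor_rel_scale_zero:
  assumes "module K V" "set xs \<subseteq> carrier V \<times> carrier W"
  shows "tensor_rel K V W (map (\<lambda>(v, w). (\<zero>\<^bsub>K\<^esub> \<odot>\<^bsub>V\<^esub> v, w)) xs) []"
  using assms(2)
proof (induction xs)
  case Nil
  then show ?case by (simp add: tensor_rel.refl)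
next
  case (Cons p xs)
  interpret module K V by fact
  have "tensor_rel K V W (map (\<lambda>(v, w). (\<zero>\<^bsub>K\<^esub> \<odot>\<^bsub>V\<^esub> v, w)) (p # xs)) ([] @ [])"
    unfolding list.map using Cons by (intro tensor_rel_Cons) (auto simp: tensor_rel.zero)
  then show ?case by simp
qed

text \<open>The induction yields an a-pair and a b-pair for each entry, whereas the claim lists all
  a-pairs before all b-pairs; the application of \<open>tensor_rel.commute\<close> moves the new
  b-pair past the a-pairs of the tail.\<close>

lemma tensor_rel_scale_add:
  assumes "module K V" "a \<in> carrier K" "b \<in> carrier K" "set xs \<subseteq> carrier V \<times> carrier W"
  shows "tensor_rel K V W (map (\<lambda>(v, w). ((a \<oplus>\<^bsub>K\<^esub> b) \<odot>\<^bsub>V\<^esub> v, w)) xs)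
    (map (\<lambda>(v, w). (a \<odot>\<^bsub>V\<^esub> v, w)) xs @ map (\<lambda>(v, w). (b \<odot>\<^bsub>V\<^esub> v, w)) xs)"
  using assms(4)
proof (induction xs)
  case Nil
  then show ?case by (simp add: tensor_rel.refl)
next
  case (Cons p xs)
  interpret module K V by fact
  obtain v w where p: "p = (v, w)" by (cases p)
  let ?A = "map (\<lambda>(v, w). (a \<odot>\<^bsub>V\<^esub> v, w)) xs" and ?B = "map (\<lambda>(v, w). (b \<odot>\<^bsub>V\<^esub> v, w)) xs"
  have in_carrier: "set ?A \<subseteq> carrier V \<times> carrier W" "set ?B \<subseteq> carrier V \<times> carrier W"
    "v \<in> carrier V" "w \<in> carrier W"
    using Cons.prems assms p by auto
  have "tensor_rel K V W (map (\<lambda>(v, w). ((a \<oplus>\<^bsub>K\<^esub> b) \<odot>\<^bsub>V\<^esub> v, w)) (p # xs))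
    ([(a \<odot>\<^bsub>V\<^esub> v, w), (b \<odot>\<^bsub>V\<^esub> v, w)] @ (?A @ ?B))"
    unfolding list.map using Cons assms(2,3) p
    by (intro tensor_rel_Cons) (auto simp: smult_l_distr tensor_rel.add_left)
  moreover have "tensor_rel K V W ([(a \<odot>\<^bsub>V\<^esub> v, w)] @ (([(b \<odot>\<^bsub>V\<^esub> v, w)] @ ?A) @ ?B))
    ([(a \<odot>\<^bsub>V\<^esub> v, w)] @ ((?A @ [(b \<odot>\<^bsub>V\<^esub> v, w)]) @ ?B))"
    using in_carrier assms(2,3)
    by (intro tensor_rel.append tensor_rel.commute tensor_rel.refl) auto
  ultimately show ?case using p by (auto intro: tensor_rel.trans)
qed

text \<open>The delicate axiom is the existence of negatives, because formal sums carry no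
  subtraction. The negative of x is (-1)x: distributivity gives (-1)x + 1x = 0x, and
  \<open>tensor_rel_scale_zero\<close> identifies 0x with the empty sum.\<close>

lemma module_tensor [simp]:
  assumes "module K V" "module K W"
  shows "module K (tensor K V W)"
proof (rule moduleI)
  interpret V: module K V by fact
  interpret W: module K W by fact
  let ?T = "tensor K V W"
  show add_closed: "c \<odot>\<^bsub>?T\<^esub> x \<in> carrier ?T" if "c \<in> carrier K" "x \<in> carrier ?T" for c x
  proof -
    from that obtain xs where xs: "x = tclass K V W xs" "set xs \<subseteq> carrier V \<times> carrier W"
      by (auto simp: carrier_tensor)
    then have "set (map (\<lambda>(v, w). (c \<odot>\<^bsub>V\<^esub> v, w)) xs) \<subseteq> carrier V \<times> carrier W"
      using that(1) by auto
    then show ?thesis using that(1) xs assms by (simp add: smult_tclass carrier_tensor)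
  qed
  show l_distr: "(a \<oplus>\<^bsub>K\<^esub> b) \<odot>\<^bsub>?T\<^esub> x = a \<odot>\<^bsub>?T\<^esub> x \<oplus>\<^bsub>?T\<^esub> b \<odot>\<^bsub>?T\<^esub> x"
    if "a \<in> carrier K" "b \<in> carrier K" "x \<in> carrier ?T" for a b x
    using that assms
    by (auto simp: carrier_tensor smult_tclass)
      (subst add_tclass, auto intro!: tclass_eqI tensor_rel_scale_add)
  show "a \<odot>\<^bsub>?T\<^esub> (x \<oplus>\<^bsub>?T\<^esub> y) = a \<odot>\<^bsub>?T\<^esub> x \<oplus>\<^bsub>?T\<^esub> a \<odot>\<^bsub>?T\<^esub> y"
    if "a \<in> carrier K" "x \<in> carrier ?T" "y \<in> carrier ?T" for a x y
    using that assms
    by (auto simp: carrier_tensor smult_tclass add_tclass) (subst add_tclass, auto)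
  show "(a \<otimes>\<^bsub>K\<^esub> b) \<odot>\<^bsub>?T\<^esub> x = a \<odot>\<^bsub>?T\<^esub> (b \<odot>\<^bsub>?T\<^esub> x)"
    if "a \<in> carrier K" "b \<in> carrier K" "x \<in> carrier ?T" for a b x
  proof -
    from that obtain xs where xs: "x = tclass K V W xs" "set xs \<subseteq> carrier V \<times> carrier W"
      by (auto simp: carrier_tensor)
    then have "set (map (\<lambda>(v, w). (b \<odot>\<^bsub>V\<^esub> v, w)) xs) \<subseteq> carrier V \<times> carrier W"
      using that(2) by auto
    moreover have "map (\<lambda>(v, w). ((a \<otimes>\<^bsub>K\<^esub> b) \<odot>\<^bsub>V\<^esub> v, w)) xs =
      map (\<lambda>(v, w). (a \<odot>\<^bsub>V\<^esub> v, w)) (map (\<lambda>(v, w). (b \<odot>\<^bsub>V\<^esub> v, w)) xs)"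
      using xs(2) that(1,2) by (auto simp: V.smult_assoc1)
    ultimately show ?thesis using that(1,2) xs assms by (simp only: smult_tclass V.R.m_closed)
  qed
  show "\<one>\<^bsub>K\<^esub> \<odot>\<^bsub>?T\<^esub> x = x" if "x \<in> carrier ?T" for x
  proof -
    from that obtain xs where xs: "x = tclass K V W xs" "set xs \<subseteq> carrier V \<times> carrier W"
      by (auto simp: carrier_tensor)
    have "map (\<lambda>(v, w). (\<one>\<^bsub>K\<^esub> \<odot>\<^bsub>V\<^esub> v, w)) xs = xs"
      using xs(2) by (intro map_idI) auto
    then show ?thesis using xs assms by (simp add: smult_tclass)
  qed
  show "cring K" by (rule cring_K)
  show "abelian_group ?T"
  proof (rule abelian_groupI)
    show "x \<oplus>\<^bsub>?T\<^esub> y \<in> carrier ?T" if "x \<in> carrier ?T" "y \<in> carrier ?T" for x y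
      using that by (auto simp: carrier_tensor add_tclass intro!: imageI)
    show "\<zero>\<^bsub>?T\<^esub> \<in> carrier ?T" by (auto simp: carrier_tensor zero_tensor intro!: imageI)
    show "x \<oplus>\<^bsub>?T\<^esub> y \<oplus>\<^bsub>?T\<^esub> z = x \<oplus>\<^bsub>?T\<^esub> (y \<oplus>\<^bsub>?T\<^esub> z)"
      if "x \<in> carrier ?T" "y \<in> carrier ?T" "z \<in> carrier ?T" for x y z
      using that by (auto simp: carrier_tensor add_tclass)
    show "x \<oplus>\<^bsub>?T\<^esub> y = y \<oplus>\<^bsub>?T\<^esub> x" if "x \<in> carrier ?T" "y \<in> carrier ?T" for x y
      using that by (auto simp: carrier_tensor add_tclass intro!: tclass_eqI tensor_rel.commute)
    show "\<zero>\<^bsub>?T\<^esub> \<oplus>\<^bsub>?T\<^esub> x = x" if "x \<in> carrier ?T" for x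
      using that by (auto simp: carrier_tensor zero_tensor add_tclass)
    show "\<exists>y\<in>carrier ?T. y \<oplus>\<^bsub>?T\<^esub> x = \<zero>\<^bsub>?T\<^esub>" if x: "x \<in> carrier ?T" for x
    proof
      have "\<ominus>\<^bsub>K\<^esub> \<one>\<^bsub>K\<^esub> \<odot>\<^bsub>?T\<^esub> x \<oplus>\<^bsub>?T\<^esub> \<one>\<^bsub>K\<^esub> \<odot>\<^bsub>?T\<^esub> x = \<zero>\<^bsub>K\<^esub> \<odot>\<^bsub>?T\<^esub> x"
        using x by (subst l_distr[symmetric]) (auto simp: V.R.l_neg)
      also have "\<dots> = \<zero>\<^bsub>?T\<^esub>"
        using x assms by (auto simp: carrier_tensor smult_tclass zero_tensor intro!: tclass_eqI tensor_rel_scale_zero)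
      finally show "\<ominus>\<^bsub>K\<^esub> \<one>\<^bsub>K\<^esub> \<odot>\<^bsub>?T\<^esub> x \<oplus>\<^bsub>?T\<^esub> x = \<zero>\<^bsub>?T\<^esub>"
        by (simp only: \<open>\<And>x. x \<in> carrier ?T \<Longrightarrow> \<one>\<^bsub>K\<^esub> \<odot>\<^bsub>?T\<^esub> x = x\<close>[OF x])
      show "\<ominus>\<^bsub>K\<^esub> \<one>\<^bsub>K\<^esub> \<odot>\<^bsub>?T\<^esub> x \<in> carrier ?T" using add_closed x by simp
    qed
  qed
qed

section \<open>The universal property of the tensor product\<close>

lemma pure_linear_left:
  assumes "module K V" "module K W" "w \<in> carrier W"
  shows "linear_map K V (tensor K V W) (\<lambda>v. pure K V W v w)"
proof (rule linear_mapI)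
  fix x y assume "x \<in> carrier V" "y \<in> carrier V"
  then show "pure K V W (x \<oplus>\<^bsub>V\<^esub> y) w = pure K V W x w \<oplus>\<^bsub>tensor K V W\<^esub> pure K V W y w"
    using assms by (simp add: pure_def add_tclass) (intro tclass_eqI tensor_rel.add_left)
qed (use assms in \<open>auto simp: pure_def smult_tclass pure_closed[unfolded pure_def]\<close>)

lemma pure_linear_right:
  assumes "module K V" "module K W" "v \<in> carrier V"
  shows "linear_map K W (tensor K V W) (\<lambda>w. pure K V W v w)"
proof (rule linear_mapI)
  fix x y assume "x \<in> carrier W" "y \<in> carrier W"
  then show "pure K V W v (x \<oplus>\<^bsub>W\<^esub> y) = pure K V W v x \<oplus>\<^bsub>tensor K V W\<^esub> pure K V W v y"
    using assms by (simp add: pure_def add_tclass) (intro tclass_eqI tensor_rel.add_right)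
next
  fix c x assume "c \<in> carrier K" "x \<in> carrier W"
  then show "pure K V W v (c \<odot>\<^bsub>W\<^esub> x) = c \<odot>\<^bsub>tensor K V W\<^esub> pure K V W v x"
    using assms by (simp add: pure_def smult_tclass) (intro tclass_eqI tensor_rel.sym[OF tensor_rel.balanced])
qed (use assms in auto)

lemma tclass_eq_list_sum:
  assumes "set xs \<subseteq> carrier V \<times> carrier W"
  shows "tclass K V W xs = list_sum (tensor K V W) (pure K V W) xs"
  using assms
proof (induction xs)
  case Nil
  then show ?case by (simp add: zero_tensor)
next
  case (Cons p xs)
  then show ?case
    using add_tclass[of "[p]" V W xs] by (auto simp: pure_def)
qed

lemma tensor_sum_tclass:
  assumes "module K V" "module K W" "module K M" "bilinear_map K V W M \<beta>"
    "set xs \<subseteq> carrier V \<times> carrier W"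
  shows "tensor_sum M \<beta> (tclass K V W xs) = list_sum M \<beta> xs"
  unfolding tensor_sum_eq
  by (rule list_sum_tensor_rel[symmetric, OF assms(1-4) tensor_rel_formal_sum[OF assms(5)]])

lemma tensor_sum_pure:
  assumes "module K V" "module K W" "module K M" "bilinear_map K V W M \<beta>"
    "v \<in> carrier V" "w \<in> carrier W"
  shows "tensor_sum M \<beta> (pure K V W v w) = \<beta> v w"
  unfolding pure_def using assms
  by (subst tensor_sum_tclass) (auto simp: bilinear_map_closed)

text \<open>Existence of the linear map induced by \<beta>. Additivity comes from appending lists,
  homogeneity from scaling the left entries, once \<open>tensor_sum_tclass\<close> has replaced the
  stored representative by a convenient one.\<close>

lemma linear_tensor_sum:
  assumes "module K V" "module K W" "module K M" "bilinear_map K V W M \<beta>"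
  shows "linear_map K (tensor K V W) M (tensor_sum M \<beta>)"
proof -
  interpret V: module K V by fact
  note closed = bilinear_map_closed[OF assms(4)]
  show ?thesis
  proof (rule linear_mapI)
    show "tensor_sum M \<beta> x \<in> carrier M" if "x \<in> carrier (tensor K V W)" for x
      using formal_sum_set[OF assms(1,2) that] closed assms(3)
      by (auto simp: tensor_sum_eq intro!: list_sum_closed)
  next
    fix x y assume "x \<in> carrier (tensor K V W)" "y \<in> carrier (tensor K V W)"
    then obtain xs ys where "x = tclass K V W xs" "set xs \<subseteq> carrier V \<times> carrier W"
      "y = tclass K V W ys" "set ys \<subseteq> carrier V \<times> carrier W"
      by (auto simp: carrier_tensor)
    then show "tensor_sum M \<beta> (x \<oplus>\<^bsub>tensor K V W\<^esub> y) = tensor_sum M \<beta> x \<oplus>\<^bsub>M\<^esub> tensor_sum M \<beta> y"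
      using assms closed
      by (simp add: add_tclass tensor_sum_tclass) (subst list_sum_append, auto)
  next
    fix c x assume c: "c \<in> carrier K" and "x \<in> carrier (tensor K V W)"
    then obtain xs where xs: "x = tclass K V W xs" "set xs \<subseteq> carrier V \<times> carrier W"
      by (auto simp: carrier_tensor)
    have "list_sum M \<beta> (map (\<lambda>(v, w). (c \<odot>\<^bsub>V\<^esub> v, w)) xs) = list_sum M (\<lambda>v w. \<beta> (c \<odot>\<^bsub>V\<^esub> v) w) xs"
      using list_sum_map[of M \<beta> "\<lambda>v w. c \<odot>\<^bsub>V\<^esub> v" "\<lambda>v w. w" xs] by (simp add: case_prod_unfold)
    also have "\<dots> = list_sum M (\<lambda>v w. c \<odot>\<^bsub>M\<^esub> \<beta> v w) xs"
      using xs(2) c linear_map_smult[OF bilinear_map_left[OF assms(4)]] by (intro list_sum_cong) auto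
    also have "\<dots> = c \<odot>\<^bsub>M\<^esub> list_sum M \<beta> xs"
      using assms(3) xs(2) c closed by (intro list_sum_smult) auto
    moreover have "set (map (\<lambda>(v, w). (c \<odot>\<^bsub>V\<^esub> v, w)) xs) \<subseteq> carrier V \<times> carrier W"
      using xs(2) c by auto
    ultimately show "tensor_sum M \<beta> (c \<odot>\<^bsub>tensor K V W\<^esub> x) = c \<odot>\<^bsub>M\<^esub> tensor_sum M \<beta> x"
      using xs c assms by (simp only: smult_tclass tensor_sum_tclass)
  qed
qed

lemma tensor_sum_cong:
  assumes "module K V" "module K W" "x \<in> carrier (tensor K V W)"
    and "\<And>v w. \<lbrakk>v \<in> carrier V; w \<in> carrier W\<rbrakk> \<Longrightarrow> \<beta> v w = \<beta>' v w"
  shows "tensor_sum M \<beta> x = tensor_sum M \<beta>' x"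
  unfolding tensor_sum_eq using formal_sum_set[OF assms(1-3)] assms(4) by (intro list_sum_cong) auto

lemma tensor_sum_closed:
  assumes "module K V" "module K W" "x \<in> carrier (tensor K V W)" "module K M"
    and "\<And>v w. \<lbrakk>v \<in> carrier V; w \<in> carrier W\<rbrakk> \<Longrightarrow> \<beta> v w \<in> carrier M"
  shows "tensor_sum M \<beta> x \<in> carrier M"
  unfolding tensor_sum_eq using formal_sum_set[OF assms(1-3)] assms(4,5)
  by (intro list_sum_closed) auto

lemma linear_map_tensor_sum:
  assumes "module K V" "module K W" "x \<in> carrier (tensor K V W)" "module K M" "module K N"
    and "linear_map K M N f" "\<And>v w. \<lbrakk>v \<in> carrier V; w \<in> carrier W\<rbrakk> \<Longrightarrow> \<beta> v w \<in> carrier M"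
  shows "f (tensor_sum M \<beta> x) = tensor_sum N (\<lambda>v w. f (\<beta> v w)) x"
  unfolding tensor_sum_eq using formal_sum_set[OF assms(1-3)] assms(4-)
  by (intro list_sum_linear) auto

lemma tensor_sum_swap:
  assumes "module K V" "module K W" "x \<in> carrier (tensor K V W)"
    and "module K V'" "module K W'" "y \<in> carrier (tensor K V' W')" "module K M"
    and "\<And>v w v' w'. \<lbrakk>v \<in> carrier V; w \<in> carrier W; v' \<in> carrier V'; w' \<in> carrier W'\<rbrakk>
      \<Longrightarrow> \<beta> v w v' w' \<in> carrier M"
  shows "tensor_sum M (\<lambda>v w. tensor_sum M (\<lambda>v' w'. \<beta> v w v' w') y) x =
    tensor_sum M (\<lambda>v' w'. tensor_sum M (\<lambda>v w. \<beta> v w v' w') x) y"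
  unfolding tensor_sum_eq using formal_sum_set[OF assms(1-3)] formal_sum_set[OF assms(4-6)] assms(7-)
  by (intro list_sum_swap) blast+

text \<open>The universal bilinear map induces the identity: a tensor is the sum of the pure tensors
  in its own list.\<close>

lemma tensor_sum_pure_id:
  assumes "module K V" "module K W" "x \<in> carrier (tensor K V W)"
  shows "tensor_sum (tensor K V W) (pure K V W) x = x"
  unfolding tensor_sum_eq
  using tclass_eq_list_sum[OF formal_sum_set[OF assms]] tclass_formal_sum[OF assms(3)] by simp

text \<open>Complement of \<open>linear_tensor_sum\<close>: here the tensor x is fixed and the
  summands vary linearly with a parameter. Nested sums call for both kinds of linearity.\<close>

lemma linear_tensor_sum_param:
  assumes "module K V" "module K W" "x \<in> carrier (tensor K V W)" "module K M"
    and "\<And>v w. \<lbrakk>v \<in> carrier V; w \<in> carrier W\<rbrakk> \<Longrightarrow> linear_map K U M (\<lambda>u. \<beta> u v w)"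
  shows "linear_map K U M (\<lambda>u. tensor_sum M (\<lambda>v w. \<beta> u v w) x)"
proof -
  note xs = formal_sum_set[OF assms(1-3)]
  show ?thesis
  proof (rule linear_mapI)
    show "tensor_sum M (\<lambda>v w. \<beta> u v w) x \<in> carrier M" if "u \<in> carrier U" for u
      using assms(1-4) that linear_map_closed[OF assms(5)] by (intro tensor_sum_closed) auto
  next
    fix a b assume ab: "a \<in> carrier U" "b \<in> carrier U"
    then have "tensor_sum M (\<beta> (a \<oplus>\<^bsub>U\<^esub> b)) x = tensor_sum M (\<lambda>v w. \<beta> a v w \<oplus>\<^bsub>M\<^esub> \<beta> b v w) x"
      using linear_map_add[OF assms(5)] assms(1-3) by (intro tensor_sum_cong) auto
    also have "\<dots> = tensor_sum M (\<beta> a) x \<oplus>\<^bsub>M\<^esub> tensor_sum M (\<beta> b) x"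
      unfolding tensor_sum_eq using ab xs linear_map_closed[OF assms(5)] assms(4)
      by (intro list_sum_add) auto
    finally show "tensor_sum M (\<beta> (a \<oplus>\<^bsub>U\<^esub> b)) x = tensor_sum M (\<beta> a) x \<oplus>\<^bsub>M\<^esub> tensor_sum M (\<beta> b) x" .
  next
    fix c a assume ca: "c \<in> carrier K" "a \<in> carrier U"
    then have "tensor_sum M (\<beta> (c \<odot>\<^bsub>U\<^esub> a)) x = tensor_sum M (\<lambda>v w. c \<odot>\<^bsub>M\<^esub> \<beta> a v w) x"
      using linear_map_smult[OF assms(5)] assms(1-3) by (intro tensor_sum_cong) auto
    also have "\<dots> = c \<odot>\<^bsub>M\<^esub> tensor_sum M (\<beta> a) x"
      unfolding tensor_sum_eq using ca xs linear_map_closed[OF assms(5)] assms(4)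
      by (intro list_sum_smult) auto
    finally show "tensor_sum M (\<beta> (c \<odot>\<^bsub>U\<^esub> a)) x = c \<odot>\<^bsub>M\<^esub> tensor_sum M (\<beta> a) x" .
  qed
qed

text \<open>Since x is the sum of its pure tensors, every linear h satisfies h(x) = \<Sum> h(v
  \<otimes> w), summed over the list of x; f and g are compared term by term.\<close>

lemma tensor_eqI:
  assumes "module K V" "module K W" "module K M"
    and "linear_map K (tensor K V W) M f" "linear_map K (tensor K V W) M g"
    and "\<And>v w. \<lbrakk>v \<in> carrier V; w \<in> carrier W\<rbrakk> \<Longrightarrow> f (pure K V W v w) = g (pure K V W v w)"
    and "x \<in> carrier (tensor K V W)"
  shows "f x = g x"
proof -
  have *: "h x = tensor_sum M (\<lambda>v w. h (pure K V W v w)) x" if "linear_map K (tensor K V W) M h" for h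
    using linear_map_tensor_sum[OF assms(1,2,7) _ assms(3) that, of "pure K V W"]
      tensor_sum_pure_id[OF assms(1,2,7)] assms(1,2) by simp
  show ?thesis
    unfolding *[OF assms(4)] *[OF assms(5)] by (rule tensor_sum_cong[OF assms(1,2,7,6)])
qed

section \<open>Closure rules for linearity\<close>

lemma linear_ident [simp]: "linear_map K V V (\<lambda>x. x)"
  and linear_id [simp]: "linear_map K V V id"
  by (simp_all add: linear_map_def)

lemma linear_restrict [simp]:
  "module K V \<Longrightarrow> linear_map K V W (restrict f (carrier V)) \<longleftrightarrow> linear_map K V W f"
  by (auto simp: linear_map_def)

text \<open>Covers the shape that an eta-expanded \<open>restrict\<close> takes after simplification
  with \<open>restrict_apply\<close>.\<close>

lemma linear_if [simp]:
  "module K V \<Longrightarrow> linear_map K V W (\<lambda>x. if x \<in> carrier V then f x else undefined) \<longleftrightarrow> linear_map K V W f"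
  by (auto simp: linear_map_def)

lemma linear_compose:
  "\<lbrakk>linear_map K U V f; linear_map K V W g\<rbrakk> \<Longrightarrow> linear_map K U W (\<lambda>x. g (f x))"
  by (simp add: linear_map_def)

lemma linear_pure1:
  "\<lbrakk>linear_map K U V f; module K V; module K W; w \<in> carrier W\<rbrakk>
    \<Longrightarrow> linear_map K U (tensor K V W) (\<lambda>u. pure K V W (f u) w)"
  and linear_pure2:
  "\<lbrakk>linear_map K U W g; module K V; module K W; v \<in> carrier V\<rbrakk>
    \<Longrightarrow> linear_map K U (tensor K V W) (\<lambda>u. pure K V W v (g u))"
  using linear_compose[OF _ pure_linear_left] linear_compose[OF _ pure_linear_right] by blast+

lemma module_base [simp]: "module K (base_module K)"
proof -
  interpret cring K by (rule cring_K)
  show ?thesis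
    by (intro moduleI abelian_groupI cring_K)
      (auto simp: base_module_def l_distr r_distr m_assoc a_assoc a_comm a_lcomm intro: bexI[of _ "\<ominus>\<^bsub>K\<^esub> _"] l_neg)
qed

lemma base_simps [simp]:
  "carrier (base_module K) = carrier K" "add (base_module K) = add K"
  "\<zero>\<^bsub>base_module K\<^esub> = \<zero>\<^bsub>K\<^esub>" "smult (base_module K) = monoid.mult K"
  by (simp_all add: base_module_def)

lemma linear_smult1:
  assumes "linear_map K U (base_module K) f" "module K V" "v \<in> carrier V"
  shows "linear_map K U V (\<lambda>u. f u \<odot>\<^bsub>V\<^esub> v)"
proof -
  interpret module K V by fact
  show ?thesis using assms(1,3)
    by (auto simp: linear_map_def smult_l_distr smult_assoc1)
qed

lemma linear_smult2:
  assumes "linear_map K U V f" "module K V" "c \<in> carrier K"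
  shows "linear_map K U V (\<lambda>u. c \<odot>\<^bsub>V\<^esub> f u)"
proof -
  interpret module K V by fact
  show ?thesis using assms(1,3)
    by (auto simp: linear_map_def smult_r_distr smult_assoc1[symmetric] R.m_comm)
qed

lemma linear_tensor_sum1:
  assumes "linear_map K U (tensor K V W) f" "module K V" "module K W" "module K M"
    and "\<And>v. v \<in> carrier V \<Longrightarrow> linear_map K W M (\<lambda>w. \<beta> v w)"
    and "\<And>w. w \<in> carrier W \<Longrightarrow> linear_map K V M (\<lambda>v. \<beta> v w)"
  shows "linear_map K U M (\<lambda>u. tensor_sum M \<beta> (f u))"
  using linear_compose[OF assms(1) linear_tensor_sum[OF assms(2-4) bilinear_mapI]] assms(5,6) by blast

text \<open>The rules follow the outermost operation under the lambda, so \<open>intro\<close>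
  decomposes a linearity goal until conditions on carriers and modules remain.\<close>

lemmas linear_intros = linear_ident linear_id linear_pure1 linear_pure2 linear_smult1 linear_smult2
  linear_tensor_sum1 linear_tensor_sum_param

lemma tensor_lift_eq:
  "x \<in> carrier (tensor K V W) \<Longrightarrow> tensor_lift K V W M \<beta> x = tensor_sum M \<beta> x"
  by (simp add: tensor_lift_def)

lemma tensor_lift_pure:
  assumes "bilinear_map K V W M \<beta>" "module K V" "module K W" "module K M"
    "v \<in> carrier V" "w \<in> carrier W"
  shows "tensor_lift K V W M \<beta> (pure K V W v w) = \<beta> v w"
  using assms by (simp add: tensor_lift_eq tensor_sum_pure)

lemma linear_tensor_lift:
  assumes "bilinear_map K V W M \<beta>" "module K V" "module K W" "module K M"
  shows "linear_map K (tensor K V W) M (tensor_lift K V W M \<beta>)"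
  unfolding tensor_lift_def using assms by (simp add: linear_tensor_sum)

lemma tensor_lift_in_lin_maps:
  assumes "bilinear_map K V W M \<beta>" "module K V" "module K W" "module K M"
  shows "tensor_lift K V W M \<beta> \<in> lin_maps K (tensor K V W) M"
  using linear_tensor_lift[OF assms] by (simp add: lin_maps_iff tensor_lift_def)

lemma lin_maps_linear [simp]: "f \<in> lin_maps K V W \<Longrightarrow> linear_map K V W f"
  by (simp add: lin_maps_iff)

lemma lin_maps_closed: "f \<in> lin_maps K V W \<Longrightarrow> x \<in> carrier V \<Longrightarrow> f x \<in> carrier W"
  by (auto simp: lin_maps_iff linear_map_closed)

lemma lin_maps_compose [intro]:
  "\<lbrakk>f \<in> lin_maps K U V; g \<in> lin_maps K V W; module K U\<rbrakk> \<Longrightarrow> compose (carrier U) g f \<in> lin_maps K U W"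
  by (auto simp: lin_maps_iff linear_map_def compose_eq)

lemma lin_maps_ident [intro, simp]: "module K V \<Longrightarrow> (\<lambda>x\<in>carrier V. x) \<in> lin_maps K V V"
  by (simp add: lin_maps_iff)

lemma lin_maps_eqI:
  "\<lbrakk>f \<in> lin_maps K V W; g \<in> lin_maps K V W; \<And>x. x \<in> carrier V \<Longrightarrow> f x = g x\<rbrakk> \<Longrightarrow> f = g"
  by (auto simp: lin_maps_iff intro: extensionalityI)

section \<open>Maps out of iterated tensor products\<close>

lemma linear_map_pure_left:
  assumes "linear_map K (tensor K V W) M f" "module K V" "module K W" "w \<in> carrier W"
  shows "linear_map K V M (\<lambda>v. f (pure K V W v w))"
  using linear_compose[OF pure_linear_left assms(1)] assms(2-) by blast

lemma linear_map_pure_right: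
  assumes "linear_map K (tensor K V W) M f" "module K V" "module K W" "v \<in> carrier V"
  shows "linear_map K W M (\<lambda>w. f (pure K V W v w))"
  using linear_compose[OF pure_linear_right assms(1)] assms(2-) by blast

text \<open>The letters l and r in the names record left and right bracketing. The outer tensor
  product is peeled off first; with the outer factor w fixed, p \<mapsto> f(p \<otimes> w) is
  linear, so \<open>tensor_eqI\<close> applies again. The fourfold versions below serve the
  pentagon.\<close>

lemma tensor3l_eqI:
  assumes "module K U" "module K V" "module K W" "module K M"
    and "linear_map K (tensor K (tensor K U V) W) M f" "linear_map K (tensor K (tensor K U V) W) M g"
    and "\<And>u v w. \<lbrakk>u \<in> carrier U; v \<in> carrier V; w \<in> carrier W\<rbrakk>
      \<Longrightarrow> f (pure K (tensor K U V) W (pure K U V u v) w) = g (pure K (tensor K U V) W (pure K U V u v) w)"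
    and "x \<in> carrier (tensor K (tensor K U V) W)"
  shows "f x = g x"
proof (rule tensor_eqI[OF _ assms(3,4,5,6) _ assms(8)])
  fix p w assume p: "p \<in> carrier (tensor K U V)" and w: "w \<in> carrier W"
  show "f (pure K (tensor K U V) W p w) = g (pure K (tensor K U V) W p w)"
    by (rule tensor_eqI[OF assms(1,2,4) _ _ _ p]) (use assms w in \<open>auto intro!: linear_map_pure_left\<close>)
qed (use assms in auto)

lemma tensor3r_eqI:
  assumes "module K U" "module K V" "module K W" "module K M"
    and "linear_map K (tensor K U (tensor K V W)) M f" "linear_map K (tensor K U (tensor K V W)) M g"
    and "\<And>u v w. \<lbrakk>u \<in> carrier U; v \<in> carrier V; w \<in> carrier W\<rbrakk>
      \<Longrightarrow> f (pure K U (tensor K V W) u (pure K V W v w)) = g (pure K U (tensor K V W) u (pure K V W v w))"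
    and "x \<in> carrier (tensor K U (tensor K V W))"
  shows "f x = g x"
proof (rule tensor_eqI[OF assms(1) _ assms(4,5,6) _ assms(8)])
  fix u p assume p: "p \<in> carrier (tensor K V W)" and u: "u \<in> carrier U"
  show "f (pure K U (tensor K V W) u p) = g (pure K U (tensor K V W) u p)"
    by (rule tensor_eqI[OF assms(2,3,4) _ _ _ p]) (use assms u in \<open>auto intro!: linear_map_pure_right\<close>)
qed (use assms in auto)

lemma tensor4l_eqI:
  assumes "module K U" "module K V" "module K W" "module K X" "module K M"
    and "linear_map K (tensor K (tensor K (tensor K U V) W) X) M f"
      "linear_map K (tensor K (tensor K (tensor K U V) W) X) M g"
    and "\<And>u v w y. \<lbrakk>u \<in> carrier U; v \<in> carrier V; w \<in> carrier W; y \<in> carrier X\<rbrakk>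
      \<Longrightarrow> f (pure K (tensor K (tensor K U V) W) X (pure K (tensor K U V) W (pure K U V u v) w) y) =
          g (pure K (tensor K (tensor K U V) W) X (pure K (tensor K U V) W (pure K U V u v) w) y)"
    and "x \<in> carrier (tensor K (tensor K (tensor K U V) W) X)"
  shows "f x = g x"
proof (rule tensor_eqI[OF _ assms(4,5,6,7) _ assms(9)])
  fix p w assume p: "p \<in> carrier (tensor K (tensor K U V) W)" and w: "w \<in> carrier X"
  show "f (pure K (tensor K (tensor K U V) W) X p w) = g (pure K (tensor K (tensor K U V) W) X p w)"
    by (rule tensor3l_eqI[OF assms(1,2,3,5) _ _ _ p]) (use assms w in \<open>auto intro!: linear_map_pure_left\<close>)
qed (use assms in auto)

lemma tensor4r_eqI:
  assumes "module K U" "module K V" "module K W" "module K X" "module K M"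
    and "linear_map K (tensor K U (tensor K V (tensor K W X))) M f"
      "linear_map K (tensor K U (tensor K V (tensor K W X))) M g"
    and "\<And>u v w y. \<lbrakk>u \<in> carrier U; v \<in> carrier V; w \<in> carrier W; y \<in> carrier X\<rbrakk>
      \<Longrightarrow> f (pure K U (tensor K V (tensor K W X)) u (pure K V (tensor K W X) v (pure K W X w y))) =
          g (pure K U (tensor K V (tensor K W X)) u (pure K V (tensor K W X) v (pure K W X w y)))"
    and "x \<in> carrier (tensor K U (tensor K V (tensor K W X)))"
  shows "f x = g x"
proof (rule tensor_eqI[OF assms(1) _ assms(5,6,7) _ assms(9)])
  fix u p assume p: "p \<in> carrier (tensor K V (tensor K W X))" and u: "u \<in> carrier U"
  show "f (pure K U (tensor K V (tensor K W X)) u p) = g (pure K U (tensor K V (tensor K W X)) u p)"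
    by (rule tensor3r_eqI[OF assms(2,3,4,5) _ _ _ p]) (use assms u in \<open>auto intro!: linear_map_pure_right\<close>)
qed (use assms in auto)

section \<open>Coherence of the tensor product\<close>

lemma bilinear_tensor_map:
  assumes "linear_map K V V' f" "linear_map K W W' g" "module K V'" "module K W'"
  shows "bilinear_map K V W (tensor K V' W') (\<lambda>v w. pure K V' W' (f v) (g w))"
  using assms by (intro bilinear_mapI linear_intros) (auto intro: linear_map_closed)

lemma tensor_map_pure [simp]:
  assumes "linear_map K V V' f" "linear_map K W W' g"
    "module K V" "module K W" "module K V'" "module K W'" "v \<in> carrier V" "w \<in> carrier W"
  shows "tensor_map K V W V' W' f g (pure K V W v w) = pure K V' W' (f v) (g w)"
  unfolding tensor_map_def using assms by (intro tensor_lift_pure bilinear_tensor_map module_tensor)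

lemma tensor_map_in_lin_maps:
  assumes "linear_map K V V' f" "linear_map K W W' g"
    "module K V" "module K W" "module K V'" "module K W'"
  shows "tensor_map K V W V' W' f g \<in> lin_maps K (tensor K V W) (tensor K V' W')"
  unfolding tensor_map_def using assms by (intro tensor_lift_in_lin_maps bilinear_tensor_map module_tensor)

lemma linear_tensor_map [simp]:
  assumes "linear_map K V V' f" "linear_map K W W' g"
    "module K V" "module K W" "module K V'" "module K W'"
  shows "linear_map K (tensor K V W) (tensor K V' W') (tensor_map K V W V' W' f g)"
  using tensor_map_in_lin_maps[OF assms] by simp

lemma bilinear_tensor_assoc_inner:
  assumes "module K U" "module K V" "module K W" "w \<in> carrier W"
  shows "bilinear_map K U V (tensor K U (tensor K V W)) (\<lambda>u v. pure K U (tensor K V W) u (pure K V W v w))"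
  using assms by (intro bilinear_mapI linear_intros) auto

text \<open>Linearity in p is that of a lift. Linearity in w is less direct, since w sits inside the
  inner bilinear map: for fixed p the lift is a \<open>tensor_sum\<close> whose summands are linear
  in w.\<close>

lemma bilinear_tensor_assoc:
  assumes "module K U" "module K V" "module K W"
  shows "bilinear_map K (tensor K U V) W (tensor K U (tensor K V W))
    (\<lambda>p w. tensor_lift K U V (tensor K U (tensor K V W))
        (\<lambda>u v. pure K U (tensor K V W) u (pure K V W v w)) p)"
proof (rule bilinear_mapI)
  fix p assume p: "p \<in> carrier (tensor K U V)"
  show "linear_map K W (tensor K U (tensor K V W))
    (\<lambda>w. tensor_lift K U V (tensor K U (tensor K V W)) (\<lambda>u v. pure K U (tensor K V W) u (pure K V W v w)) p)"
    unfolding tensor_lift_eq[OF p] using assms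
    by (intro linear_tensor_sum_param[OF _ _ p]) (auto intro!: linear_intros)
qed (use assms in \<open>auto intro!: linear_tensor_lift bilinear_tensor_assoc_inner\<close>)

lemma tensor_assoc_pure [simp]:
  assumes "module K U" "module K V" "module K W" "u \<in> carrier U" "v \<in> carrier V" "w \<in> carrier W"
  shows "tensor_assoc K U V W (pure K (tensor K U V) W (pure K U V u v) w) =
    pure K U (tensor K V W) u (pure K V W v w)"
  unfolding tensor_assoc_def using assms
  by (simp add: tensor_lift_pure[OF bilinear_tensor_assoc] tensor_lift_pure[OF bilinear_tensor_assoc_inner])

lemma tensor_assoc_in_lin_maps:
  assumes "module K U" "module K V" "module K W"
  shows "tensor_assoc K U V W \<in> lin_maps K (tensor K (tensor K U V) W) (tensor K U (tensor K V W))"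
  unfolding tensor_assoc_def using assms by (intro tensor_lift_in_lin_maps bilinear_tensor_assoc) auto

lemma bilinear_tensor_assoc_inv_inner:
  assumes "module K U" "module K V" "module K W" "u \<in> carrier U"
  shows "bilinear_map K V W (tensor K (tensor K U V) W) (\<lambda>v w. pure K (tensor K U V) W (pure K U V u v) w)"
  using assms by (intro bilinear_mapI linear_intros) auto

lemma bilinear_tensor_assoc_inv:
  assumes "module K U" "module K V" "module K W"
  shows "bilinear_map K U (tensor K V W) (tensor K (tensor K U V) W)
    (\<lambda>u p. tensor_lift K V W (tensor K (tensor K U V) W)
        (\<lambda>v w. pure K (tensor K U V) W (pure K U V u v) w) p)"
proof (rule bilinear_mapI)
  fix p assume p: "p \<in> carrier (tensor K V W)"
  show "linear_map K U (tensor K (tensor K U V) W)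
    (\<lambda>u. tensor_lift K V W (tensor K (tensor K U V) W) (\<lambda>v w. pure K (tensor K U V) W (pure K U V u v) w) p)"
    unfolding tensor_lift_eq[OF p] using assms
    by (intro linear_tensor_sum_param[OF _ _ p]) (auto intro!: linear_intros)
qed (use assms in \<open>auto intro!: linear_tensor_lift bilinear_tensor_assoc_inv_inner\<close>)

lemma tensor_assoc_inv_pure [simp]:
  assumes "module K U" "module K V" "module K W" "u \<in> carrier U" "v \<in> carrier V" "w \<in> carrier W"
  shows "tensor_assoc_inv K U V W (pure K U (tensor K V W) u (pure K V W v w)) =
    pure K (tensor K U V) W (pure K U V u v) w"
  unfolding tensor_assoc_inv_def using assms
  by (simp add: tensor_lift_pure[OF bilinear_tensor_assoc_inv] tensor_lift_pure[OF bilinear_tensor_assoc_inv_inner])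

lemma tensor_assoc_inv_in_lin_maps:
  assumes "module K U" "module K V" "module K W"
  shows "tensor_assoc_inv K U V W \<in> lin_maps K (tensor K U (tensor K V W)) (tensor K (tensor K U V) W)"
  unfolding tensor_assoc_inv_def using assms by (intro tensor_lift_in_lin_maps bilinear_tensor_assoc_inv) auto

lemma linear_tensor_assoc [simp]:
  assumes "module K U" "module K V" "module K W"
  shows "linear_map K (tensor K (tensor K U V) W) (tensor K U (tensor K V W)) (tensor_assoc K U V W)"
    and "linear_map K (tensor K U (tensor K V W)) (tensor K (tensor K U V) W) (tensor_assoc_inv K U V W)"
  using tensor_assoc_in_lin_maps[OF assms] tensor_assoc_inv_in_lin_maps[OF assms] by simp_all

lemmas structure_lin_maps = lin_maps_compose lin_maps_ident tensor_map_in_lin_maps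
  tensor_assoc_in_lin_maps tensor_assoc_inv_in_lin_maps

lemma tensor_map_ident:
  assumes "module K V" "module K W"
  shows "tensor_map K V W V W (\<lambda>v\<in>carrier V. v) (\<lambda>w\<in>carrier W. w) = (\<lambda>x\<in>carrier (tensor K V W). x)"
proof (rule lin_maps_eqI)
  fix x assume x: "x \<in> carrier (tensor K V W)"
  show "tensor_map K V W V W (\<lambda>v\<in>carrier V. v) (\<lambda>w\<in>carrier W. w) x = (\<lambda>x\<in>carrier (tensor K V W). x) x"
    by (rule tensor_eqI[OF assms module_tensor[OF assms] _ _ _ x]) (use assms in auto)
qed (use assms in \<open>auto intro!: structure_lin_maps\<close>)

text \<open>The interchange law; for both bicategories it provides the functoriality of horizontal
  composition on 2-cells.\<close>

lemma tensor_map_compose: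
  assumes "module K V" "module K W" "module K V'" "module K W'" "module K V''" "module K W''"
    and f: "f \<in> lin_maps K V V'" "f' \<in> lin_maps K V' V''"
    and g: "g \<in> lin_maps K W W'" "g' \<in> lin_maps K W' W''"
  shows "tensor_map K V W V'' W'' (compose (carrier V) f' f) (compose (carrier W) g' g) =
    compose (carrier (tensor K V W)) (tensor_map K V' W' V'' W'' f' g') (tensor_map K V W V' W' f g)"
    (is "?l = ?r")
proof (rule lin_maps_eqI)
  have c: "linear_map K V V'' (compose (carrier V) f' f)" "linear_map K W W'' (compose (carrier W) g' g)"
    using assms(1-6) f g by (auto intro!: lin_maps_linear lin_maps_compose)
  show l: "?l \<in> lin_maps K (tensor K V W) (tensor K V'' W'')"
    using assms c by (intro structure_lin_maps)
  show r: "?r \<in> lin_maps K (tensor K V W) (tensor K V'' W'')"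
    using assms by (auto intro!: structure_lin_maps)
  show "?l x = ?r x" if x: "x \<in> carrier (tensor K V W)" for x
    by (rule tensor_eqI[OF assms(1,2) _ lin_maps_linear[OF l] lin_maps_linear[OF r] _ x])
      (use assms c in \<open>simp_all add: compose_eq lin_maps_closed\<close>)
qed

lemma tensor_assoc_inverse:
  assumes "module K U" "module K V" "module K W"
  shows "compose (carrier (tensor K (tensor K U V) W)) (tensor_assoc_inv K U V W) (tensor_assoc K U V W) =
      (\<lambda>x\<in>carrier (tensor K (tensor K U V) W). x)" (is "?l = ?i")
    and "compose (carrier (tensor K U (tensor K V W))) (tensor_assoc K U V W) (tensor_assoc_inv K U V W) =
      (\<lambda>x\<in>carrier (tensor K U (tensor K V W)). x)" (is "?r = ?j")
proof -
  have l: "?l \<in> lin_maps K (tensor K (tensor K U V) W) (tensor K (tensor K U V) W)"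
    and r: "?r \<in> lin_maps K (tensor K U (tensor K V W)) (tensor K U (tensor K V W))"
    using assms by (auto intro!: structure_lin_maps)
  show "?l = ?i"
  proof (rule lin_maps_eqI[OF l])
    show "?l x = ?i x" if "x \<in> carrier (tensor K (tensor K U V) W)" for x
      by (rule tensor3l_eqI[OF assms _ lin_maps_linear[OF l] _ _ that])
        (use assms in \<open>auto simp: compose_eq\<close>)
  qed (use assms in simp)
  show "?r = ?j"
  proof (rule lin_maps_eqI[OF r])
    show "?r x = ?j x" if "x \<in> carrier (tensor K U (tensor K V W))" for x
      by (rule tensor3r_eqI[OF assms _ lin_maps_linear[OF r] _ _ that])
        (use assms in \<open>auto simp: compose_eq\<close>)
  qed (use assms in simp)
qed

lemma tensor_assoc_natural:
  assumes "module K U" "module K V" "module K W" "module K U'" "module K V'" "module K W'"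
    and "f \<in> lin_maps K U U'" "g \<in> lin_maps K V V'" "h \<in> lin_maps K W W'"
  shows "compose (carrier (tensor K (tensor K U V) W)) (tensor_assoc K U' V' W')
      (tensor_map K (tensor K U V) W (tensor K U' V') W' (tensor_map K U V U' V' f g) h) =
    compose (carrier (tensor K (tensor K U V) W))
      (tensor_map K U (tensor K V W) U' (tensor K V' W') f (tensor_map K V W V' W' g h)) (tensor_assoc K U V W)"
    (is "?l = ?r")
proof (rule lin_maps_eqI)
  show l: "?l \<in> lin_maps K (tensor K (tensor K U V) W) (tensor K U' (tensor K V' W'))"
    and r: "?r \<in> lin_maps K (tensor K (tensor K U V) W) (tensor K U' (tensor K V' W'))"
    using assms by (auto intro!: structure_lin_maps)
  show "?l x = ?r x" if x: "x \<in> carrier (tensor K (tensor K U V) W)" for x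
    by (rule tensor3l_eqI[OF assms(1-3) _ lin_maps_linear[OF l] lin_maps_linear[OF r] _ x])
      (use assms in \<open>auto simp: compose_eq lin_maps_closed\<close>)
qed

text \<open>Read on pure tensors like its companion. It serves the bicategory of extensions, whose
  associator is the inverse rebracketing.\<close>

lemma tensor_assoc_inv_natural:
  assumes "module K U" "module K V" "module K W" "module K U'" "module K V'" "module K W'"
    and "f \<in> lin_maps K U U'" "g \<in> lin_maps K V V'" "h \<in> lin_maps K W W'"
  shows "compose (carrier (tensor K U (tensor K V W))) (tensor_assoc_inv K U' V' W')
      (tensor_map K U (tensor K V W) U' (tensor K V' W') f (tensor_map K V W V' W' g h)) =
    compose (carrier (tensor K U (tensor K V W)))
      (tensor_map K (tensor K U V) W (tensor K U' V') W' (tensor_map K U V U' V' f g) h) (tensor_assoc_inv K U V W)"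
    (is "?l = ?r")
proof (rule lin_maps_eqI)
  show l: "?l \<in> lin_maps K (tensor K U (tensor K V W)) (tensor K (tensor K U' V') W')"
    and r: "?r \<in> lin_maps K (tensor K U (tensor K V W)) (tensor K (tensor K U' V') W')"
    using assms by (auto intro!: structure_lin_maps)
  show "?l x = ?r x" if x: "x \<in> carrier (tensor K U (tensor K V W))" for x
    by (rule tensor3r_eqI[OF assms(1-3) _ lin_maps_linear[OF l] lin_maps_linear[OF r] _ x])
      (use assms in \<open>auto simp: compose_eq lin_maps_closed\<close>)
qed

lemma tensor_pentagon:
  assumes "module K U" "module K V" "module K W" "module K X"
  shows "compose (carrier (tensor K (tensor K (tensor K U V) W) X))
      (tensor_assoc K U V (tensor K W X)) (tensor_assoc K (tensor K U V) W X) =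
    compose (carrier (tensor K (tensor K (tensor K U V) W) X))
      (tensor_map K U (tensor K (tensor K V W) X) U (tensor K V (tensor K W X))
        (\<lambda>x\<in>carrier U. x) (tensor_assoc K V W X))
      (compose (carrier (tensor K (tensor K (tensor K U V) W) X))
        (tensor_assoc K U (tensor K V W) X)
        (tensor_map K (tensor K (tensor K U V) W) X (tensor K U (tensor K V W)) X
          (tensor_assoc K U V W) (\<lambda>x\<in>carrier X. x)))"
    (is "?l = ?r")
proof (rule lin_maps_eqI)
  show l: "?l \<in> lin_maps K (tensor K (tensor K (tensor K U V) W) X) (tensor K U (tensor K V (tensor K W X)))"
    and r: "?r \<in> lin_maps K (tensor K (tensor K (tensor K U V) W) X) (tensor K U (tensor K V (tensor K W X)))"
    using assms by (auto intro!: structure_lin_maps)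
  show "?l x = ?r x" if x: "x \<in> carrier (tensor K (tensor K (tensor K U V) W) X)" for x
    by (rule tensor4l_eqI[OF assms _ lin_maps_linear[OF l] lin_maps_linear[OF r] _ x])
      (use assms in \<open>auto simp: compose_eq\<close>)
qed

text \<open>The pentagon traversed from the fully right-bracketed to the fully left-bracketed
  product. With U, V, W, X the algebras of f, g, h, l in the order of composition, this is the
  pentagon for extensions.\<close>

lemma tensor_pentagon_inv:
  assumes "module K U" "module K V" "module K W" "module K X"
  shows "compose (carrier (tensor K U (tensor K V (tensor K W X))))
      (tensor_assoc_inv K (tensor K U V) W X) (tensor_assoc_inv K U V (tensor K W X)) =
    compose (carrier (tensor K U (tensor K V (tensor K W X))))
      (tensor_map K (tensor K U (tensor K V W)) X (tensor K (tensor K U V) W) X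
        (tensor_assoc_inv K U V W) (\<lambda>x\<in>carrier X. x))
      (compose (carrier (tensor K U (tensor K V (tensor K W X))))
        (tensor_assoc_inv K U (tensor K V W) X)
        (tensor_map K U (tensor K V (tensor K W X)) U (tensor K (tensor K V W) X)
          (\<lambda>x\<in>carrier U. x) (tensor_assoc_inv K V W X)))"
    (is "?l = ?r")
proof (rule lin_maps_eqI)
  show l: "?l \<in> lin_maps K (tensor K U (tensor K V (tensor K W X))) (tensor K (tensor K (tensor K U V) W) X)"
    and r: "?r \<in> lin_maps K (tensor K U (tensor K V (tensor K W X))) (tensor K (tensor K (tensor K U V) W) X)"
    using assms by (auto intro!: structure_lin_maps)
  show "?l x = ?r x" if x: "x \<in> carrier (tensor K U (tensor K V (tensor K W X)))" for x
    by (rule tensor4r_eqI[OF assms _ lin_maps_linear[OF l] lin_maps_linear[OF r] _ x])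
      (use assms in \<open>auto simp: compose_eq\<close>)
qed

section \<open>The unit of the tensor product\<close>

lemma carrier_unit [simp]: "carrier (unit_algebra K) = Scal ` carrier K"
  and add_unit [simp]: "Scal a \<oplus>\<^bsub>unit_algebra K\<^esub> Scal b = Scal (a \<oplus>\<^bsub>K\<^esub> b)"
  and smult_unit [simp]: "c \<odot>\<^bsub>unit_algebra K\<^esub> Scal b = Scal (c \<otimes>\<^bsub>K\<^esub> b)"
  and mult_unit [simp]: "Scal a \<otimes>\<^bsub>unit_algebra K\<^esub> Scal b = Scal (a \<otimes>\<^bsub>K\<^esub> b)"
  and one_unit [simp]: "\<one>\<^bsub>unit_algebra K\<^esub> = Scal \<one>\<^bsub>K\<^esub>"
  and zero_unit [simp]: "\<zero>\<^bsub>unit_algebra K\<^esub> = Scal \<zero>\<^bsub>K\<^esub>"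
  by (simp_all add: unit_algebra_def)

lemma k_algebra_unit: "k_algebra K (unit_algebra K)"
proof -
  interpret cring K by (rule cring_K)
  have g: "abelian_group (unit_algebra K)"
    by (rule abelian_groupI) (auto simp: a_assoc a_comm a_lcomm intro: bexI[of _ "\<ominus>\<^bsub>K\<^esub> _"] l_neg)
  have m: "module K (unit_algebra K)"
    by (rule moduleI) (auto simp: g cring_K l_distr r_distr m_assoc)
  have r: "ring (unit_algebra K)"
    by (rule ringI) (auto simp: g l_distr r_distr m_assoc intro!: monoidI)
  show ?thesis
    by (intro k_algebra.intro k_algebra_axioms.intro m r) (auto simp: m_assoc m_lcomm)
qed

lemma module_unit [simp]: "module K (unit_algebra K)"
  using k_algebra_unit by (rule k_algebra.axioms)

lemma ground_ring_closed [simp]: "\<one>\<^bsub>K\<^esub> \<in> carrier K" "\<zero>\<^bsub>K\<^esub> \<in> carrier K"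
proof -
  interpret cring K by (rule cring_K)
  show "\<one>\<^bsub>K\<^esub> \<in> carrier K" "\<zero>\<^bsub>K\<^esub> \<in> carrier K" by simp_all
qed

lemma ground_ring_simps [simp]:
  "\<lbrakk>a \<in> carrier K; b \<in> carrier K\<rbrakk> \<Longrightarrow> a \<otimes>\<^bsub>K\<^esub> b \<in> carrier K"
  "a \<in> carrier K \<Longrightarrow> a \<otimes>\<^bsub>K\<^esub> \<one>\<^bsub>K\<^esub> = a"
  "a \<in> carrier K \<Longrightarrow> \<one>\<^bsub>K\<^esub> \<otimes>\<^bsub>K\<^esub> a = a"
proof -
  interpret cring K by (rule cring_K)
  show "\<lbrakk>a \<in> carrier K; b \<in> carrier K\<rbrakk> \<Longrightarrow> a \<otimes>\<^bsub>K\<^esub> b \<in> carrier K"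
    "a \<in> carrier K \<Longrightarrow> a \<otimes>\<^bsub>K\<^esub> \<one>\<^bsub>K\<^esub> = a"
    "a \<in> carrier K \<Longrightarrow> \<one>\<^bsub>K\<^esub> \<otimes>\<^bsub>K\<^esub> a = a" by simp_all
qed

lemma linear_scalar [simp]: "linear_map K (unit_algebra K) (base_module K) scalar"
  by (auto intro!: linear_mapI)

text \<open>Left and right refer to the position of the ground ring in the tensor product. For
  extensions these are interchanged with the unitors of the bicategory, because composites are
  written in the opposite order.\<close>

abbreviation left_unitor :: "('k, ('k, 'a) univ, 'm) module_scheme \<Rightarrow> ('k, 'a) univ \<Rightarrow> ('k, 'a) univ" where
  "left_unitor V \<equiv> tensor_lift K (unit_algebra K) V V (\<lambda>x v. scalar x \<odot>\<^bsub>V\<^esub> v)"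

abbreviation right_unitor :: "('k, ('k, 'a) univ, 'm) module_scheme \<Rightarrow> ('k, 'a) univ \<Rightarrow> ('k, 'a) univ" where
  "right_unitor V \<equiv> tensor_lift K V (unit_algebra K) V (\<lambda>v x. scalar x \<odot>\<^bsub>V\<^esub> v)"

lemma bilinear_unitor:
  assumes "module K V"
  shows "bilinear_map K (unit_algebra K) V V (\<lambda>x v. scalar x \<odot>\<^bsub>V\<^esub> v)"
    and "bilinear_map K V (unit_algebra K) V (\<lambda>v x. scalar x \<odot>\<^bsub>V\<^esub> v)"
  using assms by (auto intro!: bilinear_mapI linear_intros)

lemma unitor_pure [simp]:
  assumes "module K V" "v \<in> carrier V" "c \<in> carrier K"
  shows "left_unitor V (pure K (unit_algebra K) V (Scal c) v) = c \<odot>\<^bsub>V\<^esub> v"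
    and "right_unitor V (pure K V (unit_algebra K) v (Scal c)) = c \<odot>\<^bsub>V\<^esub> v"
  using assms by (simp_all add: tensor_lift_pure[OF bilinear_unitor(1)] tensor_lift_pure[OF bilinear_unitor(2)])

lemma unitor_in_lin_maps [simp]:
  assumes "module K V"
  shows "left_unitor V \<in> lin_maps K (tensor K (unit_algebra K) V) V"
    and "right_unitor V \<in> lin_maps K (tensor K V (unit_algebra K)) V"
  using assms by (auto intro!: tensor_lift_in_lin_maps bilinear_unitor)

lemma linear_unitor [simp]:
  assumes "module K V"
  shows "linear_map K (tensor K (unit_algebra K) V) V (left_unitor V)"
    and "linear_map K (tensor K V (unit_algebra K)) V (right_unitor V)"
  using unitor_in_lin_maps[OF assms] by simp_all

lemma pure_smult:
  assumes "module K V" "module K W" "c \<in> carrier K" "v \<in> carrier V" "w \<in> carrier W"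
  shows "pure K V W (c \<odot>\<^bsub>V\<^esub> v) w = c \<odot>\<^bsub>tensor K V W\<^esub> pure K V W v w"
    and "pure K V W v (c \<odot>\<^bsub>W\<^esub> w) = c \<odot>\<^bsub>tensor K V W\<^esub> pure K V W v w"
  using linear_map_smult[OF pure_linear_left[OF assms(1,2,5)] assms(3,4)]
    linear_map_smult[OF pure_linear_right[OF assms(1,2,4)] assms(3,5)] .

lemma pure_Scal:
  assumes "module K V" "c \<in> carrier K" "v \<in> carrier V"
  shows "pure K (unit_algebra K) V (Scal c) v = c \<odot>\<^bsub>tensor K (unit_algebra K) V\<^esub> pure K (unit_algebra K) V (Scal \<one>\<^bsub>K\<^esub>) v"
    and "pure K V (unit_algebra K) v (Scal c) = c \<odot>\<^bsub>tensor K V (unit_algebra K)\<^esub> pure K V (unit_algebra K) v (Scal \<one>\<^bsub>K\<^esub>)"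
  using pure_smult[of "unit_algebra K" V c "Scal \<one>\<^bsub>K\<^esub>" v] pure_smult[of V "unit_algebra K" c v "Scal \<one>\<^bsub>K\<^esub>"] assms
  by simp_all

lemma left_unitor_inverse:
  assumes "module K V"
  shows "(\<lambda>v\<in>carrier V. pure K (unit_algebra K) V (Scal \<one>\<^bsub>K\<^esub>) v) \<in> lin_maps K V (tensor K (unit_algebra K) V)"
    and "compose (carrier (tensor K (unit_algebra K) V)) (\<lambda>v\<in>carrier V. pure K (unit_algebra K) V (Scal \<one>\<^bsub>K\<^esub>) v) (left_unitor V)
      = (\<lambda>x\<in>carrier (tensor K (unit_algebra K) V). x)" (is "?l = ?i")
    and "compose (carrier V) (left_unitor V) (\<lambda>v\<in>carrier V. pure K (unit_algebra K) V (Scal \<one>\<^bsub>K\<^esub>) v) = (\<lambda>v\<in>carrier V. v)"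
proof -
  show 1: "(\<lambda>v\<in>carrier V. pure K (unit_algebra K) V (Scal \<one>\<^bsub>K\<^esub>) v) \<in> lin_maps K V (tensor K (unit_algebra K) V)"
    using assms by (auto simp: lin_maps_iff intro!: linear_intros)
  have l: "?l \<in> lin_maps K (tensor K (unit_algebra K) V) (tensor K (unit_algebra K) V)"
    using assms by (intro lin_maps_compose[OF unitor_in_lin_maps(1) 1]) auto
  show "?l = ?i"
  proof (rule lin_maps_eqI[OF l])
    show "?l x = ?i x" if "x \<in> carrier (tensor K (unit_algebra K) V)" for x
      by (rule tensor_eqI[OF module_unit assms module_tensor[OF module_unit assms] lin_maps_linear[OF l] _ _ that])
        (use assms in \<open>auto simp: compose_eq pure_Scal[of V _, symmetric] pure_smult(2)\<close>)
  qed (use assms in simp)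
  show "compose (carrier V) (left_unitor V) (\<lambda>v\<in>carrier V. pure K (unit_algebra K) V (Scal \<one>\<^bsub>K\<^esub>) v) = (\<lambda>v\<in>carrier V. v)"
    using assms by (auto simp: compose_def intro!: restrict_ext)
qed

lemma right_unitor_inverse:
  assumes "module K V"
  shows "(\<lambda>v\<in>carrier V. pure K V (unit_algebra K) v (Scal \<one>\<^bsub>K\<^esub>)) \<in> lin_maps K V (tensor K V (unit_algebra K))"
    and "compose (carrier (tensor K V (unit_algebra K))) (\<lambda>v\<in>carrier V. pure K V (unit_algebra K) v (Scal \<one>\<^bsub>K\<^esub>)) (right_unitor V)
      = (\<lambda>x\<in>carrier (tensor K V (unit_algebra K)). x)" (is "?l = ?i")
    and "compose (carrier V) (right_unitor V) (\<lambda>v\<in>carrier V. pure K V (unit_algebra K) v (Scal \<one>\<^bsub>K\<^esub>)) = (\<lambda>v\<in>carrier V. v)"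
proof -
  show 1: "(\<lambda>v\<in>carrier V. pure K V (unit_algebra K) v (Scal \<one>\<^bsub>K\<^esub>)) \<in> lin_maps K V (tensor K V (unit_algebra K))"
    using assms by (auto simp: lin_maps_iff intro!: linear_intros)
  have l: "?l \<in> lin_maps K (tensor K V (unit_algebra K)) (tensor K V (unit_algebra K))"
    using assms by (intro lin_maps_compose[OF unitor_in_lin_maps(2) 1]) auto
  show "?l = ?i"
  proof (rule lin_maps_eqI[OF l])
    show "?l x = ?i x" if "x \<in> carrier (tensor K V (unit_algebra K))" for x
      by (rule tensor_eqI[OF assms module_unit module_tensor[OF assms module_unit] lin_maps_linear[OF l] _ _ that])
        (use assms in \<open>auto simp: compose_eq pure_Scal[of V _, symmetric] pure_smult(1)\<close>)
  qed (use assms in simp)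
  show "compose (carrier V) (right_unitor V) (\<lambda>v\<in>carrier V. pure K V (unit_algebra K) v (Scal \<one>\<^bsub>K\<^esub>)) = (\<lambda>v\<in>carrier V. v)"
    using assms by (auto simp: compose_def intro!: restrict_ext)
qed

lemma unitor_natural:
  assumes "module K V" "module K W" "f \<in> lin_maps K V W"
  shows "compose (carrier (tensor K (unit_algebra K) V)) (left_unitor W)
      (tensor_map K (unit_algebra K) V (unit_algebra K) W (\<lambda>x\<in>carrier (unit_algebra K). x) f) =
      compose (carrier (tensor K (unit_algebra K) V)) f (left_unitor V)" (is "?l = ?r")
    and "compose (carrier (tensor K V (unit_algebra K))) (right_unitor W)
      (tensor_map K V (unit_algebra K) W (unit_algebra K) f (\<lambda>x\<in>carrier (unit_algebra K). x)) =
      compose (carrier (tensor K V (unit_algebra K))) f (right_unitor V)" (is "?l' = ?r'")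
proof -
  \<comment> \<open>As a rewrite rule \<open>carrier_unit\<close> turns the carrier into an image,
    and facts phrased with \<open>carrier (unit_algebra K)\<close> no longer match. Below it is
    applied to membership statements only, through \<open>eqset_imp_iff\<close>.\<close>
  note [simp del] = carrier_unit
  have l: "?l \<in> lin_maps K (tensor K (unit_algebra K) V) W"
    and r: "?r \<in> lin_maps K (tensor K (unit_algebra K) V) W"
    and l': "?l' \<in> lin_maps K (tensor K V (unit_algebra K)) W"
    and r': "?r' \<in> lin_maps K (tensor K V (unit_algebra K)) W"
    using assms by (auto intro!: structure_lin_maps unitor_in_lin_maps)
  show "?l = ?r"
  proof (rule lin_maps_eqI[OF l r])
    show "?l x = ?r x" if "x \<in> carrier (tensor K (unit_algebra K) V)" for x
      by (rule tensor_eqI[OF module_unit assms(1,2) lin_maps_linear[OF l] lin_maps_linear[OF r] _ that])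
        (use assms in \<open>auto simp: compose_eq lin_maps_closed linear_map_smult[OF lin_maps_linear[OF assms(3)]] carrier_unit[THEN eqset_imp_iff]\<close>)
  qed
  show "?l' = ?r'"
  proof (rule lin_maps_eqI[OF l' r'])
    show "?l' x = ?r' x" if "x \<in> carrier (tensor K V (unit_algebra K))" for x
      by (rule tensor_eqI[OF assms(1) module_unit assms(2) lin_maps_linear[OF l'] lin_maps_linear[OF r'] _ that])
        (use assms in \<open>auto simp: compose_eq lin_maps_closed linear_map_smult[OF lin_maps_linear[OF assms(3)]] carrier_unit[THEN eqset_imp_iff]\<close>)
  qed
qed

text \<open>On the triple of v, c and w both sides equal c(v \<otimes> w), since the scalar can be
  absorbed by either neighbour. The form with the inverse associator is the triangle for
  extensions.\<close>

lemma tensor_triangle: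
  assumes "module K V" "module K W"
  shows "compose (carrier (tensor K (tensor K V (unit_algebra K)) W))
      (tensor_map K V (tensor K (unit_algebra K) W) V W (\<lambda>v\<in>carrier V. v) (left_unitor W))
      (tensor_assoc K V (unit_algebra K) W) =
    tensor_map K (tensor K V (unit_algebra K)) W V W (right_unitor V) (\<lambda>w\<in>carrier W. w)" (is "?l = ?r")
    and "compose (carrier (tensor K V (tensor K (unit_algebra K) W)))
      (tensor_map K (tensor K V (unit_algebra K)) W V W (right_unitor V) (\<lambda>w\<in>carrier W. w))
      (tensor_assoc_inv K V (unit_algebra K) W) =
    tensor_map K V (tensor K (unit_algebra K) W) V W (\<lambda>v\<in>carrier V. v) (left_unitor W)" (is "?l' = ?r'")
proof -
  let ?I = "unit_algebra K"
  have l: "?l \<in> lin_maps K (tensor K (tensor K V ?I) W) (tensor K V W)"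
    and r: "?r \<in> lin_maps K (tensor K (tensor K V ?I) W) (tensor K V W)"
    and l': "?l' \<in> lin_maps K (tensor K V (tensor K ?I W)) (tensor K V W)"
    and r': "?r' \<in> lin_maps K (tensor K V (tensor K ?I W)) (tensor K V W)"
    using assms by (auto intro!: structure_lin_maps)
  show "?l = ?r"
  proof (rule lin_maps_eqI[OF l r])
    show "?l x = ?r x" if "x \<in> carrier (tensor K (tensor K V ?I) W)" for x
      by (rule tensor3l_eqI[OF assms(1) module_unit assms(2) _ lin_maps_linear[OF l] lin_maps_linear[OF r] _ that])
        (use assms in \<open>auto simp: compose_eq pure_smult\<close>)
  qed
  show "?l' = ?r'"
  proof (rule lin_maps_eqI[OF l' r'])
    show "?l' x = ?r' x" if "x \<in> carrier (tensor K V (tensor K ?I W))" for x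
      by (rule tensor3r_eqI[OF assms(1) module_unit assms(2) _ lin_maps_linear[OF l'] lin_maps_linear[OF r'] _ that])
        (use assms in \<open>auto simp: compose_eq pure_smult\<close>)
  qed
qed

end

section \<open>Coalgebras\<close>

text \<open>
  \<open>coalg_tensor K C D\<close> and \<open>tensor K C D\<close> are records of different types which agree on all fields of a
  module.  The rules \<open>coalg_space\<close> below replace the former by the latter wherever only those fields matter.
\<close>

definition same_space :: "('k, 'u, 'm) module_scheme \<Rightarrow> ('k, 'u, 'n) module_scheme \<Rightarrow> bool" where
  "same_space V V' \<longleftrightarrow> carrier V = carrier V' \<and> monoid.mult V = monoid.mult V' \<and> \<one>\<^bsub>V\<^esub> = \<one>\<^bsub>V'\<^esub> \<and>
    \<zero>\<^bsub>V\<^esub> = \<zero>\<^bsub>V'\<^esub> \<and> add V = add V' \<and> smult V = smult V'"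

lemma same_space_refl [simp]: "same_space V V"
  by (simp add: same_space_def)

lemma same_space_sym: "same_space V V' \<Longrightarrow> same_space V' V"
  by (simp add: same_space_def)

text \<open>One inclusion; as \<open>same_space\<close> is symmetric, the converse is another
  instance. Each rule is reapplied with the corresponding fields exchanged.\<close>

lemma tensor_rel_mono:
  assumes "same_space V V'" "same_space W W'" "tensor_rel K V W xs ys"
  shows "tensor_rel K V' W' xs ys"
  using assms(3)
proof induction
  case (refl xs)
  then show ?case using assms(1,2) by (intro tensor_rel.refl) (simp add: same_space_def)
next
  case (sym xs ys)
  from sym.IH show ?case by (rule tensor_rel.sym)
next
  case (trans xs ys zs)
  from trans.IH show ?case by (rule tensor_rel.trans)
next
  case (append xs xs' ys ys')
  from append.IH show ?case by (rule tensor_rel.append)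
next
  case (commute xs ys)
  then show ?case using assms(1,2) by (intro tensor_rel.commute) (simp_all add: same_space_def)
next
  case (zero w)
  then show ?case using assms(1,2) tensor_rel.zero[of w W' K V'] by (simp add: same_space_def)
next
  case (add_left v v' w)
  then show ?case using assms(1,2) tensor_rel.add_left[of v V' v' w W' K] by (simp add: same_space_def)
next
  case (add_right v w w')
  then show ?case using assms(1,2) tensor_rel.add_right[of v V' w W' w' K] by (simp add: same_space_def)
next
  case (balanced c v w)
  then show ?case using assms(1,2) tensor_rel.balanced[of c K v V' w W'] by (simp add: same_space_def)
qed

lemma tensor_rel_cong:
  assumes "same_space V V'" "same_space W W'"
  shows "tensor_rel K V W = tensor_rel K V' W'"
  using tensor_rel_mono[OF assms] tensor_rel_mono[OF assms[THEN same_space_sym]] by (intro ext) blast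

text \<open>\<open>V\<close> and \<open>V'\<close> may have different record types and so cannot be
  equated, but \<open>tensor\<close> always returns a plain \<open>module\<close> record. Hence
  genuine equations hold here, and they can be used for rewriting.\<close>

lemma tensor_cong:
  assumes "same_space V V'" "same_space W W'"
  shows "pure K V W = pure K V' W'" and "tensor K V W = tensor K V' W'"
proof -
  have t: "tclass K V W = tclass K V' W'"
    by (intro ext) (simp add: tclass_def tensor_rel_cong[OF assms])
  then show p: "pure K V W = pure K V' W'" by (simp add: pure_def fun_eq_iff)
  show "tensor K V W = tensor K V' W'"
    using assms by (simp add: tensor_def t p same_space_def)
qed

lemma tensor_sum_space_cong:
  assumes "same_space M M'"
  shows "tensor_sum M \<beta> x = tensor_sum M' \<beta> x"
  using assms by (simp add: tensor_sum_def same_space_def)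

lemma tensor_lift_space_cong:
  assumes "same_space V V'" "same_space W W'" "same_space M M'"
  shows "tensor_lift K V W M \<beta> = tensor_lift K V' W' M' \<beta>"
  using assms by (simp add: tensor_lift_def tensor_cong tensor_sum_space_cong cong: tensor_cong)

lemma tensor_map_space_cong:
  assumes "same_space V V'" "same_space W W'" "same_space X X'" "same_space Y Y'"
  shows "tensor_map K V W X Y f g = tensor_map K V' W' X' Y' f g"
  unfolding tensor_map_def tensor_cong[OF assms(3,4)]
  by (rule tensor_lift_space_cong) (use assms in simp_all)

lemma tensor_assoc_space_cong:
  assumes "same_space U U'" "same_space V V'" "same_space W W'"
  shows "tensor_assoc K U V W = tensor_assoc K U' V' W'"
    and "tensor_assoc_inv K U V W = tensor_assoc_inv K U' V' W'"
proof -
  note eqs = assms[THEN tensor_cong(1)[OF _ same_space_refl]] assms[THEN tensor_cong(1)[OF same_space_refl]]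
    assms[THEN tensor_cong(2)[OF _ same_space_refl]] assms[THEN tensor_cong(2)[OF same_space_refl]]
    assms[THEN tensor_lift_space_cong[OF _ same_space_refl same_space_refl]]
    assms[THEN tensor_lift_space_cong[OF same_space_refl _ same_space_refl]]
  show "tensor_assoc K U V W = tensor_assoc K U' V' W'"
    unfolding tensor_assoc_def eqs ..
  show "tensor_assoc_inv K U V W = tensor_assoc_inv K U' V' W'"
    unfolding tensor_assoc_inv_def eqs ..
qed

lemma linear_space_cong:
  assumes "same_space V V'" "same_space W W'"
  shows "linear_map K V W f = linear_map K V' W' f" and "lin_maps K V W = lin_maps K V' W'"
  using assms by (simp_all add: linear_map_def lin_maps_def same_space_def)

lemma module_space_mono:
  assumes "same_space V V'" "module K V"
  shows "module K V'"
proof -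
  interpret V: module K V by fact
  note eqs = assms(1)[unfolded same_space_def, THEN conjunct1, symmetric]
    assms(1)[unfolded same_space_def, THEN conjunct2, THEN conjunct2, THEN conjunct2, THEN conjunct1, symmetric]
    assms(1)[unfolded same_space_def, THEN conjunct2, THEN conjunct2, THEN conjunct2, THEN conjunct2, THEN conjunct1, symmetric]
    assms(1)[unfolded same_space_def, THEN conjunct2, THEN conjunct2, THEN conjunct2, THEN conjunct2, THEN conjunct2, symmetric]
  show ?thesis
    by (intro moduleI abelian_groupI)
      (simp_all add: eqs abelian_groupE(1,2,5,6)[OF V.M.abelian_group_axioms] V.M.a_ac V.smult_l_distr V.smult_r_distr
        V.smult_assoc1 V.R.is_cring)
qed

lemma module_space_cong: "same_space V V' \<Longrightarrow> module K V = module K V'"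
  using module_space_mono[of V V' K] module_space_mono[OF same_space_sym, of V V' K] by auto

lemma same_space_coalg:
  "same_space (coalg_tensor K C D) (tensor K C D)" "same_space (unit_coalgebra K) (unit_algebra K)"
  by (simp_all add: same_space_def coalg_tensor_def unit_coalgebra_def tensor_def unit_algebra_def Let_def module.defs)

text \<open>The premise \<open>same_space\<close> leaves the replacing record undetermined for the
  simplifier; one instance per argument position, for each of the two coalgebra constructions, fixes
  it.\<close>

lemmas coalg_space [simp] =
  same_space_coalg[unfolded same_space_def, THEN conjunct1]
  same_space_coalg[unfolded same_space_def, THEN conjunct2, THEN conjunct2, THEN conjunct2, THEN conjunct1]
  same_space_coalg[unfolded same_space_def, THEN conjunct2, THEN conjunct2, THEN conjunct2, THEN conjunct2, THEN conjunct1]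
  same_space_coalg[unfolded same_space_def, THEN conjunct2, THEN conjunct2, THEN conjunct2, THEN conjunct2, THEN conjunct2]
  tensor_cong[OF same_space_coalg(1) same_space_refl] tensor_cong[OF same_space_refl same_space_coalg(1)]
  tensor_cong[OF same_space_coalg(2) same_space_refl] tensor_cong[OF same_space_refl same_space_coalg(2)]
  tensor_sum_space_cong[OF same_space_coalg(1)] tensor_sum_space_cong[OF same_space_coalg(2)]
  tensor_lift_space_cong[OF same_space_coalg(1) same_space_refl same_space_refl]
  tensor_lift_space_cong[OF same_space_refl same_space_coalg(1) same_space_refl]
  tensor_lift_space_cong[OF same_space_refl same_space_refl same_space_coalg(1)]
  tensor_lift_space_cong[OF same_space_coalg(2) same_space_refl same_space_refl]
  tensor_lift_space_cong[OF same_space_refl same_space_coalg(2) same_space_refl]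
  tensor_lift_space_cong[OF same_space_refl same_space_refl same_space_coalg(2)]
  tensor_map_space_cong[OF same_space_coalg(1) same_space_refl same_space_refl same_space_refl]
  tensor_map_space_cong[OF same_space_refl same_space_coalg(1) same_space_refl same_space_refl]
  tensor_map_space_cong[OF same_space_refl same_space_refl same_space_coalg(1) same_space_refl]
  tensor_map_space_cong[OF same_space_refl same_space_refl same_space_refl same_space_coalg(1)]
  tensor_map_space_cong[OF same_space_coalg(2) same_space_refl same_space_refl same_space_refl]
  tensor_map_space_cong[OF same_space_refl same_space_coalg(2) same_space_refl same_space_refl]
  tensor_map_space_cong[OF same_space_refl same_space_refl same_space_coalg(2) same_space_refl]
  tensor_map_space_cong[OF same_space_refl same_space_refl same_space_refl same_space_coalg(2)]
  tensor_assoc_space_cong[OF same_space_coalg(1) same_space_refl same_space_refl]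
  tensor_assoc_space_cong[OF same_space_refl same_space_coalg(1) same_space_refl]
  tensor_assoc_space_cong[OF same_space_refl same_space_refl same_space_coalg(1)]
  tensor_assoc_space_cong[OF same_space_coalg(2) same_space_refl same_space_refl]
  tensor_assoc_space_cong[OF same_space_refl same_space_coalg(2) same_space_refl]
  tensor_assoc_space_cong[OF same_space_refl same_space_refl same_space_coalg(2)]
  linear_space_cong[OF same_space_coalg(1) same_space_refl] linear_space_cong[OF same_space_refl same_space_coalg(1)]
  linear_space_cong[OF same_space_coalg(2) same_space_refl] linear_space_cong[OF same_space_refl same_space_coalg(2)]
  module_space_cong[OF same_space_coalg(1)] module_space_cong[OF same_space_coalg(2)]

context linear_calculus
begin

section \<open>Coassociativity and counit in Sweedler form\<close>

lemma tensor_map_eq_sum: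
  assumes "x \<in> carrier (tensor K V W)"
  shows "tensor_map K V W V' W' f g x = tensor_sum (tensor K V' W') (\<lambda>v w. pure K V' W' (f v) (g w)) x"
  using assms by (simp add: tensor_map_def tensor_lift_eq)

lemma tensor_assoc_pure_left:
  assumes "module K U" "module K V" "module K W" "p \<in> carrier (tensor K U V)" "w \<in> carrier W"
  shows "tensor_assoc K U V W (pure K (tensor K U V) W p w) =
    tensor_sum (tensor K U (tensor K V W)) (\<lambda>u v. pure K U (tensor K V W) u (pure K V W v w)) p"
  unfolding tensor_assoc_def tensor_lift_eq[OF assms(4), symmetric] using assms
  by (intro tensor_lift_pure bilinear_tensor_assoc module_tensor)

lemma pure_sum_right:
  assumes "module K U" "module K V" "module K W" "u \<in> carrier U" "p \<in> carrier (tensor K V W)"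
  shows "pure K U (tensor K V W) u p =
    tensor_sum (tensor K U (tensor K V W)) (\<lambda>v w. pure K U (tensor K V W) u (pure K V W v w)) p"
  using linear_map_tensor_sum[OF assms(2,3,5) module_tensor[OF assms(2,3)]
      module_tensor[OF assms(1) module_tensor[OF assms(2,3)]] pure_linear_right[OF assms(1) module_tensor[OF assms(2,3)] assms(4)],
      of "pure K V W"] tensor_sum_pure_id[OF assms(2,3,5)] by simp

text \<open>Turns (\<Delta> \<otimes> id)\<Delta>, followed by rebracketing, into a nested sum in
  which the left factor y is split again and c is kept. Together with its right-hand companion it
  removes \<open>tensor_map\<close> and \<open>tensor_assoc\<close> from the coassociativity
  axiom.\<close>

lemma coassoc_left_sum:
  assumes "module K H" "linear_map K H (tensor K H H) \<Delta>" "x \<in> carrier (tensor K H H)"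
  shows "tensor_assoc K H H H (tensor_map K H H (tensor K H H) H \<Delta> id x) =
    tensor_sum (tensor K H (tensor K H H)) (\<lambda>y c.
      tensor_sum (tensor K H (tensor K H H)) (\<lambda>a b. pure K H (tensor K H H) a (pure K H H b c)) (\<Delta> y)) x"
    (is "?l = ?r")
proof -
  have "?l = tensor_sum (tensor K H (tensor K H H)) (\<lambda>y c. tensor_assoc K H H H (pure K (tensor K H H) H (\<Delta> y) c)) x"
    unfolding tensor_map_eq_sum[OF assms(3)] id_apply using assms
    by (intro linear_map_tensor_sum[where V = H and W = H and M = "tensor K (tensor K H H) H"])
      (auto simp: linear_map_closed[OF assms(2)])
  also have "\<dots> = ?r"
    using assms by (intro tensor_sum_cong[of H H]) (auto simp: tensor_assoc_pure_left linear_map_closed[OF assms(2)])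
  finally show ?thesis .
qed

lemma coassoc_right_sum:
  assumes "module K H" "linear_map K H (tensor K H H) \<Delta>" "x \<in> carrier (tensor K H H)"
  shows "tensor_map K H H H (tensor K H H) id \<Delta> x =
    tensor_sum (tensor K H (tensor K H H)) (\<lambda>a y.
      tensor_sum (tensor K H (tensor K H H)) (\<lambda>b c. pure K H (tensor K H H) a (pure K H H b c)) (\<Delta> y)) x"
  unfolding tensor_map_eq_sum[OF assms(3)] id_apply
  using assms by (intro tensor_sum_cong[of H H]) (auto intro!: pure_sum_right intro: linear_map_closed)

lemma coalgebra_linear [simp]:
  assumes "coalgebra K H"
  shows "module K H" "linear_map K H (tensor K H H) (comul H)" "linear_map K H (base_module K) (counit H)"
proof -
  interpret coalgebra K H by fact
  show m: "module K H" by unfold_locales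
  show "linear_map K H (tensor K H H) (comul H)" "linear_map K H (base_module K) (counit H)"
    using comul_linear counit_linear by (auto simp: lin_maps_iff m)
qed

lemma coalgebraI:
  assumes "module K H" "linear_map K H (tensor K H H) (comul H)" "linear_map K H (base_module K) (counit H)"
    and "\<And>h. h \<in> carrier H \<Longrightarrow>
     tensor_sum (tensor K H (tensor K H H)) (\<lambda>y c.
      tensor_sum (tensor K H (tensor K H H)) (\<lambda>a b. pure K H (tensor K H H) a (pure K H H b c)) (comul H y)) (comul H h) =
    tensor_sum (tensor K H (tensor K H H)) (\<lambda>a y.
      tensor_sum (tensor K H (tensor K H H)) (\<lambda>b c. pure K H (tensor K H H) a (pure K H H b c)) (comul H y)) (comul H h)"
    and "\<And>h. h \<in> carrier H \<Longrightarrow> tensor_sum H (\<lambda>x y. counit H x \<odot>\<^bsub>H\<^esub> y) (comul H h) = h"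
    and "\<And>h. h \<in> carrier H \<Longrightarrow> tensor_sum H (\<lambda>x y. counit H y \<odot>\<^bsub>H\<^esub> x) (comul H h) = h"
  shows "coalgebra K H"
  using assms
  by (intro coalgebra.intro coalgebra_axioms.intro)
    (auto simp: lin_maps_iff coassoc_left_sum coassoc_right_sum linear_map_closed)

text \<open>Coassociativity in the form in which Sweedler notation uses it: for an arbitrary
  trilinear \<gamma> instead of the universal one. Such a \<gamma> factors through a linear map G on
  H \<otimes> (H \<otimes> H), and the claim is the image of the axiom under G.\<close>

lemma coalgebra_coassoc:
  assumes H: "coalgebra K H" and N: "module K N" and h: "h \<in> carrier H"
    and "\<And>b c. \<lbrakk>b \<in> carrier H; c \<in> carrier H\<rbrakk> \<Longrightarrow> linear_map K H N (\<lambda>a. \<gamma> a b c)"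
    and "\<And>a c. \<lbrakk>a \<in> carrier H; c \<in> carrier H\<rbrakk> \<Longrightarrow> linear_map K H N (\<lambda>b. \<gamma> a b c)"
    and "\<And>a b. \<lbrakk>a \<in> carrier H; b \<in> carrier H\<rbrakk> \<Longrightarrow> linear_map K H N (\<lambda>c. \<gamma> a b c)"
  shows "tensor_sum N (\<lambda>y c. tensor_sum N (\<lambda>a b. \<gamma> a b c) (comul H y)) (comul H h) =
    tensor_sum N (\<lambda>a y. tensor_sum N (\<lambda>b c. \<gamma> a b c) (comul H y)) (comul H h)"
proof -
  interpret coalgebra K H by fact
  let ?HHH = "tensor K H (tensor K H H)"
  define G where "G z = tensor_sum N (\<lambda>a p. tensor_sum N (\<gamma> a) p) z" for z
  note mH = coalgebra_linear[OF H]
  have bil: "bilinear_map K H H N (\<gamma> a)" if "a \<in> carrier H" for a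
    using assms that by (intro bilinear_mapI) auto
  have bil': "bilinear_map K H (tensor K H H) N (\<lambda>a p. tensor_sum N (\<gamma> a) p)"
    using bil mH N assms(4) by (intro bilinear_mapI) (auto intro: linear_tensor_sum intro!: linear_tensor_sum_param[of H H])
  have G: "linear_map K ?HHH N G"
    unfolding G_def[abs_def] using mH N bil' by (intro linear_tensor_sum) auto
  have Gp: "G (pure K H (tensor K H H) a (pure K H H b c)) = \<gamma> a b c"
    if "a \<in> carrier H" "b \<in> carrier H" "c \<in> carrier H" for a b c
    unfolding G_def using that mH N by (simp add: tensor_sum_pure[OF _ _ _ bil'] tensor_sum_pure[OF _ _ _ bil])
  have \<Delta>: "comul H y \<in> carrier (tensor K H H)" if "y \<in> carrier H" for y
    using mH that by (auto intro: linear_map_closed)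
  \<comment> \<open>G moves inside both sums. The summand F and the element S that supplies the
    inner sum stay abstract, so that the same statement covers splitting the left and splitting the
    right factor.\<close>
  have *: "G (tensor_sum ?HHH (\<lambda>x y. tensor_sum ?HHH (F x y) (S x y)) (comul H h)) =
    tensor_sum N (\<lambda>x y. tensor_sum N (\<lambda>u v. G (F x y u v)) (S x y)) (comul H h)"
    if "\<And>x y. \<lbrakk>x \<in> carrier H; y \<in> carrier H\<rbrakk> \<Longrightarrow> S x y \<in> carrier (tensor K H H)"
      "\<And>x y u v. \<lbrakk>x \<in> carrier H; y \<in> carrier H; u \<in> carrier H; v \<in> carrier H\<rbrakk> \<Longrightarrow> F x y u v \<in> carrier ?HHH" for F S
  proof -
    have "G (tensor_sum ?HHH (\<lambda>x y. tensor_sum ?HHH (F x y) (S x y)) (comul H h)) =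
      tensor_sum N (\<lambda>x y. G (tensor_sum ?HHH (F x y) (S x y))) (comul H h)"
      using mH N G that h by (intro linear_map_tensor_sum[of H H]) (auto intro!: tensor_sum_closed[of H H] \<Delta>)
    also have "\<dots> = tensor_sum N (\<lambda>x y. tensor_sum N (\<lambda>u v. G (F x y u v)) (S x y)) (comul H h)"
      using mH N G that h by (intro tensor_sum_cong[of H H] linear_map_tensor_sum[of H H _ ?HHH]) (auto intro!: \<Delta>)
    finally show ?thesis .
  qed
  have "tensor_sum N (\<lambda>y c. tensor_sum N (\<lambda>a b. \<gamma> a b c) (comul H y)) (comul H h) =
    tensor_sum N (\<lambda>y c. tensor_sum N (\<lambda>a b. G (pure K H (tensor K H H) a (pure K H H b c))) (comul H y)) (comul H h)"
    using mH h \<Delta> by (intro tensor_sum_cong[of H H]) (auto simp: Gp)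
  also have "\<dots> = G (tensor_sum ?HHH (\<lambda>y c.
      tensor_sum ?HHH (\<lambda>a b. pure K H (tensor K H H) a (pure K H H b c)) (comul H y)) (comul H h))"
    using \<Delta> by (intro *[symmetric]) auto
  also have "\<dots> = G (tensor_sum ?HHH (\<lambda>a y.
      tensor_sum ?HHH (\<lambda>b c. pure K H (tensor K H H) a (pure K H H b c)) (comul H y)) (comul H h))"
    using coassoc[OF h] mH \<Delta>[OF h] by (simp add: coassoc_left_sum coassoc_right_sum)
  also have "\<dots> = tensor_sum N (\<lambda>a y. tensor_sum N (\<lambda>b c. G (pure K H (tensor K H H) a (pure K H H b c))) (comul H y)) (comul H h)"
    using \<Delta> by (intro *) auto
  also have "\<dots> = tensor_sum N (\<lambda>a y. tensor_sum N (\<lambda>b c. \<gamma> a b c) (comul H y)) (comul H h)"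
    using mH h \<Delta> by (intro tensor_sum_cong[of H H]) (auto simp: Gp)
  finally show ?thesis .
qed

text \<open>The counit axioms are the case where f is the identity; the general form is their image
  under f, which passes through the sum and the scalars.\<close>

lemma coalgebra_counit:
  assumes H: "coalgebra K H" and N: "module K N" and h: "h \<in> carrier H" and f: "linear_map K H N f"
  shows "tensor_sum N (\<lambda>x y. counit H x \<odot>\<^bsub>N\<^esub> f y) (comul H h) = f h"
    and "tensor_sum N (\<lambda>x y. counit H y \<odot>\<^bsub>N\<^esub> f x) (comul H h) = f h"
proof -
  interpret coalgebra K H by fact
  note mH = coalgebra_linear[OF H]
  have \<Delta>: "comul H h \<in> carrier (tensor K H H)" using mH h by (auto intro: linear_map_closed)
  have \<epsilon>: "counit H x \<in> carrier K" if "x \<in> carrier H" for x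
    using linear_map_closed[OF mH(3) that] by simp
  have "f (tensor_sum H (\<lambda>x y. counit H x \<odot>\<^bsub>H\<^esub> y) (comul H h)) = tensor_sum N (\<lambda>x y. f (counit H x \<odot>\<^bsub>H\<^esub> y)) (comul H h)"
    using mH N f \<epsilon> by (intro linear_map_tensor_sum[OF _ _ \<Delta>]) auto
  also have "\<dots> = tensor_sum N (\<lambda>x y. counit H x \<odot>\<^bsub>N\<^esub> f y) (comul H h)"
    using mH \<epsilon> by (intro tensor_sum_cong[OF _ _ \<Delta>]) (auto simp: linear_map_smult[OF f])
  finally show "tensor_sum N (\<lambda>x y. counit H x \<odot>\<^bsub>N\<^esub> f y) (comul H h) = f h"
    by (simp add: counit_left h)
  have "f (tensor_sum H (\<lambda>x y. counit H y \<odot>\<^bsub>H\<^esub> x) (comul H h)) = tensor_sum N (\<lambda>x y. f (counit H y \<odot>\<^bsub>H\<^esub> x)) (comul H h)"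
    using mH N f \<epsilon> by (intro linear_map_tensor_sum[OF _ _ \<Delta>]) auto
  also have "\<dots> = tensor_sum N (\<lambda>x y. counit H y \<odot>\<^bsub>N\<^esub> f x) (comul H h)"
    using mH \<epsilon> by (intro tensor_sum_cong[OF _ _ \<Delta>]) (auto simp: linear_map_smult[OF f])
  finally show "tensor_sum N (\<lambda>x y. counit H y \<odot>\<^bsub>N\<^esub> f x) (comul H h) = f h"
    by (simp add: counit_right h)
qed

lemma comul_closed [simp]:
  "\<lbrakk>coalgebra K H; h \<in> carrier H\<rbrakk> \<Longrightarrow> comul H h \<in> carrier (tensor K H H)"
  by (rule linear_map_closed[OF coalgebra_linear(2)])

lemma counit_closed [simp]: "\<lbrakk>coalgebra K H; h \<in> carrier H\<rbrakk> \<Longrightarrow> counit H h \<in> carrier K"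
  using linear_map_closed[OF coalgebra_linear(3)] by simp

lemma comul_sum_cong:
  assumes "coalgebra K H" "h \<in> carrier H"
    and "\<And>x y. \<lbrakk>x \<in> carrier H; y \<in> carrier H\<rbrakk> \<Longrightarrow> \<beta> x y = \<beta>' x y"
  shows "tensor_sum M \<beta> (comul H h) = tensor_sum M \<beta>' (comul H h)"
  using assms by (intro tensor_sum_cong[of H H]) auto

lemma comul_sum_closed:
  assumes "coalgebra K H" "h \<in> carrier H" "module K M"
    and "\<And>x y. \<lbrakk>x \<in> carrier H; y \<in> carrier H\<rbrakk> \<Longrightarrow> \<beta> x y \<in> carrier M"
  shows "tensor_sum M \<beta> (comul H h) \<in> carrier M"
  using assms by (intro tensor_sum_closed[of H H]) auto

lemma comul_sum_linear_map:
  assumes "linear_map K M N f" "coalgebra K H" "h \<in> carrier H" "module K M" "module K N"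
    and "\<And>x y. \<lbrakk>x \<in> carrier H; y \<in> carrier H\<rbrakk> \<Longrightarrow> \<beta> x y \<in> carrier M"
  shows "f (tensor_sum M \<beta> (comul H h)) = tensor_sum N (\<lambda>x y. f (\<beta> x y)) (comul H h)"
  using assms by (intro linear_map_tensor_sum[of H H _ M]) auto

lemma comul_sum_swap:
  assumes "coalgebra K H" "h \<in> carrier H" "coalgebra K H'" "h' \<in> carrier H'" "module K M"
    and "\<And>x y x' y'. \<lbrakk>x \<in> carrier H; y \<in> carrier H; x' \<in> carrier H'; y' \<in> carrier H'\<rbrakk>
      \<Longrightarrow> \<beta> x y x' y' \<in> carrier M"
  shows "tensor_sum M (\<lambda>x y. tensor_sum M (\<lambda>x' y'. \<beta> x y x' y') (comul H' h')) (comul H h) =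
    tensor_sum M (\<lambda>x' y'. tensor_sum M (\<lambda>x y. \<beta> x y x' y') (comul H h)) (comul H' h')"
  using assms by (intro tensor_sum_swap[of H H _ H' H']) auto

text \<open>Here the variable occurs in the element that is comultiplied; in the next lemma it
  occurs in the summand. In nested sums the two alternate.\<close>

lemma linear_comul_sum1:
  assumes "linear_map K U H f" "coalgebra K H" "module K M"
    and "\<And>x. x \<in> carrier H \<Longrightarrow> linear_map K H M (\<lambda>y. \<beta> x y)"
    and "\<And>y. y \<in> carrier H \<Longrightarrow> linear_map K H M (\<lambda>x. \<beta> x y)"
  shows "linear_map K U M (\<lambda>u. tensor_sum M \<beta> (comul H (f u)))"
  using assms by (intro linear_tensor_sum1[of U H H] linear_compose[of U H f "tensor K H H"]) auto

lemma linear_comul_sum2: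
  assumes "coalgebra K H" "h \<in> carrier H" "module K M"
    and "\<And>x y. \<lbrakk>x \<in> carrier H; y \<in> carrier H\<rbrakk> \<Longrightarrow> linear_map K U M (\<lambda>u. \<beta> u x y)"
  shows "linear_map K U M (\<lambda>u. tensor_sum M (\<lambda>x y. \<beta> u x y) (comul H h))"
  using assms by (intro linear_tensor_sum_param[of H H]) auto

lemma linear_base_mult1:
  assumes "linear_map K U (base_module K) f" "c \<in> carrier K"
  shows "linear_map K U (base_module K) (\<lambda>u. f u \<otimes>\<^bsub>K\<^esub> c)"
  using linear_smult1[OF assms(1) module_base, of c] assms(2) by simp

lemma linear_base_mult2:
  assumes "linear_map K U (base_module K) f" "c \<in> carrier K"
  shows "linear_map K U (base_module K) (\<lambda>u. c \<otimes>\<^bsub>K\<^esub> f u)"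
  using linear_smult2[OF assms(1) module_base, of c] assms(2) by simp

lemmas sweedler_intros = linear_comul_sum1 linear_comul_sum2 linear_pure1 linear_pure2
  linear_smult1 linear_smult2 linear_base_mult1 linear_base_mult2

lemma comul_eq_sum:
  "\<lbrakk>coalgebra K H; h \<in> carrier H\<rbrakk> \<Longrightarrow> tensor_sum (tensor K H H) (pure K H H) (comul H h) = comul H h"
  by (intro tensor_sum_pure_id) auto

section \<open>Tensor products of coalgebras\<close>

lemma comul_coalg_tensor:
  "comul (coalg_tensor K C D) =
    tensor_lift K C D (tensor K (tensor K C D) (tensor K C D)) (\<lambda>x y.
      tensor_sum (tensor K (tensor K C D) (tensor K C D)) (\<lambda>x1 x2.
        tensor_sum (tensor K (tensor K C D) (tensor K C D)) (\<lambda>y1 y2.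
          pure K (tensor K C D) (tensor K C D) (pure K C D x1 y1) (pure K C D x2 y2)) (comul D y)) (comul C x))"
  and counit_coalg_tensor:
  "counit (coalg_tensor K C D) = tensor_lift K C D (base_module K) (\<lambda>x y. counit C x \<otimes>\<^bsub>K\<^esub> counit D y)"
  by (simp_all add: coalg_tensor_def Let_def module.defs coalgebra.defs)

context
  fixes C D :: "('k, ('k, 'a) univ) coalgebra"
  assumes C: "coalgebra K C" and D: "coalgebra K D"
begin

lemma bilinear_comul_tensor:
  "bilinear_map K C D (tensor K (tensor K C D) (tensor K C D)) (\<lambda>x y.
      tensor_sum (tensor K (tensor K C D) (tensor K C D)) (\<lambda>x1 x2.
        tensor_sum (tensor K (tensor K C D) (tensor K C D)) (\<lambda>y1 y2.
          pure K (tensor K C D) (tensor K C D) (pure K C D x1 y1) (pure K C D x2 y2)) (comul D y)) (comul C x))"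
  using C D by (auto intro!: bilinear_mapI sweedler_intros)

lemma linear_comul_tensor:
  "linear_map K (tensor K C D) (tensor K (tensor K C D) (tensor K C D)) (comul (coalg_tensor K C D))"
  unfolding comul_coalg_tensor using bilinear_comul_tensor C D by (intro linear_tensor_lift) auto

lemma comul_tensor_pure:
  "\<lbrakk>x \<in> carrier C; y \<in> carrier D\<rbrakk> \<Longrightarrow> comul (coalg_tensor K C D) (pure K C D x y) =
      tensor_sum (tensor K (tensor K C D) (tensor K C D)) (\<lambda>x1 x2.
        tensor_sum (tensor K (tensor K C D) (tensor K C D)) (\<lambda>y1 y2.
          pure K (tensor K C D) (tensor K C D) (pure K C D x1 y1) (pure K C D x2 y2)) (comul D y)) (comul C x)"
  unfolding comul_coalg_tensor using C D by (subst tensor_lift_pure[OF bilinear_comul_tensor]) auto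

text \<open>A Sweedler sum over \<Delta>(x \<otimes> y) is an iterated sum over \<Delta>x and
  \<Delta>y. Proved by pushing the linear map \<open>tensor_sum N \<beta>\<close> through the
  definition, it stands in for that definition in the later computations.\<close>

lemma comul_tensor_sum:
  assumes "module K N" and x: "x \<in> carrier C" and y: "y \<in> carrier D"
    and "\<And>p. p \<in> carrier (tensor K C D) \<Longrightarrow> linear_map K (tensor K C D) N (\<lambda>q. \<beta> p q)"
    and "\<And>q. q \<in> carrier (tensor K C D) \<Longrightarrow> linear_map K (tensor K C D) N (\<lambda>p. \<beta> p q)"
  shows "tensor_sum N \<beta> (comul (coalg_tensor K C D) (pure K C D x y)) =
    tensor_sum N (\<lambda>x1 x2. tensor_sum N (\<lambda>y1 y2. \<beta> (pure K C D x1 y1) (pure K C D x2 y2)) (comul D y)) (comul C x)"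
proof -
  let ?T = "tensor K C D"
  let ?TT = "tensor K ?T ?T"
  have b: "bilinear_map K ?T ?T N \<beta>" using assms by (intro bilinear_mapI)
  have l: "linear_map K ?TT N (tensor_sum N \<beta>)"
    using b assms(1) C D by (intro linear_tensor_sum) auto
  have "tensor_sum N \<beta> (comul (coalg_tensor K C D) (pure K C D x y)) =
    tensor_sum N (\<lambda>x1 x2. tensor_sum N \<beta> (tensor_sum ?TT (\<lambda>y1 y2.
          pure K ?T ?T (pure K C D x1 y1) (pure K C D x2 y2)) (comul D y))) (comul C x)"
    unfolding comul_tensor_pure[OF x y] using C D x y assms(1)
    by (intro comul_sum_linear_map[OF l]) (auto intro!: comul_sum_closed)
  also have "\<dots> = tensor_sum N (\<lambda>x1 x2. tensor_sum N (\<lambda>y1 y2. tensor_sum N \<beta>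
          (pure K ?T ?T (pure K C D x1 y1) (pure K C D x2 y2))) (comul D y)) (comul C x)"
    using C D x y assms(1) by (intro comul_sum_cong comul_sum_linear_map[OF l]) auto
  also have "\<dots> = tensor_sum N (\<lambda>x1 x2. tensor_sum N (\<lambda>y1 y2. \<beta> (pure K C D x1 y1) (pure K C D x2 y2)) (comul D y)) (comul C x)"
    using C D x y assms(1) by (intro comul_sum_cong) (auto simp: tensor_sum_pure[OF _ _ _ b])
  finally show ?thesis .
qed

lemma bilinear_counit_tensor:
  "bilinear_map K C D (base_module K) (\<lambda>x y. counit C x \<otimes>\<^bsub>K\<^esub> counit D y)"
  using C D by (auto intro!: bilinear_mapI sweedler_intros)

lemma linear_counit_tensor:
  "linear_map K (tensor K C D) (base_module K) (counit (coalg_tensor K C D))"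
  unfolding counit_coalg_tensor using bilinear_counit_tensor C D by (intro linear_tensor_lift) auto

lemma counit_tensor_pure:
  "\<lbrakk>x \<in> carrier C; y \<in> carrier D\<rbrakk> \<Longrightarrow>
    counit (coalg_tensor K C D) (pure K C D x y) = counit C x \<otimes>\<^bsub>K\<^esub> counit D y"
  unfolding counit_coalg_tensor using C D by (subst tensor_lift_pure[OF bilinear_counit_tensor]) auto

text \<open>
  After expanding in Sweedler notation and exchanging the inner sums, this is coassociativity of \<open>D\<close> in the
  inner double sum followed by coassociativity of \<open>C\<close> in the outer one.
\<close>

lemma coassoc_coalg_tensor:
  assumes N: "module K N" and x: "x \<in> carrier C" and y: "y \<in> carrier D"
    and g1: "\<And>b c. \<lbrakk>b \<in> carrier (tensor K C D); c \<in> carrier (tensor K C D)\<rbrakk> \<Longrightarrow> linear_map K (tensor K C D) N (\<lambda>a. \<gamma> a b c)"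
    and g2: "\<And>a c. \<lbrakk>a \<in> carrier (tensor K C D); c \<in> carrier (tensor K C D)\<rbrakk> \<Longrightarrow> linear_map K (tensor K C D) N (\<lambda>b. \<gamma> a b c)"
    and g3: "\<And>a b. \<lbrakk>a \<in> carrier (tensor K C D); b \<in> carrier (tensor K C D)\<rbrakk> \<Longrightarrow> linear_map K (tensor K C D) N (\<lambda>c. \<gamma> a b c)"
  shows "tensor_sum N (\<lambda>p c. tensor_sum N (\<lambda>a b. \<gamma> a b c) (comul (coalg_tensor K C D) p))
      (comul (coalg_tensor K C D) (pure K C D x y)) =
    tensor_sum N (\<lambda>a p. tensor_sum N (\<lambda>b c. \<gamma> a b c) (comul (coalg_tensor K C D) p))
      (comul (coalg_tensor K C D) (pure K C D x y))" (is "?l = ?r")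
proof -
  let ?T = "tensor K C D" and ?p = "pure K C D"
  note mT = coalgebra_linear(1)[OF C] coalgebra_linear(1)[OF D]
  note closed = linear_map_closed[OF g1]
  have bil: "bilinear_map K ?T ?T N (\<lambda>a b. \<gamma> a b c)" if "c \<in> carrier ?T" for c
    using that g1 g2 by (intro bilinear_mapI)
  have bil': "bilinear_map K ?T ?T N (\<lambda>b c. \<gamma> a b c)" if "a \<in> carrier ?T" for a
    using that g2 g3 by (intro bilinear_mapI)
  have lin: "linear_map K ?T N (\<lambda>p. tensor_sum N (\<lambda>a b. \<gamma> a b c) (comul (coalg_tensor K C D) p))"
    if "c \<in> carrier ?T" for c
    using linear_compose[OF linear_comul_tensor linear_tensor_sum[OF _ _ N bil[OF that]]] mT by simp
  have lin': "linear_map K ?T N (\<lambda>p. tensor_sum N (\<lambda>b c. \<gamma> a b c) (comul (coalg_tensor K C D) p))"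
    if "a \<in> carrier ?T" for a
    using linear_compose[OF linear_comul_tensor linear_tensor_sum[OF _ _ N bil'[OF that]]] mT by simp
  have par: "linear_map K ?T N (\<lambda>c. tensor_sum N (\<lambda>a b. \<gamma> a b c) (comul (coalg_tensor K C D) p))"
    if "p \<in> carrier ?T" for p
    using linear_map_closed[OF linear_comul_tensor that] mT N g3 by (intro linear_tensor_sum_param[of ?T ?T]) auto
  have par': "linear_map K ?T N (\<lambda>a. tensor_sum N (\<lambda>b c. \<gamma> a b c) (comul (coalg_tensor K C D) p))"
    if "p \<in> carrier ?T" for p
    using linear_map_closed[OF linear_comul_tensor that] mT N g1 by (intro linear_tensor_sum_param[of ?T ?T]) auto
  have expand: "tensor_sum N (\<lambda>p c. tensor_sum N (\<lambda>a b. \<gamma> a b c) (comul (coalg_tensor K C D) p))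
      (comul (coalg_tensor K C D) (?p x y)) =
    tensor_sum N (\<lambda>x1 x2. tensor_sum N (\<lambda>y1 y2. tensor_sum N (\<lambda>u v. tensor_sum N (\<lambda>s t.
      \<gamma> (?p u s) (?p v t) (?p x2 y2)) (comul D y1)) (comul C x1)) (comul D y)) (comul C x)"
    using lin par N x y C D g1 g2 by (subst comul_tensor_sum) (auto intro!: comul_sum_cong comul_tensor_sum)
  have expand': "tensor_sum N (\<lambda>a p. tensor_sum N (\<lambda>b c. \<gamma> a b c) (comul (coalg_tensor K C D) p))
      (comul (coalg_tensor K C D) (?p x y)) =
    tensor_sum N (\<lambda>x1 x2. tensor_sum N (\<lambda>y1 y2. tensor_sum N (\<lambda>u v. tensor_sum N (\<lambda>s t.
      \<gamma> (?p x1 y1) (?p u s) (?p v t)) (comul D y2)) (comul C x2)) (comul D y)) (comul C x)"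
    using lin' par' N x y C D g2 g3 by (subst comul_tensor_sum) (auto intro!: comul_sum_cong comul_tensor_sum)
  \<comment> \<open>These six facts state linearity of \<gamma> in each factor of each of its three
    tensor arguments. They supply the trilinearity conditions when coassociativity of C or of D is
    applied to a summand with the other variables frozen.\<close>
  have lin1a: "linear_map K U N (\<lambda>u. \<gamma> (?p (f u) s) b c)"
    if "linear_map K U C f" "s \<in> carrier D" "b \<in> carrier ?T" "c \<in> carrier ?T" for f s b c and U :: "('k, ('k, 'a) univ) coalgebra"
    using linear_compose[OF linear_pure1[OF that(1) mT that(2)] g1[OF that(3,4)]] .
  have lin1b: "linear_map K U N (\<lambda>s. \<gamma> (?p u (f s)) b c)"
    if "linear_map K U D f" "u \<in> carrier C" "b \<in> carrier ?T" "c \<in> carrier ?T" for f u b c and U :: "('k, ('k, 'a) univ) coalgebra"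
    using linear_compose[OF linear_pure2[OF that(1) mT that(2)] g1[OF that(3,4)]] .
  have lin2a: "linear_map K U N (\<lambda>u. \<gamma> a (?p (f u) s) c)"
    if "linear_map K U C f" "s \<in> carrier D" "a \<in> carrier ?T" "c \<in> carrier ?T" for f s a c and U :: "('k, ('k, 'a) univ) coalgebra"
    using linear_compose[OF linear_pure1[OF that(1) mT that(2)] g2[OF that(3,4)]] .
  have lin2b: "linear_map K U N (\<lambda>s. \<gamma> a (?p u (f s)) c)"
    if "linear_map K U D f" "u \<in> carrier C" "a \<in> carrier ?T" "c \<in> carrier ?T" for f u a c and U :: "('k, ('k, 'a) univ) coalgebra"
    using linear_compose[OF linear_pure2[OF that(1) mT that(2)] g2[OF that(3,4)]] .
  have lin3a: "linear_map K U N (\<lambda>u. \<gamma> a b (?p (f u) s))"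
    if "linear_map K U C f" "s \<in> carrier D" "a \<in> carrier ?T" "b \<in> carrier ?T" for f s a b and U :: "('k, ('k, 'a) univ) coalgebra"
    using linear_compose[OF linear_pure1[OF that(1) mT that(2)] g3[OF that(3,4)]] .
  have lin3b: "linear_map K U N (\<lambda>s. \<gamma> a b (?p u (f s)))"
    if "linear_map K U D f" "u \<in> carrier C" "a \<in> carrier ?T" "b \<in> carrier ?T" for f u a b and U :: "('k, ('k, 'a) univ) coalgebra"
    using linear_compose[OF linear_pure2[OF that(1) mT that(2)] g3[OF that(3,4)]] .
  note lins = lin1a lin1b lin2a lin2b lin3a lin3b
  have "?l = tensor_sum N (\<lambda>x1 x2. tensor_sum N (\<lambda>u v. tensor_sum N (\<lambda>y1 y2. tensor_sum N (\<lambda>s t.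
      \<gamma> (?p u s) (?p v t) (?p x2 y2)) (comul D y1)) (comul D y)) (comul C x1)) (comul C x)"
    unfolding expand using N x y C D closed
    by (intro comul_sum_cong[OF C x] comul_sum_swap) (auto intro!: comul_sum_closed)
  also have "\<dots> = tensor_sum N (\<lambda>x1 x2. tensor_sum N (\<lambda>u v. tensor_sum N (\<lambda>y1 y2. tensor_sum N (\<lambda>s t.
      \<gamma> (?p u y1) (?p v s) (?p x2 t)) (comul D y2)) (comul D y)) (comul C x1)) (comul C x)"
    using N x y C D closed
    by (intro comul_sum_cong[OF C] comul_sum_cong[OF C x] coalgebra_coassoc[OF D N y]) (auto intro!: lins)
  also have "\<dots> = tensor_sum N (\<lambda>x1 x2. tensor_sum N (\<lambda>u v. tensor_sum N (\<lambda>y1 y2. tensor_sum N (\<lambda>s t.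
      \<gamma> (?p x1 y1) (?p u s) (?p v t)) (comul D y2)) (comul D y)) (comul C x2)) (comul C x)"
    using N x y C D closed
    by (intro coalgebra_coassoc[OF C N x]) (auto intro!: lins linear_comul_sum2)
  also have "\<dots> = ?r"
    unfolding expand' using N x y C D closed
    by (intro comul_sum_cong[OF C x] comul_sum_swap) (auto intro!: comul_sum_closed)
  finally show ?thesis .
qed

text \<open>Both sides of each axiom are linear in h, so h may be x \<otimes> y. Coassociativity is
  the preceding lemma with \<gamma> the threefold pure tensor; the counit laws collapse the sum over
  D and then the sum over C.\<close>

lemma coalgebra_tensor: "coalgebra K (coalg_tensor K C D)"
proof (rule coalgebraI)
  let ?T = "tensor K C D" and ?P = "coalg_tensor K C D"
  note mT = coalgebra_linear(1)[OF C] coalgebra_linear(1)[OF D]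
  show "module K ?P" using mT by simp
  show "linear_map K ?P (tensor K ?P ?P) (comul ?P)" using linear_comul_tensor by simp
  show "linear_map K ?P (base_module K) (counit ?P)" using linear_counit_tensor by simp
  have \<epsilon>: "counit ?P p \<in> carrier K" if "p \<in> carrier ?T" for p
    using linear_map_closed[OF linear_counit_tensor that] by simp
  fix h assume "h \<in> carrier ?P"
  then have h: "h \<in> carrier ?T" by simp
  let ?M = "tensor K ?T (tensor K ?T ?T)"
  have p1: "linear_map K ?T ?M (\<lambda>a. pure K ?T (tensor K ?T ?T) a (pure K ?T ?T b c))"
    and p2: "linear_map K ?T ?M (\<lambda>b. pure K ?T (tensor K ?T ?T) a (pure K ?T ?T b c))"
    and p3: "linear_map K ?T ?M (\<lambda>c. pure K ?T (tensor K ?T ?T) a (pure K ?T ?T b c))"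
    if "a \<in> carrier ?T" "b \<in> carrier ?T" "c \<in> carrier ?T" for a b c
    using that mT by (auto intro!: linear_intros)
  have \<Delta>: "comul ?P p \<in> carrier (tensor K ?T ?T)" if "p \<in> carrier ?T" for p
    using linear_map_closed[OF linear_comul_tensor that] .
  have l1: "linear_map K ?T ?M (\<lambda>h. tensor_sum ?M (\<lambda>y c. tensor_sum ?M (\<lambda>a b. pure K ?T (tensor K ?T ?T) a (pure K ?T ?T b c)) (comul ?P y)) (comul ?P h))"
    using mT p1 p2 p3 \<Delta>
    by (intro linear_tensor_sum1[OF linear_comul_tensor] linear_tensor_sum_param[of ?T ?T]) auto
  have l2: "linear_map K ?T ?M (\<lambda>h. tensor_sum ?M (\<lambda>a y. tensor_sum ?M (\<lambda>b c. pure K ?T (tensor K ?T ?T) a (pure K ?T ?T b c)) (comul ?P y)) (comul ?P h))"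
    using mT p1 p2 p3 \<Delta>
    by (intro linear_tensor_sum1[OF linear_comul_tensor] linear_tensor_sum_param[of ?T ?T]) auto
  have "tensor_sum ?M (\<lambda>y c. tensor_sum ?M (\<lambda>a b. pure K ?T (tensor K ?T ?T) a (pure K ?T ?T b c)) (comul ?P y)) (comul ?P h)
    = tensor_sum ?M (\<lambda>a y. tensor_sum ?M (\<lambda>b c. pure K ?T (tensor K ?T ?T) a (pure K ?T ?T b c)) (comul ?P y)) (comul ?P h)"
    using p1 p2 p3 mT
    by (intro tensor_eqI[OF mT _ l1 l2 coassoc_coalg_tensor h]) (auto)
  then show "tensor_sum (tensor K ?P (tensor K ?P ?P)) (\<lambda>y c. tensor_sum (tensor K ?P (tensor K ?P ?P))
      (\<lambda>a b. pure K ?P (tensor K ?P ?P) a (pure K ?P ?P b c)) (comul ?P y)) (comul ?P h)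
    = tensor_sum (tensor K ?P (tensor K ?P ?P)) (\<lambda>a y. tensor_sum (tensor K ?P (tensor K ?P ?P))
      (\<lambda>b c. pure K ?P (tensor K ?P ?P) a (pure K ?P ?P b c)) (comul ?P y)) (comul ?P h)"
    by simp
  have s1: "linear_map K ?T ?T (\<lambda>x. counit ?P x \<odot>\<^bsub>?T\<^esub> y)" if "y \<in> carrier ?T" for y
    using that mT linear_counit_tensor by (intro linear_smult1) auto
  have s2: "linear_map K ?T ?T (\<lambda>y. counit ?P x \<odot>\<^bsub>?T\<^esub> y)" if "x \<in> carrier ?T" for x
    using that mT \<epsilon> by (intro linear_smult2) auto
  \<comment> \<open>The right side is written as the identity map applied to h so that it fits the
    shape of \<open>tensor_eqI\<close>.\<close>
  have "tensor_sum ?T (\<lambda>x y. counit ?P x \<odot>\<^bsub>?T\<^esub> y) (comul ?P h) = (\<lambda>h. h) h"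
  proof (rule tensor_eqI[OF mT _ _ _ _ h, where M = ?T])
    show "linear_map K ?T ?T (\<lambda>h. tensor_sum ?T (\<lambda>x y. counit ?P x \<odot>\<^bsub>?T\<^esub> y) (comul ?P h))"
      using mT s1 s2 by (intro linear_tensor_sum1[OF linear_comul_tensor]) auto
    fix x y assume x: "x \<in> carrier C" and y: "y \<in> carrier D"
    have "tensor_sum ?T (\<lambda>x y. counit ?P x \<odot>\<^bsub>?T\<^esub> y) (comul ?P (pure K C D x y)) =
      tensor_sum ?T (\<lambda>x1 x2. tensor_sum ?T (\<lambda>y1 y2. (counit C x1 \<otimes>\<^bsub>K\<^esub> counit D y1) \<odot>\<^bsub>?T\<^esub> pure K C D x2 y2) (comul D y)) (comul C x)"
      using mT s1 s2 x y C D
      by (subst comul_tensor_sum) (auto intro!: comul_sum_cong simp: counit_tensor_pure)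
    \<comment> \<open>The scalars are regrouped so that \<epsilon>(y1) stands outermost: the inner
      sum then has the form required by the counit law of D, for the linear map y2 \<mapsto>
      \<epsilon>(x1)(x2 \<otimes> y2).\<close>
    also have "\<dots> = tensor_sum ?T (\<lambda>x1 x2. tensor_sum ?T (\<lambda>y1 y2. counit D y1 \<odot>\<^bsub>?T\<^esub> (counit C x1 \<odot>\<^bsub>?T\<^esub> pure K C D x2 y2)) (comul D y)) (comul C x)"
    proof -
      interpret T: module K ?T using mT by simp
      show ?thesis using x y C D by (intro comul_sum_cong) (auto simp: T.smult_assoc1[symmetric] T.R.m_comm)
    qed
    also have "\<dots> = tensor_sum ?T (\<lambda>x1 x2. counit C x1 \<odot>\<^bsub>?T\<^esub> pure K C D x2 y) (comul C x)"
      using x y C D by (intro comul_sum_cong[OF C] coalgebra_counit(1)[OF D]) (auto intro!: sweedler_intros)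
    also have "\<dots> = pure K C D x y"
      using x y C D by (intro coalgebra_counit(1)[OF C]) (auto intro!: sweedler_intros)
    finally show "tensor_sum ?T (\<lambda>x y. counit ?P x \<odot>\<^bsub>?T\<^esub> y) (comul ?P (pure K C D x y)) = pure K C D x y" .
  qed (use mT in auto)
  then show "tensor_sum ?P (\<lambda>x y. counit ?P x \<odot>\<^bsub>?P\<^esub> y) (comul ?P h) = h" by simp
  have "tensor_sum ?T (\<lambda>x y. counit ?P y \<odot>\<^bsub>?T\<^esub> x) (comul ?P h) = (\<lambda>h. h) h"
  proof (rule tensor_eqI[OF mT _ _ _ _ h, where M = ?T])
    show "linear_map K ?T ?T (\<lambda>h. tensor_sum ?T (\<lambda>x y. counit ?P y \<odot>\<^bsub>?T\<^esub> x) (comul ?P h))"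
      using mT s1 s2 by (intro linear_tensor_sum1[OF linear_comul_tensor]) auto
    fix x y assume x: "x \<in> carrier C" and y: "y \<in> carrier D"
    have "tensor_sum ?T (\<lambda>x y. counit ?P y \<odot>\<^bsub>?T\<^esub> x) (comul ?P (pure K C D x y)) =
      tensor_sum ?T (\<lambda>x1 x2. tensor_sum ?T (\<lambda>y1 y2. (counit C x2 \<otimes>\<^bsub>K\<^esub> counit D y2) \<odot>\<^bsub>?T\<^esub> pure K C D x1 y1) (comul D y)) (comul C x)"
      using mT s1 s2 x y C D
      by (subst comul_tensor_sum) (auto intro!: comul_sum_cong simp: counit_tensor_pure)
    also have "\<dots> = tensor_sum ?T (\<lambda>x1 x2. tensor_sum ?T (\<lambda>y1 y2. counit D y2 \<odot>\<^bsub>?T\<^esub> (counit C x2 \<odot>\<^bsub>?T\<^esub> pure K C D x1 y1)) (comul D y)) (comul C x)"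
    proof -
      interpret T: module K ?T using mT by simp
      show ?thesis using x y C D by (intro comul_sum_cong) (auto simp: T.smult_assoc1[symmetric] T.R.m_comm)
    qed
    also have "\<dots> = tensor_sum ?T (\<lambda>x1 x2. counit C x2 \<odot>\<^bsub>?T\<^esub> pure K C D x1 y) (comul C x)"
      using x y C D by (intro comul_sum_cong[OF C] coalgebra_counit(2)[OF D]) (auto intro!: sweedler_intros)
    also have "\<dots> = pure K C D x y"
      using x y C D by (intro coalgebra_counit(2)[OF C]) (auto intro!: sweedler_intros)
    finally show "tensor_sum ?T (\<lambda>x y. counit ?P y \<odot>\<^bsub>?T\<^esub> x) (comul ?P (pure K C D x y)) = pure K C D x y" .
  qed (use mT in auto)
  then show "tensor_sum ?P (\<lambda>x y. counit ?P y \<odot>\<^bsub>?P\<^esub> x) (comul ?P h) = h" by simp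
qed

end

section \<open>The one-dimensional coalgebra\<close>

lemma comul_unit: "comul (unit_coalgebra K) = (\<lambda>x. pure K (unit_algebra K) (unit_algebra K) x (Scal \<one>\<^bsub>K\<^esub>))"
  and counit_unit: "counit (unit_coalgebra K) = scalar"
  by (simp_all add: unit_coalgebra_def Let_def module.defs coalgebra.defs)

text \<open>In \<Delta>x = x \<otimes> 1 the scalar stands in the left factor, so a Sweedler sum
  over it has the single term \<beta> x 1. Both iterated comultiplications of h become h \<otimes>
  (1 \<otimes> 1).\<close>

lemma coalgebra_unit: "coalgebra K (unit_coalgebra K :: ('k, ('k, 'a) univ) coalgebra)"
proof -
  let ?I = "unit_algebra K :: ('k, ('k, 'a) univ) module" and ?J = "unit_coalgebra K :: ('k, ('k, 'a) univ) coalgebra"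
  note [simp] = comul_unit counit_unit
  have one: "Scal \<one>\<^bsub>K\<^esub> \<in> carrier ?I" by simp
  show "coalgebra K ?J"
  proof (rule coalgebraI)
    fix h assume "h \<in> carrier ?J"
    then have h: "h \<in> carrier ?I" by simp
    let ?M = "tensor K ?I (tensor K ?I ?I)"
    have lin: "linear_map K ?I ?M (\<lambda>a. pure K ?I (tensor K ?I ?I) a (pure K ?I ?I b c))"
      "linear_map K ?I ?M (\<lambda>b. pure K ?I (tensor K ?I ?I) a (pure K ?I ?I b c))"
      "linear_map K ?I ?M (\<lambda>c. pure K ?I (tensor K ?I ?I) a (pure K ?I ?I b c))"
      if "a \<in> carrier ?I" "b \<in> carrier ?I" "c \<in> carrier ?I" for a b c
      using that by (auto simp del: carrier_unit intro!: linear_intros)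
    have ev: "tensor_sum M \<beta> (pure K ?I ?I x y) = \<beta> x y"
      if "module K M" "x \<in> carrier ?I" "y \<in> carrier ?I"
        "\<And>x. x \<in> carrier ?I \<Longrightarrow> linear_map K ?I M (\<lambda>y. \<beta> x y)" "\<And>y. y \<in> carrier ?I \<Longrightarrow> linear_map K ?I M (\<lambda>x. \<beta> x y)"
      for M :: "('k, ('k, 'a) univ) module" and \<beta> x y
      using that by (intro tensor_sum_pure[of ?I ?I M] bilinear_mapI) auto
    have in1: "tensor_sum ?M (\<lambda>a b. pure K ?I (tensor K ?I ?I) a (pure K ?I ?I b c)) (pure K ?I ?I y (Scal \<one>\<^bsub>K\<^esub>)) =
        pure K ?I (tensor K ?I ?I) y (pure K ?I ?I (Scal \<one>\<^bsub>K\<^esub>) c)" if "y \<in> carrier ?I" "c \<in> carrier ?I" for y c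
      using that one lin by (intro ev) (auto simp del: carrier_unit)
    have in2: "tensor_sum ?M (\<lambda>b c. pure K ?I (tensor K ?I ?I) a (pure K ?I ?I b c)) (pure K ?I ?I y (Scal \<one>\<^bsub>K\<^esub>)) =
        pure K ?I (tensor K ?I ?I) a (pure K ?I ?I y (Scal \<one>\<^bsub>K\<^esub>))" if "a \<in> carrier ?I" "y \<in> carrier ?I" for a y
      using that one lin by (intro ev) (auto simp del: carrier_unit)
    have \<Delta>h: "pure K ?I ?I h (Scal \<one>\<^bsub>K\<^esub>) \<in> carrier (tensor K ?I ?I)" using h one by simp
    have "tensor_sum ?M (\<lambda>y c. tensor_sum ?M (\<lambda>a b. pure K ?I (tensor K ?I ?I) a (pure K ?I ?I b c)) (pure K ?I ?I y (Scal \<one>\<^bsub>K\<^esub>))) (pure K ?I ?I h (Scal \<one>\<^bsub>K\<^esub>))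
      = tensor_sum ?M (\<lambda>y c. pure K ?I (tensor K ?I ?I) y (pure K ?I ?I (Scal \<one>\<^bsub>K\<^esub>) c)) (pure K ?I ?I h (Scal \<one>\<^bsub>K\<^esub>))"
      by (intro tensor_sum_cong[of ?I ?I] in1 \<Delta>h) auto
    also have "\<dots> = pure K ?I (tensor K ?I ?I) h (pure K ?I ?I (Scal \<one>\<^bsub>K\<^esub>) (Scal \<one>\<^bsub>K\<^esub>))"
      using h one lin by (intro ev) (auto simp del: carrier_unit)
    also have "\<dots> = tensor_sum ?M (\<lambda>a y. pure K ?I (tensor K ?I ?I) a (pure K ?I ?I y (Scal \<one>\<^bsub>K\<^esub>))) (pure K ?I ?I h (Scal \<one>\<^bsub>K\<^esub>))"
      using h one lin by (intro ev[symmetric]) (auto simp del: carrier_unit)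
    also have "\<dots> = tensor_sum ?M (\<lambda>a y. tensor_sum ?M (\<lambda>b c. pure K ?I (tensor K ?I ?I) a (pure K ?I ?I b c)) (pure K ?I ?I y (Scal \<one>\<^bsub>K\<^esub>))) (pure K ?I ?I h (Scal \<one>\<^bsub>K\<^esub>))"
      by (intro tensor_sum_cong[of ?I ?I] in2[symmetric] \<Delta>h) auto
    finally show "tensor_sum (tensor K ?J (tensor K ?J ?J)) (\<lambda>y c. tensor_sum (tensor K ?J (tensor K ?J ?J)) (\<lambda>a b. pure K ?J (tensor K ?J ?J) a (pure K ?J ?J b c)) (comul ?J y)) (comul ?J h)
      = tensor_sum (tensor K ?J (tensor K ?J ?J)) (\<lambda>a y. tensor_sum (tensor K ?J (tensor K ?J ?J)) (\<lambda>b c. pure K ?J (tensor K ?J ?J) a (pure K ?J ?J b c)) (comul ?J y)) (comul ?J h)"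
      by simp
    have "tensor_sum ?I (\<lambda>x y. scalar x \<odot>\<^bsub>?I\<^esub> y) (pure K ?I ?I h (Scal \<one>\<^bsub>K\<^esub>)) = scalar h \<odot>\<^bsub>?I\<^esub> Scal \<one>\<^bsub>K\<^esub>"
      by (rule tensor_sum_pure[OF module_unit module_unit module_unit bilinear_unitor(1)[OF module_unit] h one])
    then show "tensor_sum ?J (\<lambda>x y. counit ?J x \<odot>\<^bsub>?J\<^esub> y) (comul ?J h) = h" using h by auto
    have "tensor_sum ?I (\<lambda>x y. scalar y \<odot>\<^bsub>?I\<^esub> x) (pure K ?I ?I h (Scal \<one>\<^bsub>K\<^esub>)) = scalar (Scal \<one>\<^bsub>K\<^esub> :: ('k, 'a) univ) \<odot>\<^bsub>?I\<^esub> h"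
      by (rule tensor_sum_pure[OF module_unit module_unit module_unit bilinear_unitor(2)[OF module_unit] h one])
    then show "tensor_sum ?J (\<lambda>x y. counit ?J y \<odot>\<^bsub>?J\<^esub> x) (comul ?J h) = h" using h by auto
  qed (auto intro!: linear_intros)
qed

lemma comul_unit_sum:
  assumes "module K M" "x \<in> carrier (unit_algebra K)"
    "\<And>x. x \<in> carrier (unit_algebra K) \<Longrightarrow> linear_map K (unit_algebra K) M (\<lambda>y. \<beta> x y)"
    "\<And>y. y \<in> carrier (unit_algebra K) \<Longrightarrow> linear_map K (unit_algebra K) M (\<lambda>x. \<beta> x y)"
  shows "tensor_sum M \<beta> (comul (unit_coalgebra K) x) = \<beta> x (Scal \<one>\<^bsub>K\<^esub>)"
  unfolding comul_unit using assms
  by (intro tensor_sum_pure[of "unit_algebra K" "unit_algebra K" M] bilinear_mapI) auto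

section \<open>Coalgebra homomorphisms\<close>

lemma coalg_homsI:
  assumes "\<tau> \<in> lin_maps K H H'" "coalgebra K H"
    and "\<And>h. h \<in> carrier H \<Longrightarrow>
      comul H' (\<tau> h) = tensor_sum (tensor K H' H') (\<lambda>x y. pure K H' H' (\<tau> x) (\<tau> y)) (comul H h)"
    and "\<And>h. h \<in> carrier H \<Longrightarrow> counit H' (\<tau> h) = counit H h"
  shows "\<tau> \<in> coalg_homs K H H'"
  using assms by (auto simp: coalg_homs_def tensor_map_eq_sum)

lemma coalg_homs_lin: "\<tau> \<in> coalg_homs K H H' \<Longrightarrow> \<tau> \<in> lin_maps K H H'"
  by (simp add: coalg_homs_def)

lemma coalg_homs_comul:
  assumes "\<tau> \<in> coalg_homs K H H'" "coalgebra K H" "h \<in> carrier H"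
  shows "comul H' (\<tau> h) = tensor_sum (tensor K H' H') (\<lambda>x y. pure K H' H' (\<tau> x) (\<tau> y)) (comul H h)"
  using assms by (auto simp: coalg_homs_def tensor_map_eq_sum)

lemma coalg_homs_counit:
  "\<lbrakk>\<tau> \<in> coalg_homs K H H'; h \<in> carrier H\<rbrakk> \<Longrightarrow> counit H' (\<tau> h) = counit H h"
  by (simp add: coalg_homs_def)

text \<open>The substitution rule of Sweedler calculus: a sum over \<Delta>(\<tau> h) is a sum over
  \<Delta>h with \<tau> applied to both factors. It follows by applying the linear map induced by
  \<beta> to the homomorphism property.\<close>

lemma coalg_homs_comul_sum:
  assumes "\<tau> \<in> coalg_homs K H H'" "coalgebra K H" "coalgebra K H'" "h \<in> carrier H" "module K M"
    and "\<And>x. x \<in> carrier H' \<Longrightarrow> linear_map K H' M (\<lambda>y. \<beta> x y)"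
    and "\<And>y. y \<in> carrier H' \<Longrightarrow> linear_map K H' M (\<lambda>x. \<beta> x y)"
  shows "tensor_sum M \<beta> (comul H' (\<tau> h)) = tensor_sum M (\<lambda>x y. \<beta> (\<tau> x) (\<tau> y)) (comul H h)"
proof -
  have b: "bilinear_map K H' H' M \<beta>" using assms by (intro bilinear_mapI)
  note \<tau> = lin_maps_closed[OF coalg_homs_lin[OF assms(1)]]
  have "tensor_sum M \<beta> (comul H' (\<tau> h)) =
    tensor_sum M (\<lambda>x y. tensor_sum M \<beta> (pure K H' H' (\<tau> x) (\<tau> y))) (comul H h)"
    unfolding coalg_homs_comul[OF assms(1,2,4)] using assms(2-5) b \<tau>
    by (intro comul_sum_linear_map[of "tensor K H' H'"] linear_tensor_sum[of H' H']) auto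
  also have "\<dots> = tensor_sum M (\<lambda>x y. \<beta> (\<tau> x) (\<tau> y)) (comul H h)"
    using assms(2-5) \<tau> by (intro comul_sum_cong tensor_sum_pure[OF _ _ _ b]) auto
  finally show ?thesis .
qed

lemma coalg_homs_ident:
  assumes "coalgebra K H"
  shows "(\<lambda>h\<in>carrier H. h) \<in> coalg_homs K H H"
proof (rule coalg_homsI)
  fix h assume h: "h \<in> carrier H"
  have "tensor_sum (tensor K H H) (\<lambda>x y. pure K H H ((\<lambda>h\<in>carrier H. h) x) ((\<lambda>h\<in>carrier H. h) y)) (comul H h) =
    tensor_sum (tensor K H H) (\<lambda>x y. pure K H H x y) (comul H h)"
    using assms h by (intro comul_sum_cong) auto
  then show "comul H ((\<lambda>h\<in>carrier H. h) h) =
    tensor_sum (tensor K H H) (\<lambda>x y. pure K H H ((\<lambda>h\<in>carrier H. h) x) ((\<lambda>h\<in>carrier H. h) y)) (comul H h)"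
    using assms h by (simp add: comul_eq_sum)
qed (use assms in auto)

lemma coalg_homs_compose:
  assumes "coalgebra K H" "coalgebra K H'" "coalgebra K H''" "\<tau> \<in> coalg_homs K H H'" "\<tau>' \<in> coalg_homs K H' H''"
  shows "compose (carrier H) \<tau>' \<tau> \<in> coalg_homs K H H''"
proof (rule coalg_homsI)
  note l = coalg_homs_lin[OF assms(4)] coalg_homs_lin[OF assms(5)]
  show "compose (carrier H) \<tau>' \<tau> \<in> lin_maps K H H''"
    using l assms(1) by (intro lin_maps_compose) auto
  fix h assume h: "h \<in> carrier H"
  then show "counit H'' (compose (carrier H) \<tau>' \<tau> h) = counit H h"
    using assms(4,5) l by (auto simp: compose_eq coalg_homs_counit lin_maps_closed)
  have "comul H'' (\<tau>' (\<tau> h)) =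
      tensor_sum (tensor K H'' H'') (\<lambda>x y. pure K H'' H'' (\<tau>' x) (\<tau>' y)) (comul H' (\<tau> h))"
    using assms l h by (intro coalg_homs_comul) (auto simp: lin_maps_closed)
  also have "\<dots> = tensor_sum (tensor K H'' H'') (\<lambda>x y. pure K H'' H'' (\<tau>' (\<tau> x)) (\<tau>' (\<tau> y))) (comul H h)"
    using assms l h by (intro coalg_homs_comul_sum[OF assms(4)]) (auto simp: lin_maps_closed intro!: linear_pure1 linear_pure2)
  also have "\<dots> = tensor_sum (tensor K H'' H'') (\<lambda>x y. pure K H'' H'' (compose (carrier H) \<tau>' \<tau> x)
      (compose (carrier H) \<tau>' \<tau> y)) (comul H h)"
    using assms(1) h by (intro comul_sum_cong) (auto simp: compose_eq)
  finally show "comul H'' (compose (carrier H) \<tau>' \<tau> h) = tensor_sum (tensor K H'' H'') (\<lambda>x y. pure K H'' H'' (compose (carrier H) \<tau>' \<tau> x)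
      (compose (carrier H) \<tau>' \<tau> y)) (comul H h)"
    using h by (simp add: compose_eq)
qed (rule assms)

text \<open>Write h as \<tau>(\<tau>' h). The substitution rule for \<tau> turns (\<tau>' \<otimes>
  \<tau>')\<Delta>h into a sum over \<Delta>(\<tau>' h) in which \<tau>' cancels \<tau> in both
  factors.\<close>

lemma coalg_homs_inverse:
  assumes "coalgebra K H" "coalgebra K H'" "\<tau> \<in> coalg_homs K H H'" "\<tau>' \<in> lin_maps K H' H"
    and "compose (carrier H) \<tau>' \<tau> = (\<lambda>h\<in>carrier H. h)" "compose (carrier H') \<tau> \<tau>' = (\<lambda>h\<in>carrier H'. h)"
  shows "\<tau>' \<in> coalg_homs K H' H"
proof (rule coalg_homsI[OF assms(4,2)])
  note l = coalg_homs_lin[OF assms(3)]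
  have inv: "\<tau>' (\<tau> x) = x" if "x \<in> carrier H" for x
    using fun_cong[OF assms(5), of x] that by (simp add: compose_eq)
  fix h assume h: "h \<in> carrier H'"
  then have inv': "\<tau> (\<tau>' h) = h"
    using fun_cong[OF assms(6), of h] by (simp add: compose_eq)
  have k: "\<tau>' h \<in> carrier H" using h assms(4) by (auto intro: lin_maps_closed)
  show "counit H (\<tau>' h) = counit H' h"
    using coalg_homs_counit[OF assms(3) k] inv' by simp
  have "tensor_sum (tensor K H H) (\<lambda>x y. pure K H H (\<tau>' x) (\<tau>' y)) (comul H' (\<tau> (\<tau>' h))) =
    tensor_sum (tensor K H H) (\<lambda>x y. pure K H H (\<tau>' (\<tau> x)) (\<tau>' (\<tau> y))) (comul H (\<tau>' h))"
    using assms(1,2,4) k l by (intro coalg_homs_comul_sum[OF assms(3)]) (auto simp: lin_maps_closed intro!: linear_pure1 linear_pure2)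
  also have "\<dots> = tensor_sum (tensor K H H) (\<lambda>x y. pure K H H x y) (comul H (\<tau>' h))"
    using assms(1) k by (intro comul_sum_cong) (auto simp: inv)
  also have "\<dots> = comul H (\<tau>' h)"
    using assms(1) k by (simp add: comul_eq_sum)
  finally show "comul H (\<tau>' h) = tensor_sum (tensor K H H) (\<lambda>x y. pure K H H (\<tau>' x) (\<tau>' y)) (comul H' h)"
    by (simp add: inv')
qed

lemma linear_lin_maps_pure1:
  "\<lbrakk>f \<in> lin_maps K U V; module K V; module K W; w \<in> carrier W\<rbrakk>
    \<Longrightarrow> linear_map K U (tensor K V W) (\<lambda>u. pure K V W (f u) w)"
  and linear_lin_maps_pure2:
  "\<lbrakk>f \<in> lin_maps K U W; module K V; module K W; v \<in> carrier V\<rbrakk>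
    \<Longrightarrow> linear_map K U (tensor K V W) (\<lambda>u. pure K V W v (f u))"
  by (simp_all add: linear_pure1 linear_pure2)

text \<open>Compatibility with \<Delta> and with \<epsilon> are equations between linear maps on C
  \<otimes> D. On a pure tensor \<open>comul_tensor_sum\<close> replaces the comultiplication of the
  tensor coalgebra by the iterated sum that appears in the premise.\<close>

lemma coalg_homs_tensorI:
  assumes C: "coalgebra K C" and D: "coalgebra K D" and E: "coalgebra K E"
    and \<tau>: "\<tau> \<in> lin_maps K (tensor K C D) E"
    and comul: "\<And>x y. \<lbrakk>x \<in> carrier C; y \<in> carrier D\<rbrakk> \<Longrightarrow> comul E (\<tau> (pure K C D x y)) =
      tensor_sum (tensor K E E) (\<lambda>x1 x2. tensor_sum (tensor K E E) (\<lambda>y1 y2.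
        pure K E E (\<tau> (pure K C D x1 y1)) (\<tau> (pure K C D x2 y2))) (comul D y)) (comul C x)"
    and counit: "\<And>x y. \<lbrakk>x \<in> carrier C; y \<in> carrier D\<rbrakk> \<Longrightarrow>
      counit E (\<tau> (pure K C D x y)) = counit C x \<otimes>\<^bsub>K\<^esub> counit D y"
  shows "\<tau> \<in> coalg_homs K (coalg_tensor K C D) E"
proof (rule coalg_homsI)
  let ?T = "tensor K C D" and ?P = "coalg_tensor K C D"
  note mT = coalgebra_linear(1)[OF C] coalgebra_linear(1)[OF D] and P = coalgebra_tensor[OF C D]
  show "\<tau> \<in> lin_maps K ?P E" using \<tau> by simp
  show "coalgebra K ?P" by (rule P)
  fix h assume "h \<in> carrier ?P"
  then have h: "h \<in> carrier ?T" by simp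
  have p: "linear_map K ?T (tensor K E E) (\<lambda>x. pure K E E (\<tau> x) y)"
    "linear_map K ?T (tensor K E E) (\<lambda>x. pure K E E y (\<tau> x))" if "y \<in> carrier E" for y
    using that \<tau> E by (auto intro!: linear_lin_maps_pure1 linear_lin_maps_pure2)
  have l: "linear_map K ?T (tensor K E E)
      (\<lambda>h. tensor_sum (tensor K E E) (\<lambda>x y. pure K E E (\<tau> x) (\<tau> y)) (comul ?P h))"
    using E mT by (intro linear_tensor_sum1[OF linear_comul_tensor[OF C D]]) (simp_all add: p lin_maps_closed[OF \<tau>])
  show "comul E (\<tau> h) = tensor_sum (tensor K E E) (\<lambda>x y. pure K E E (\<tau> x) (\<tau> y)) (comul ?P h)"
  proof (rule tensor_eqI[OF mT _ _ l _ h])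
    show "linear_map K ?T (tensor K E E) (\<lambda>x. comul E (\<tau> x))"
      by (rule linear_compose[OF lin_maps_linear[OF \<tau>] coalgebra_linear(2)[OF E]])
    fix x y assume xy: "x \<in> carrier C" "y \<in> carrier D"
    show "comul E (\<tau> (pure K C D x y)) =
      tensor_sum (tensor K E E) (\<lambda>x y. pure K E E (\<tau> x) (\<tau> y)) (comul ?P (pure K C D x y))"
      unfolding comul[OF xy] using xy E
      by (intro comul_tensor_sum[OF C D, symmetric]) (simp_all add: p lin_maps_closed[OF \<tau>])
  qed (use E in auto)
  show "counit E (\<tau> h) = counit ?P h"
  proof (rule tensor_eqI[OF mT module_base _ linear_counit_tensor[OF C D] _ h])
    show "linear_map K ?T (base_module K) (\<lambda>x. counit E (\<tau> x))"
      by (rule linear_compose[OF lin_maps_linear[OF \<tau>] coalgebra_linear(3)[OF E]])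
  qed (simp add: counit counit_tensor_pure[OF C D])
qed

text \<open>After \<Delta>(f x \<otimes> g y) has been expanded, the substitution rule is applied in
  the outer sum for f and in the inner sum for g.\<close>

lemma coalg_homs_tensor_map:
  assumes "coalgebra K C" "coalgebra K D" "coalgebra K C'" "coalgebra K D'"
    and f: "f \<in> coalg_homs K C C'" and g: "g \<in> coalg_homs K D D'"
  shows "tensor_map K C D C' D' f g \<in> coalg_homs K (coalg_tensor K C D) (coalg_tensor K C' D')"
proof (rule coalg_homs_tensorI)
  let ?T = "tensor K C' D'"
  let ?M = "tensor K ?T ?T"
  note l = coalg_homs_lin[OF f] coalg_homs_lin[OF g]
  show "tensor_map K C D C' D' f g \<in> lin_maps K (tensor K C D) (coalg_tensor K C' D')"
    using assms l by (simp add: tensor_map_in_lin_maps)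
  fix x y assume x: "x \<in> carrier C" and y: "y \<in> carrier D"
  show "counit (coalg_tensor K C' D') (tensor_map K C D C' D' f g (pure K C D x y)) = counit C x \<otimes>\<^bsub>K\<^esub> counit D y"
    using x y assms l by (simp add: counit_tensor_pure lin_maps_closed coalg_homs_counit)
  have "comul (coalg_tensor K C' D') (pure K C' D' (f x) (g y)) =
    tensor_sum ?M (\<lambda>x1 x2. tensor_sum ?M (\<lambda>y1 y2.
      pure K ?T ?T (pure K C' D' x1 y1) (pure K C' D' x2 y2)) (comul D' (g y))) (comul C' (f x))"
    using x y l assms(3,4) by (intro comul_tensor_pure) (auto simp: lin_maps_closed)
  also have "\<dots> = tensor_sum ?M (\<lambda>x1 x2. tensor_sum ?M (\<lambda>y1 y2.
      pure K ?T ?T (pure K C' D' (f x1) y1) (pure K C' D' (f x2) y2)) (comul D' (g y))) (comul C x)"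
    using x y l assms by (intro coalg_homs_comul_sum[OF f]) (auto simp: lin_maps_closed intro!: sweedler_intros)
  also have "\<dots> = tensor_sum ?M (\<lambda>x1 x2. tensor_sum ?M (\<lambda>y1 y2.
      pure K ?T ?T (pure K C' D' (f x1) (g y1)) (pure K C' D' (f x2) (g y2))) (comul D y)) (comul C x)"
    using x y l assms by (intro comul_sum_cong coalg_homs_comul_sum[OF g]) (auto simp: lin_maps_closed intro!: sweedler_intros)
  also have "\<dots> = tensor_sum ?M (\<lambda>x1 x2. tensor_sum ?M (\<lambda>y1 y2.
      pure K ?T ?T (tensor_map K C D C' D' f g (pure K C D x1 y1)) (tensor_map K C D C' D' f g (pure K C D x2 y2))) (comul D y)) (comul C x)"
    using x y l assms by (intro comul_sum_cong) auto
  finally show "comul (coalg_tensor K C' D') (tensor_map K C D C' D' f g (pure K C D x y)) =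
    tensor_sum (tensor K (coalg_tensor K C' D') (coalg_tensor K C' D')) (\<lambda>x1 x2.
     tensor_sum (tensor K (coalg_tensor K C' D') (coalg_tensor K C' D')) (\<lambda>y1 y2.
      pure K (coalg_tensor K C' D') (coalg_tensor K C' D') (tensor_map K C D C' D' f g (pure K C D x1 y1))
       (tensor_map K C D C' D' f g (pure K C D x2 y2))) (comul D y)) (comul C x)"
    using x y l assms by simp
qed (use assms coalgebra_tensor in auto)

text \<open>The source is an iterated tensor product, so the comparison is made on triple pure
  tensors. There both sides expand to one triple sum over \<Delta>u, \<Delta>v and \<Delta>w; for
  the counit the claim is associativity of multiplication in K.\<close>

lemma coalg_homs_tensor_assoc:
  assumes U: "coalgebra K U" and V: "coalgebra K V" and W: "coalgebra K W"
  shows "tensor_assoc K U V W \<in>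
    coalg_homs K (coalg_tensor K (coalg_tensor K U V) W) (coalg_tensor K U (coalg_tensor K V W))"
proof (rule coalg_homsI)
  let ?UV = "tensor K U V" and ?VW = "tensor K V W" and ?\<alpha> = "tensor_assoc K U V W"
  let ?S = "tensor K (tensor K U V) W" and ?T = "tensor K U (tensor K V W)"
  let ?P = "coalg_tensor K (coalg_tensor K U V) W" and ?Q = "coalg_tensor K U (coalg_tensor K V W)"
  let ?M = "tensor K ?T ?T"
  note m [simp] = coalgebra_linear(1)[OF U] coalgebra_linear(1)[OF V] coalgebra_linear(1)[OF W]
  note UV = coalgebra_tensor[OF U V] and VW = coalgebra_tensor[OF V W]
  note P = coalgebra_tensor[OF UV W] and Q = coalgebra_tensor[OF U VW]
  have l: "?\<alpha> \<in> lin_maps K ?S ?T" by (simp add: tensor_assoc_in_lin_maps)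
  then show "?\<alpha> \<in> lin_maps K ?P ?Q" by simp
  show "coalgebra K ?P" by (rule P)
  note \<alpha> = lin_maps_closed[OF l]
  have p: "linear_map K ?S ?M (\<lambda>x. pure K ?T ?T (?\<alpha> x) y)"
    "linear_map K ?S ?M (\<lambda>x. pure K ?T ?T y (?\<alpha> x))" if "y \<in> carrier ?T" for y
    using that by (simp_all add: linear_lin_maps_pure1[OF l] linear_lin_maps_pure2[OF l])
  fix h assume "h \<in> carrier ?P"
  then have h: "h \<in> carrier ?S" by simp
  have lP: "linear_map K ?S (tensor K ?S ?S) (comul ?P)" "linear_map K ?S (base_module K) (counit ?P)"
    and lQ: "linear_map K ?T (tensor K ?T ?T) (comul ?Q)" "linear_map K ?T (base_module K) (counit ?Q)"
    using coalgebra_linear(2,3)[OF P] coalgebra_linear(2,3)[OF Q] by simp_all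
  show "counit ?Q (?\<alpha> h) = counit ?P h"
  proof (rule tensor3l_eqI[OF m(1) m(2) m(3) module_base linear_compose[OF lin_maps_linear[OF l] lQ(2)] lP(2) _ h])
    fix u v w assume u: "u \<in> carrier U" and v: "v \<in> carrier V" and w: "w \<in> carrier W"
    interpret cring K by (rule cring_K)
    show "counit ?Q (?\<alpha> (pure K ?UV W (pure K U V u v) w)) = counit ?P (pure K ?UV W (pure K U V u v) w)"
      using counit_tensor_pure[OF U VW, of u "pure K V W v w"] counit_tensor_pure[OF UV W, of "pure K U V u v" w]
        counit_tensor_pure[OF U V u v] counit_tensor_pure[OF V W v w] u v w U V W
      by (simp add: m_assoc)
  qed
  have lr: "linear_map K ?S ?M (\<lambda>h. tensor_sum ?M (\<lambda>x y. pure K ?T ?T (?\<alpha> x) (?\<alpha> y)) (comul ?P h))"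
    by (intro linear_tensor_sum1[OF lP(1)]) (simp_all add: p \<alpha>)
  have "comul ?Q (?\<alpha> h) = tensor_sum ?M (\<lambda>x y. pure K ?T ?T (?\<alpha> x) (?\<alpha> y)) (comul ?P h)"
  proof (rule tensor3l_eqI[OF m(1) m(2) m(3) _ linear_compose[OF lin_maps_linear[OF l] lQ(1)] lr _ h])
    fix u v w assume u: "u \<in> carrier U" and v: "v \<in> carrier V" and w: "w \<in> carrier W"
    let ?F = "\<lambda>u1 u2 v1 v2 w1 w2. pure K ?T ?T (pure K U ?VW u1 (pure K V W v1 w1)) (pure K U ?VW u2 (pure K V W v2 w2))"
    \<comment> \<open>The common normal form: every nested comultiplication is resolved, and the
      sums are ordered u, v, w.\<close>
    let ?R = "tensor_sum ?M (\<lambda>u1 u2. tensor_sum ?M (\<lambda>v1 v2. tensor_sum ?M (\<lambda>w1 w2. ?F u1 u2 v1 v2 w1 w2) (comul W w)) (comul V v)) (comul U u)"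
    have "comul ?Q (pure K U ?VW u (pure K V W v w)) =
      tensor_sum ?M (\<lambda>u1 u2. tensor_sum ?M (\<lambda>q1 q2. pure K ?T ?T (pure K U ?VW u1 q1) (pure K U ?VW u2 q2))
        (comul (coalg_tensor K V W) (pure K V W v w))) (comul U u)"
      using comul_tensor_pure[OF U VW, of u "pure K V W v w"] u v w by simp
    also have "\<dots> = ?R"
      by (intro comul_sum_cong[OF U u] comul_tensor_sum[OF V W _ v w]) (auto intro!: linear_intros)
    finally have 1: "comul ?Q (pure K U ?VW u (pure K V W v w)) = ?R" .
    have "tensor_sum ?M (\<lambda>x y. pure K ?T ?T (?\<alpha> x) (?\<alpha> y)) (comul ?P (pure K ?UV W (pure K U V u v) w)) =
      tensor_sum ?M (\<lambda>p1 p2. tensor_sum ?M (\<lambda>w1 w2. pure K ?T ?T (?\<alpha> (pure K ?UV W p1 w1)) (?\<alpha> (pure K ?UV W p2 w2))) (comul W w))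
        (comul (coalg_tensor K U V) (pure K U V u v))"
      using comul_tensor_sum[OF UV W, of ?M "pure K U V u v" w "\<lambda>x y. pure K ?T ?T (?\<alpha> x) (?\<alpha> y)"] u v w
      by (simp add: p \<alpha>)
    also have "\<dots> = tensor_sum ?M (\<lambda>u1 u2. tensor_sum ?M (\<lambda>v1 v2. tensor_sum ?M (\<lambda>w1 w2.
        pure K ?T ?T (?\<alpha> (pure K ?UV W (pure K U V u1 v1) w1)) (?\<alpha> (pure K ?UV W (pure K U V u2 v2) w2))) (comul W w)) (comul V v)) (comul U u)"
    proof (intro comul_tensor_sum[OF U V _ u v] linear_comul_sum2[OF W w])
      fix x y z assume "x \<in> carrier W" "y \<in> carrier W" "z \<in> carrier ?UV"
      then show "linear_map K ?UV ?M (\<lambda>q. pure K ?T ?T (?\<alpha> (pure K ?UV W z x)) (?\<alpha> (pure K ?UV W q y)))"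
        and "linear_map K ?UV ?M (\<lambda>q. pure K ?T ?T (?\<alpha> (pure K ?UV W q x)) (?\<alpha> (pure K ?UV W z y)))"
        by (simp_all add: \<alpha> linear_compose[OF pure_linear_left p(1)] linear_compose[OF pure_linear_left p(2)])
    qed simp_all
    also have "\<dots> = ?R"
      using u v w by (intro comul_sum_cong[OF U] comul_sum_cong[OF V] comul_sum_cong[OF W]) simp_all
    finally show "comul ?Q (?\<alpha> (pure K ?UV W (pure K U V u v) w)) =
      tensor_sum ?M (\<lambda>x y. pure K ?T ?T (?\<alpha> x) (?\<alpha> y)) (comul ?P (pure K ?UV W (pure K U V u v) w))"
      using u v w 1 by simp
  qed simp
  then show "comul ?Q (?\<alpha> h) = tensor_sum (tensor K ?Q ?Q) (\<lambda>x y. pure K ?Q ?Q (?\<alpha> x) (?\<alpha> y)) (comul ?P h)"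
    by simp
qed

text \<open>With x = c the sum over \<Delta>x reduces to the term x \<otimes> 1, so c occurs in one
  factor only and comes out of the remaining sum; what is left is \<Delta>(cv) = c
  \<Delta>v.\<close>

lemma coalg_homs_unitor:
  fixes V :: "('k, ('k, 'a) univ) coalgebra"
  assumes V: "coalgebra K V"
  shows "left_unitor V \<in> coalg_homs K (coalg_tensor K (unit_coalgebra K) V) V"
    and "right_unitor V \<in> coalg_homs K (coalg_tensor K V (unit_coalgebra K)) V"
proof -
  let ?I = "unit_algebra K :: ('k, ('k, 'a) univ) module" and ?V = "tensor K V V"
    and ?J = "unit_coalgebra K :: ('k, ('k, 'a) univ) coalgebra"
  note m [simp] = coalgebra_linear(1)[OF V]
  interpret V: module K V by simp
  have one: "Scal \<one>\<^bsub>K\<^esub> \<in> carrier ?I" by simp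
  have mm: "module K ?V" by simp
  have S: "\<exists>c\<in>carrier K. x = Scal c" if "x \<in> carrier ?J" for x :: "('k, 'a) univ" using that by auto
  show "left_unitor V \<in> coalg_homs K (coalg_tensor K ?J V) V"
  proof (rule coalg_homs_tensorI[OF coalgebra_unit V V])
    show "left_unitor V \<in> lin_maps K (tensor K ?J V) V" by simp
    fix x v assume "x \<in> carrier ?J" and v: "v \<in> carrier V"
    then obtain c where c: "c \<in> carrier K" "x = Scal c" using S by blast
    show "counit V (left_unitor V (pure K ?J V x v)) = counit ?J x \<otimes>\<^bsub>K\<^esub> counit V v"
      using c v linear_map_smult[OF coalgebra_linear(3)[OF V] c(1) v] by (simp add: counit_unit)
    have "tensor_sum ?V (\<lambda>x1 x2. tensor_sum ?V (\<lambda>y1 y2. pure K V V (left_unitor V (pure K ?I V x1 y1)) (left_unitor V (pure K ?I V x2 y2))) (comul V v)) (comul ?J x)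
      = tensor_sum ?V (\<lambda>y1 y2. pure K V V (left_unitor V (pure K ?I V x y1)) (left_unitor V (pure K ?I V (Scal \<one>\<^bsub>K\<^esub>) y2))) (comul V v)"
    proof (intro comul_unit_sum[OF mm] linear_comul_sum2[OF V v mm])
      fix a b z assume "a \<in> carrier V" "b \<in> carrier V" "z \<in> carrier ?I"
      then show "linear_map K ?I ?V (\<lambda>q. pure K V V (left_unitor V (pure K ?I V z a)) (left_unitor V (pure K ?I V q b)))"
        and "linear_map K ?I ?V (\<lambda>q. pure K V V (left_unitor V (pure K ?I V q a)) (left_unitor V (pure K ?I V z b)))"
        by (simp_all del: carrier_unit add: lin_maps_closed[OF unitor_in_lin_maps(1)]
          linear_pure1[OF linear_map_pure_left[OF linear_unitor(1)]] linear_pure2[OF linear_map_pure_left[OF linear_unitor(1)]])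
    qed (use c in simp)
    also have "\<dots> = tensor_sum ?V (\<lambda>y1 y2. c \<odot>\<^bsub>?V\<^esub> pure K V V y1 y2) (comul V v)"
      using V v c by (intro comul_sum_cong) (simp_all add: pure_smult)
    also have "\<dots> = c \<odot>\<^bsub>?V\<^esub> tensor_sum ?V (pure K V V) (comul V v)"
      using V v c by (intro comul_sum_linear_map[of ?V ?V "\<lambda>z. c \<odot>\<^bsub>?V\<^esub> z", symmetric] linear_smult2) simp_all
    finally show "comul V (left_unitor V (pure K ?J V x v)) =
      tensor_sum ?V (\<lambda>x1 x2. tensor_sum ?V (\<lambda>y1 y2. pure K V V (left_unitor V (pure K ?J V x1 y1)) (left_unitor V (pure K ?J V x2 y2))) (comul V v)) (comul ?J x)"
      using c v V linear_map_smult[OF coalgebra_linear(2)[OF V] c(1) v] by (simp add: comul_eq_sum)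
  qed
  show "right_unitor V \<in> coalg_homs K (coalg_tensor K V ?J) V"
  proof (rule coalg_homs_tensorI[OF V coalgebra_unit V])
    show "right_unitor V \<in> lin_maps K (tensor K V ?J) V" by simp
    fix x v assume "x \<in> carrier ?J" and v: "v \<in> carrier V"
    then obtain c where c: "c \<in> carrier K" "x = Scal c" using S by blast
    show "counit V (right_unitor V (pure K V ?J v x)) = counit V v \<otimes>\<^bsub>K\<^esub> counit ?J x"
      using c v V linear_map_smult[OF coalgebra_linear(3)[OF V] c(1) v] by (simp add: counit_unit V.R.m_comm)
    have "tensor_sum ?V (\<lambda>y1 y2. tensor_sum ?V (\<lambda>x1 x2. pure K V V (right_unitor V (pure K V ?I y1 x1)) (right_unitor V (pure K V ?I y2 x2))) (comul ?J x)) (comul V v)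
      = tensor_sum ?V (\<lambda>y1 y2. pure K V V (right_unitor V (pure K V ?I y1 x)) (right_unitor V (pure K V ?I y2 (Scal \<one>\<^bsub>K\<^esub>)))) (comul V v)"
    proof (intro comul_sum_cong[OF V v] comul_unit_sum[OF mm])
      fix a b z assume "a \<in> carrier V" "b \<in> carrier V" "z \<in> carrier ?I"
      then show "linear_map K ?I ?V (\<lambda>q. pure K V V (right_unitor V (pure K V ?I a z)) (right_unitor V (pure K V ?I b q)))"
        and "linear_map K ?I ?V (\<lambda>q. pure K V V (right_unitor V (pure K V ?I a q)) (right_unitor V (pure K V ?I b z)))"
        by (simp_all del: carrier_unit add: lin_maps_closed[OF unitor_in_lin_maps(2)]
          linear_pure1[OF linear_map_pure_right[OF linear_unitor(2)]] linear_pure2[OF linear_map_pure_right[OF linear_unitor(2)]])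
    qed (use c in simp)
    also have "\<dots> = tensor_sum ?V (\<lambda>y1 y2. c \<odot>\<^bsub>?V\<^esub> pure K V V y1 y2) (comul V v)"
      using V v c by (intro comul_sum_cong) (simp_all add: pure_smult)
    also have "\<dots> = c \<odot>\<^bsub>?V\<^esub> tensor_sum ?V (pure K V V) (comul V v)"
      using V v c by (intro comul_sum_linear_map[of ?V ?V "\<lambda>z. c \<odot>\<^bsub>?V\<^esub> z", symmetric] linear_smult2) simp_all
    finally show "comul V (right_unitor V (pure K V ?J v x)) =
      tensor_sum ?V (\<lambda>y1 y2. tensor_sum ?V (\<lambda>x1 x2. pure K V V (right_unitor V (pure K V ?J y1 x1)) (right_unitor V (pure K V ?J y2 x2))) (comul ?J x)) (comul V v)"
      using c v V linear_map_smult[OF coalgebra_linear(2)[OF V] c(1) v] by (simp add: comul_eq_sum)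
  qed
qed

section \<open>Measuring coalgebras\<close>

lemma module_hom:
  assumes "module K V" "module K W"
  shows "module K (hom_module K V W)"
proof -
  interpret V: module K V by fact
  interpret W: module K W by fact
  \<comment> \<open>The pointwise negative, restricted to the carrier so that it is extensional; it
    witnesses additive inverses below.\<close>
  have neg: "(\<lambda>v\<in>carrier V. \<ominus>\<^bsub>W\<^esub> f v) \<in> lin_maps K V W" if "f \<in> lin_maps K V W" for f
    using that lin_maps_closed[OF that]
    by (auto simp: lin_maps_iff linear_map_def W.minus_add W.smult_r_minus)
  show ?thesis
  proof (intro moduleI abelian_groupI cring_K)
    fix f assume "f \<in> carrier (hom_module K V W)"
    then have f: "f \<in> lin_maps K V W" by (simp add: hom_module_def)
    show "\<exists>g\<in>carrier (hom_module K V W). g \<oplus>\<^bsub>hom_module K V W\<^esub> f = \<zero>\<^bsub>hom_module K V W\<^esub>"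
      using neg[OF f] lin_maps_closed[OF f]
      by (intro bexI[of _ "\<lambda>v\<in>carrier V. \<ominus>\<^bsub>W\<^esub> f v"]) (auto simp: hom_module_def W.l_neg intro!: restrict_ext)
    show "\<zero>\<^bsub>hom_module K V W\<^esub> \<oplus>\<^bsub>hom_module K V W\<^esub> f = f" "\<one>\<^bsub>K\<^esub> \<odot>\<^bsub>hom_module K V W\<^esub> f = f"
      using f lin_maps_closed[OF f] by (auto simp: hom_module_def lin_maps_iff intro!: extensionalityI[of _ "carrier V"])
  next
    fix f g assume fg: "f \<in> carrier (hom_module K V W)" "g \<in> carrier (hom_module K V W)"
    then have fg: "f \<in> lin_maps K V W" "g \<in> lin_maps K V W" by (simp_all add: hom_module_def)
    show "f \<oplus>\<^bsub>hom_module K V W\<^esub> g \<in> carrier (hom_module K V W)"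
      using fg lin_maps_closed[OF fg(1)] lin_maps_closed[OF fg(2)]
      by (simp add: hom_module_def lin_maps_iff linear_map_def W.a_ac W.smult_r_distr)
    show "f \<oplus>\<^bsub>hom_module K V W\<^esub> g = g \<oplus>\<^bsub>hom_module K V W\<^esub> f"
      using lin_maps_closed[OF fg(1)] lin_maps_closed[OF fg(2)]
      by (simp add: hom_module_def W.a_comm cong: restrict_cong)
  next
    fix c f assume c: "c \<in> carrier K" and "f \<in> carrier (hom_module K V W)"
    then have f: "f \<in> lin_maps K V W" by (simp add: hom_module_def)
    show "c \<odot>\<^bsub>hom_module K V W\<^esub> f \<in> carrier (hom_module K V W)"
      using c f lin_maps_closed[OF f]
      by (simp add: hom_module_def lin_maps_iff linear_map_def W.smult_r_distr W.smult_assoc1[symmetric] V.R.m_comm)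
  next
    show "\<zero>\<^bsub>hom_module K V W\<^esub> \<in> carrier (hom_module K V W)"
      by (simp add: hom_module_def lin_maps_iff linear_map_def)
  qed (auto simp: hom_module_def lin_maps_iff linear_map_closed W.a_ac W.smult_l_distr W.smult_r_distr W.smult_assoc1 intro!: restrict_ext)
qed

lemma hom_module_simps [simp]:
  "carrier (hom_module K V W) = lin_maps K V W"
  "v \<in> carrier V \<Longrightarrow> (f \<oplus>\<^bsub>hom_module K V W\<^esub> g) v = f v \<oplus>\<^bsub>W\<^esub> g v"
  "v \<in> carrier V \<Longrightarrow> (c \<odot>\<^bsub>hom_module K V W\<^esub> f) v = c \<odot>\<^bsub>W\<^esub> f v"
  by (simp_all add: hom_module_def)

lemma linear_hom_apply:
  assumes "linear_map K U (hom_module K V W) f" "v \<in> carrier V"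
  shows "linear_map K U W (\<lambda>u. f u v)"
proof -
  have "f u v \<in> carrier W" if "u \<in> carrier U" for u
    using linear_map_closed[OF assms(1) that] assms(2) by (simp add: lin_maps_closed)
  then show ?thesis using assms by (simp add: linear_map_def)
qed

text \<open>Operations in the Hom module are pointwise, so linearity of a map into it can be tested
  by evaluation at each v. Bilinearity of the composition of measurings is reduced to maps into C in
  this way.\<close>

lemma linear_into_hom:
  assumes "module K U" "module K V" "module K W" "\<And>u. u \<in> carrier U \<Longrightarrow> f u \<in> lin_maps K V W"
    and "\<And>v. v \<in> carrier V \<Longrightarrow> linear_map K U W (\<lambda>u. f u v)"
  shows "linear_map K U (hom_module K V W) f"
proof (rule linear_mapI)
  fix x y assume "x \<in> carrier U" "y \<in> carrier U"
  then show "f (x \<oplus>\<^bsub>U\<^esub> y) = f x \<oplus>\<^bsub>hom_module K V W\<^esub> f y"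
    using assms(1,4) linear_map_add[OF assms(5)] module_simps(2)[OF module_hom[OF assms(2,3)], of "f x" "f y"]
    by (intro lin_maps_eqI[of _ V W]) simp_all
next
  fix c x assume "c \<in> carrier K" "x \<in> carrier U"
  then show "f (c \<odot>\<^bsub>U\<^esub> x) = c \<odot>\<^bsub>hom_module K V W\<^esub> f x"
    using assms(1,4) linear_map_smult[OF assms(5)] module_simps(3)[OF module_hom[OF assms(2,3)], of c "f x"]
    by (intro lin_maps_eqI[of _ V W]) simp_all
qed (simp add: assms)

lemma k_algebra_module [simp]: "k_algebra K A \<Longrightarrow> module K A"
  by (rule k_algebra.axioms(1))

lemma k_algebra_mult_closed [simp]:
  assumes "k_algebra K A"
  shows "\<lbrakk>x \<in> carrier A; y \<in> carrier A\<rbrakk> \<Longrightarrow> x \<otimes>\<^bsub>A\<^esub> y \<in> carrier A" and "\<one>\<^bsub>A\<^esub> \<in> carrier A"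
proof -
  interpret k_algebra K A by fact
  show "\<lbrakk>x \<in> carrier A; y \<in> carrier A\<rbrakk> \<Longrightarrow> x \<otimes>\<^bsub>A\<^esub> y \<in> carrier A" and "\<one>\<^bsub>A\<^esub> \<in> carrier A" by simp_all
qed

lemma linear_mult1:
  assumes "linear_map K U A f" "k_algebra K A" "b \<in> carrier A"
  shows "linear_map K U A (\<lambda>u. f u \<otimes>\<^bsub>A\<^esub> b)"
proof -
  interpret k_algebra K A by fact
  show ?thesis using assms(1,3) by (simp add: linear_map_def A.l_distr smult_mult_left)
qed

lemma linear_mult2:
  assumes "linear_map K U A f" "k_algebra K A" "b \<in> carrier A"
  shows "linear_map K U A (\<lambda>u. b \<otimes>\<^bsub>A\<^esub> f u)"
proof -
  interpret k_algebra K A by fact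
  show ?thesis using assms(1,3) by (simp add: linear_map_def A.r_distr smult_mult_right)
qed

section \<open>Measurings and their composites\<close>

lemma measuresI:
  assumes "\<rho> \<in> lin_maps K H (hom_module K A B)"
    and "\<And>h a a'. \<lbrakk>h \<in> carrier H; a \<in> carrier A; a' \<in> carrier A\<rbrakk> \<Longrightarrow>
      \<rho> h (a \<otimes>\<^bsub>A\<^esub> a') = tensor_sum B (\<lambda>x y. \<rho> x a \<otimes>\<^bsub>B\<^esub> \<rho> y a') (comul H h)"
    and "\<And>h. h \<in> carrier H \<Longrightarrow> \<rho> h \<one>\<^bsub>A\<^esub> = counit H h \<odot>\<^bsub>B\<^esub> \<one>\<^bsub>B\<^esub>"
  shows "measures K A B H \<rho>"
  using assms by (simp add: measures_def)

lemma measuresD: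
  assumes "measures K A B H \<rho>"
  shows "\<rho> \<in> lin_maps K H (hom_module K A B)"
    and "h \<in> carrier H \<Longrightarrow> \<rho> h \<in> lin_maps K A B"
    and "a \<in> carrier A \<Longrightarrow> linear_map K H B (\<lambda>h. \<rho> h a)"
    and "\<lbrakk>h \<in> carrier H; a \<in> carrier A\<rbrakk> \<Longrightarrow> \<rho> h a \<in> carrier B"
    and "\<lbrakk>h \<in> carrier H; a \<in> carrier A; a' \<in> carrier A\<rbrakk> \<Longrightarrow>
      \<rho> h (a \<otimes>\<^bsub>A\<^esub> a') = tensor_sum B (\<lambda>x y. \<rho> x a \<otimes>\<^bsub>B\<^esub> \<rho> y a') (comul H h)"
    and "h \<in> carrier H \<Longrightarrow> \<rho> h \<one>\<^bsub>A\<^esub> = counit H h \<odot>\<^bsub>B\<^esub> \<one>\<^bsub>B\<^esub>"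
proof -
  show 1: "\<rho> \<in> lin_maps K H (hom_module K A B)" using assms by (simp add: measures_def)
  show 2: "h \<in> carrier H \<Longrightarrow> \<rho> h \<in> lin_maps K A B" for h using lin_maps_closed[OF 1] by simp
  show "a \<in> carrier A \<Longrightarrow> linear_map K H B (\<lambda>h. \<rho> h a)" using linear_hom_apply[OF lin_maps_linear[OF 1]] .
  show "\<lbrakk>h \<in> carrier H; a \<in> carrier A\<rbrakk> \<Longrightarrow> \<rho> h a \<in> carrier B" using lin_maps_closed[OF 2] .
qed (use assms in \<open>simp_all add: measures_def\<close>)

text \<open>Uses projections where \<open>hcomp\<close> of \<open>Alg_check\<close> matches on
  pairs, so that it unfolds for cells given by variables.\<close>

definition measuring_comp ::
    "('k, ('k, 'a) univ) module \<Rightarrow> ('k, ('k, 'a) univ) module \<Rightarrow> ('k, 'a) meas_cell \<Rightarrow> ('k, 'a) meas_cell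
      \<Rightarrow> ('k, 'a) meas_cell" where
  "measuring_comp A C g f = (coalg_tensor K (fst g) (fst f),
    tensor_lift K (fst g) (fst f) (hom_module K A C) (\<lambda>y h. compose (carrier A) (snd g y) (snd f h)))"

definition measuring_unit :: "('k, ('k, 'a) univ) module \<Rightarrow> ('k, 'a) meas_cell" where
  "measuring_unit A = (unit_coalgebra K,
       \<lambda>x \<in> carrier (unit_coalgebra K). \<lambda>a \<in> carrier A. scalar x \<odot>\<^bsub>A\<^esub> a)"

lemma bilinear_measuring_comp:
  assumes A: "module K A" and B: "module K B" and C: "module K C" and H: "module K H" and L: "module K L"
    and \<phi>: "\<phi> \<in> lin_maps K H (hom_module K A B)" and \<psi>: "\<psi> \<in> lin_maps K L (hom_module K B C)"
  shows "bilinear_map K L H (hom_module K A C) (\<lambda>y h. compose (carrier A) (\<psi> y) (\<phi> h))"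
proof -
  have c1: "\<phi> h \<in> lin_maps K A B" if "h \<in> carrier H" for h
    using lin_maps_closed[OF \<phi> that] by simp
  have c2: "\<psi> y \<in> lin_maps K B C" if "y \<in> carrier L" for y
    using lin_maps_closed[OF \<psi> that] by simp
  show ?thesis
  proof (rule bilinear_mapI)
    fix y assume y: "y \<in> carrier L"
    show "linear_map K H (hom_module K A C) (\<lambda>h. compose (carrier A) (\<psi> y) (\<phi> h))"
    proof (rule linear_into_hom[OF H A C])
      fix a assume a: "a \<in> carrier A"
      have "linear_map K H C (\<lambda>h. \<psi> y (\<phi> h a))"
        using lin_maps_closed[OF \<psi> y]
        by (intro linear_compose[OF linear_hom_apply[OF lin_maps_linear[OF \<phi>] a]]) simp
      then show "linear_map K H C (\<lambda>h. compose (carrier A) (\<psi> y) (\<phi> h) a)"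
        using a by (simp add: compose_eq)
    qed (erule lin_maps_compose[OF c1 c2[OF y] A])
  next
    fix h assume h: "h \<in> carrier H"
    then have hl: "\<phi> h \<in> lin_maps K A B" using lin_maps_closed[OF \<phi>] by simp
    show "linear_map K L (hom_module K A C) (\<lambda>y. compose (carrier A) (\<psi> y) (\<phi> h))"
    proof (rule linear_into_hom[OF L A C])
      fix a assume a: "a \<in> carrier A"
      then show "linear_map K L C (\<lambda>y. compose (carrier A) (\<psi> y) (\<phi> h) a)"
        using linear_hom_apply[OF lin_maps_linear[OF \<psi>] lin_maps_closed[OF hl a]] by (simp add: compose_eq)
    qed (erule lin_maps_compose[OF hl c2 A])
  qed
qed

text \<open>Linearity moves \<psi>(y) into the Sweedler sum that expresses \<phi>(h)(aa'), and the
  measuring property of \<psi> splits it over each product. The outcome is a double sum over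
  \<Delta>y and \<Delta>h, that is, a sum over \<Delta>(y \<otimes> h).\<close>

lemma measures_comp:
  assumes A: "k_algebra K A" and B: "k_algebra K B" and C: "k_algebra K C"
    and H: "coalgebra K H" and L: "coalgebra K L"
    and \<phi>: "measures K A B H \<phi>" and \<psi>: "measures K B C L \<psi>"
  defines "\<rho> \<equiv> tensor_lift K L H (hom_module K A C) (\<lambda>y h. compose (carrier A) (\<psi> y) (\<phi> h))"
  shows "\<rho> \<in> lin_maps K (tensor K L H) (hom_module K A C)"
    and "\<lbrakk>y \<in> carrier L; h \<in> carrier H\<rbrakk> \<Longrightarrow> \<rho> (pure K L H y h) = compose (carrier A) (\<psi> y) (\<phi> h)"
    and "measures K A C (coalg_tensor K L H) \<rho>"
proof -
  let ?T = "tensor K L H" and ?P = "coalg_tensor K L H"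
  note m = coalgebra_linear(1)[OF L] coalgebra_linear(1)[OF H]
  have mAC: "module K (hom_module K A C)" using A C by (intro module_hom) simp_all
  have b: "bilinear_map K L H (hom_module K A C) (\<lambda>y h. compose (carrier A) (\<psi> y) (\<phi> h))"
    using A B C m \<phi> \<psi> by (intro bilinear_measuring_comp[of A B C]) (simp_all add: measuresD(1))
  show l: "\<rho> \<in> lin_maps K ?T (hom_module K A C)"
    unfolding \<rho>_def using b m mAC by (intro tensor_lift_in_lin_maps)
  show p: "\<rho> (pure K L H y h) = compose (carrier A) (\<psi> y) (\<phi> h)" if "y \<in> carrier L" "h \<in> carrier H" for y h
    unfolding \<rho>_def using b m mAC that by (subst tensor_lift_pure) simp_all
  have ap: "linear_map K ?T C (\<lambda>t. \<rho> t a)" if "a \<in> carrier A" for a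
    using linear_hom_apply[OF lin_maps_linear[OF l] that] .
  have cl: "\<rho> t a \<in> carrier C" if "t \<in> carrier ?T" "a \<in> carrier A" for t a
    using linear_map_closed[OF ap[OF that(2)] that(1)] .
  note \<phi>c = measuresD(4)[OF \<phi>] and \<psi>c = measuresD(4)[OF \<psi>]
  note P = coalgebra_tensor[OF L H]
  show "measures K A C ?P \<rho>"
  proof (rule measuresI)
    show "\<rho> \<in> lin_maps K ?P (hom_module K A C)" using l by simp
    fix t assume "t \<in> carrier ?P"
    then have t: "t \<in> carrier ?T" by simp
    show "\<rho> t \<one>\<^bsub>A\<^esub> = counit ?P t \<odot>\<^bsub>C\<^esub> \<one>\<^bsub>C\<^esub>"
    proof (rule tensor_eqI[OF m _ ap _ _ t])
      show "linear_map K ?T C (\<lambda>t. counit ?P t \<odot>\<^bsub>C\<^esub> \<one>\<^bsub>C\<^esub>)"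
        using C by (intro linear_smult1 linear_counit_tensor L H) simp_all
      fix y h assume y: "y \<in> carrier L" and h: "h \<in> carrier H"
      interpret C: module K C using C by simp
      have "\<psi> y (counit H h \<odot>\<^bsub>B\<^esub> \<one>\<^bsub>B\<^esub>) = counit H h \<odot>\<^bsub>C\<^esub> \<psi> y \<one>\<^bsub>B\<^esub>"
        using B H h by (intro linear_map_smult[OF lin_maps_linear[OF measuresD(2)[OF \<psi> y]]]) simp_all
      then show "\<rho> (pure K L H y h) \<one>\<^bsub>A\<^esub> = counit ?P (pure K L H y h) \<odot>\<^bsub>C\<^esub> \<one>\<^bsub>C\<^esub>"
        using y h A C H L
        by (simp add: p compose_eq measuresD(6)[OF \<phi>] measuresD(6)[OF \<psi>] counit_tensor_pure
            C.smult_assoc1[symmetric] C.R.m_comm)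
    qed (use A C in simp_all)
    fix a a' assume a: "a \<in> carrier A" and a': "a' \<in> carrier A"
    show "\<rho> t (a \<otimes>\<^bsub>A\<^esub> a') = tensor_sum C (\<lambda>x y. \<rho> x a \<otimes>\<^bsub>C\<^esub> \<rho> y a') (comul ?P t)"
    proof (rule tensor_eqI[OF m _ ap _ _ t])
      have l1: "linear_map K ?T C (\<lambda>x. \<rho> x a \<otimes>\<^bsub>C\<^esub> \<rho> y a')" "linear_map K ?T C (\<lambda>x. \<rho> y a \<otimes>\<^bsub>C\<^esub> \<rho> x a')"
        if "y \<in> carrier ?T" for y
        using that a a' C by (simp_all add: linear_mult1 linear_mult2 ap cl)
      show "linear_map K ?T C (\<lambda>t. tensor_sum C (\<lambda>x y. \<rho> x a \<otimes>\<^bsub>C\<^esub> \<rho> y a') (comul ?P t))"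
        using m C by (intro linear_tensor_sum1[OF linear_comul_tensor[OF L H]]) (simp_all add: l1)
      fix y h assume y: "y \<in> carrier L" and h: "h \<in> carrier H"
      have "\<rho> (pure K L H y h) (a \<otimes>\<^bsub>A\<^esub> a') = \<psi> y (tensor_sum B (\<lambda>h1 h2. \<phi> h1 a \<otimes>\<^bsub>B\<^esub> \<phi> h2 a') (comul H h))"
        using y h a a' A by (simp add: p compose_eq measuresD(5)[OF \<phi>])
      also have "\<dots> = tensor_sum C (\<lambda>h1 h2. \<psi> y (\<phi> h1 a \<otimes>\<^bsub>B\<^esub> \<phi> h2 a')) (comul H h)"
        using B C H h a a'
        by (intro comul_sum_linear_map[OF lin_maps_linear[OF measuresD(2)[OF \<psi> y]]]) (simp_all add: \<phi>c)
      also have "\<dots> = tensor_sum C (\<lambda>h1 h2. tensor_sum C (\<lambda>y1 y2. \<psi> y1 (\<phi> h1 a) \<otimes>\<^bsub>C\<^esub> \<psi> y2 (\<phi> h2 a')) (comul L y)) (comul H h)"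
        using y a a' by (intro comul_sum_cong[OF H h] measuresD(5)[OF \<psi>]) (simp_all add: \<phi>c)
      \<comment> \<open>Expanding \<phi> before \<psi> has left the sum over H outside, while
        \<open>comul_tensor_sum\<close> has the sum over L outside.\<close>
      also have "\<dots> = tensor_sum C (\<lambda>y1 y2. tensor_sum C (\<lambda>h1 h2. \<psi> y1 (\<phi> h1 a) \<otimes>\<^bsub>C\<^esub> \<psi> y2 (\<phi> h2 a')) (comul H h)) (comul L y)"
        using C a a' by (intro comul_sum_swap[OF H h L y]) (simp_all add: \<phi>c \<psi>c)
      also have "\<dots> = tensor_sum C (\<lambda>y1 y2. tensor_sum C (\<lambda>h1 h2. \<rho> (pure K L H y1 h1) a \<otimes>\<^bsub>C\<^esub> \<rho> (pure K L H y2 h2) a') (comul H h)) (comul L y)"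
        using a a' by (intro comul_sum_cong[OF L y] comul_sum_cong[OF H h]) (simp add: p compose_eq)
      also have "\<dots> = tensor_sum C (\<lambda>x y. \<rho> x a \<otimes>\<^bsub>C\<^esub> \<rho> y a') (comul ?P (pure K L H y h))"
        using C by (intro comul_tensor_sum[OF L H _ y h, symmetric]) (simp_all add: l1)
      finally show "\<rho> (pure K L H y h) (a \<otimes>\<^bsub>A\<^esub> a') = tensor_sum C (\<lambda>x y. \<rho> x a \<otimes>\<^bsub>C\<^esub> \<rho> y a') (comul ?P (pure K L H y h))" .
    qed (use A C a a' in simp_all)
  qed
qed

text \<open>The element ce acts as c times the identity. Since \<Delta>x = x \<otimes> 1, the
  measuring condition at x = c reads c(aa') = (ca)(1a').\<close>

lemma measures_unit:
  fixes A :: "('k, ('k, 'a) univ) module"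
  assumes A: "k_algebra K A"
  defines "\<rho> \<equiv> \<lambda>x \<in> carrier (unit_coalgebra K :: ('k, ('k, 'a) univ) coalgebra). \<lambda>a \<in> carrier A. scalar x \<odot>\<^bsub>A\<^esub> a"
  shows "measures K A A (unit_coalgebra K) \<rho>"
proof -
  let ?I = "unit_algebra K :: ('k, ('k, 'a) univ) module" and ?J = "unit_coalgebra K :: ('k, ('k, 'a) univ) coalgebra"
  interpret A: k_algebra K A by fact
  have ap: "\<rho> x a = scalar x \<odot>\<^bsub>A\<^esub> a" if "x \<in> carrier ?I" "a \<in> carrier A" for x a
    using that by (auto simp: \<rho>_def)
  have lin: "linear_map K ?I A (\<lambda>x. \<rho> x a)" if "a \<in> carrier A" for a
    using linear_map_cong[OF module_unit, of "\<lambda>x. scalar x \<odot>\<^bsub>A\<^esub> a" "\<lambda>x. \<rho> x a" A] linear_smult1[OF linear_scalar, of A a] that A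
    by (simp add: ap del: carrier_unit)
  have sc: "scalar x \<in> carrier K" if "x \<in> carrier ?I" for x using that by auto
  have \<rho>: "\<rho> x \<in> lin_maps K A A" if "x \<in> carrier ?I" for x
    using linear_smult2[of A A "\<lambda>a. a" "scalar x"] sc[OF that] that A
    unfolding \<rho>_def by (auto simp: lin_maps_iff)
  have cl: "\<rho> x a \<in> carrier A" if "x \<in> carrier ?I" "a \<in> carrier A" for x a
    using lin_maps_closed[OF \<rho>[OF that(1)] that(2)] .
  show ?thesis
  proof (rule measuresI)
    show "\<rho> \<in> lin_maps K ?J (hom_module K A A)"
      using linear_into_hom[OF module_unit _ _ \<rho> lin] A
      by (simp add: lin_maps_iff del: carrier_unit) (simp add: \<rho>_def)
    fix x assume "x \<in> carrier ?J"
    then have x: "x \<in> carrier ?I" by simp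
    then show "\<rho> x \<one>\<^bsub>A\<^esub> = counit ?J x \<odot>\<^bsub>A\<^esub> \<one>\<^bsub>A\<^esub>" by (simp add: ap counit_unit del: carrier_unit)
    fix a a' assume a: "a \<in> carrier A" and a': "a' \<in> carrier A"
    have "tensor_sum A (\<lambda>x y. \<rho> x a \<otimes>\<^bsub>A\<^esub> \<rho> y a') (comul ?J x) = \<rho> x a \<otimes>\<^bsub>A\<^esub> \<rho> (Scal \<one>\<^bsub>K\<^esub>) a'"
      using x a a' A by (intro comul_unit_sum) (simp_all add: linear_mult1 linear_mult2 lin cl del: carrier_unit)
    moreover have "\<rho> (Scal \<one>\<^bsub>K\<^esub>) a' = a'" using a' by (subst ap) simp_all
    ultimately show "\<rho> x (a \<otimes>\<^bsub>A\<^esub> a') = tensor_sum A (\<lambda>x y. \<rho> x a \<otimes>\<^bsub>A\<^esub> \<rho> y a') (comul ?J x)"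
      using x a a' sc[OF x] by (simp add: ap A.smult_mult_left del: carrier_unit)
  qed
qed

section \<open>The categories of measuring coalgebras\<close>

lemma meas_cat_simps:
  "x \<in> ob (meas_cat K A B) \<longleftrightarrow> coalgebra K (fst x) \<and> measures K A B (fst x) (snd x)"
  "\<tau> \<in> mor (meas_cat K A B) x y \<longleftrightarrow>
    \<tau> \<in> coalg_homs K (fst x) (fst y) \<and> compose (carrier (fst x)) (snd y) \<tau> = snd x"
  "idn (meas_cat K A B) x = (\<lambda>h\<in>carrier (fst x). h)"
  "cmp (meas_cat K A B) x y z \<tau>' \<tau> = compose (carrier (fst x)) \<tau>' \<tau>"
  by (simp_all add: meas_cat_def case_prod_beta)

lemma meas_morD:
  assumes "\<tau> \<in> mor (meas_cat K A B) x y"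
  shows "\<tau> \<in> lin_maps K (fst x) (fst y)" and "h \<in> carrier (fst x) \<Longrightarrow> snd y (\<tau> h) = snd x h"
proof -
  show "\<tau> \<in> lin_maps K (fst x) (fst y)" using assms by (simp add: meas_cat_simps coalg_homs_lin)
  have "compose (carrier (fst x)) (snd y) \<tau> h = snd x h" using assms by (simp add: meas_cat_simps)
  then show "h \<in> carrier (fst x) \<Longrightarrow> snd y (\<tau> h) = snd x h" by (simp add: compose_eq)
qed

text \<open>Both functions in the defining equation of a morphism are extensional, the measuring of
  x because x is an object, so pointwise agreement suffices.\<close>

lemma meas_morI:
  assumes "\<tau> \<in> coalg_homs K (fst x) (fst y)" "x \<in> ob (meas_cat K A B)" "y \<in> ob (meas_cat K A B)"
    and "\<And>h. h \<in> carrier (fst x) \<Longrightarrow> snd y (\<tau> h) = snd x h"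
  shows "\<tau> \<in> mor (meas_cat K A B) x y"
proof -
  have "snd x \<in> extensional (carrier (fst x))"
    using assms(2) measuresD(1) by (auto simp: meas_cat_simps lin_maps_iff)
  then have "compose (carrier (fst x)) (snd y) \<tau> = snd x"
    by (rule extensionalityI[OF compose_extensional]) (simp add: assms(4) compose_eq)
  then show ?thesis using assms(1) by (simp add: meas_cat_simps)
qed

lemma category_meas: "category (meas_cat K A B)"
proof
  fix x assume x: "x \<in> ob (meas_cat K A B)"
  then show "idn (meas_cat K A B) x \<in> mor (meas_cat K A B) x x"
    by (intro meas_morI) (auto simp: meas_cat_simps coalg_homs_ident)
next
  fix x y z f g assume x: "x \<in> ob (meas_cat K A B)" and y: "y \<in> ob (meas_cat K A B)" and z: "z \<in> ob (meas_cat K A B)"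
    and f: "f \<in> mor (meas_cat K A B) x y" and g: "g \<in> mor (meas_cat K A B) y z"
  show "cmp (meas_cat K A B) x y z g f \<in> mor (meas_cat K A B) x z"
  proof (rule meas_morI[OF _ x z])
    show "cmp (meas_cat K A B) x y z g f \<in> coalg_homs K (fst x) (fst z)"
      using x y z f g by (auto simp: meas_cat_simps intro: coalg_homs_compose)
    fix h assume h: "h \<in> carrier (fst x)"
    then show "snd z (cmp (meas_cat K A B) x y z g f h) = snd x h"
      using meas_morD(2)[OF f h] meas_morD(2)[OF g lin_maps_closed[OF meas_morD(1)[OF f] h]]
      by (simp add: meas_cat_simps compose_eq)
  qed
next
  fix x y f assume "x \<in> ob (meas_cat K A B)" and f: "f \<in> mor (meas_cat K A B) x y"
  note l = meas_morD(1)[OF f]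
  show "cmp (meas_cat K A B) x y y (idn (meas_cat K A B) y) f = f"
    "cmp (meas_cat K A B) x x y f (idn (meas_cat K A B) x) = f"
    using l lin_maps_closed[OF l]
    by (auto simp: meas_cat_simps lin_maps_iff compose_def intro!: extensionalityI[of _ "carrier (fst x)"])
next
  fix w x y z f g h
  assume f: "f \<in> mor (meas_cat K A B) w x" and g: "g \<in> mor (meas_cat K A B) x y"
  show "cmp (meas_cat K A B) w x z (cmp (meas_cat K A B) x y z h g) f =
    cmp (meas_cat K A B) w y z h (cmp (meas_cat K A B) w x y g f)"
    using lin_maps_closed[OF meas_morD(1)[OF f]] by (auto simp: meas_cat_simps compose_def)
qed

text \<open>The linear inverse is a coalgebra map by \<open>coalg_homs_inverse\<close>, and it
  respects the measurings: evaluate the condition for \<tau> at \<tau>' h and cancel.\<close>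

lemma meas_isosI:
  assumes "x \<in> ob (meas_cat K A B)" "y \<in> ob (meas_cat K A B)" "\<tau> \<in> mor (meas_cat K A B) x y"
    and \<tau>': "\<tau>' \<in> lin_maps K (fst y) (fst x)"
    and inv: "compose (carrier (fst x)) \<tau>' \<tau> = (\<lambda>h\<in>carrier (fst x). h)"
      "compose (carrier (fst y)) \<tau> \<tau>' = (\<lambda>h\<in>carrier (fst y). h)"
  shows "\<tau> \<in> isos (meas_cat K A B) x y"
proof -
  have "\<tau>' \<in> mor (meas_cat K A B) y x"
  proof (rule meas_morI[OF _ assms(2,1)])
    show "\<tau>' \<in> coalg_homs K (fst y) (fst x)"
      using assms by (intro coalg_homs_inverse[OF _ _ _ \<tau>' inv]) (simp_all add: meas_cat_simps)
    fix h assume h: "h \<in> carrier (fst y)"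
    then show "snd x (\<tau>' h) = snd y h"
      using meas_morD(2)[OF assms(3) lin_maps_closed[OF \<tau>' h]] fun_cong[OF inv(2), of h] by (simp add: compose_eq)
  qed
  then show ?thesis
    using assms(3) inv by (auto simp: isos_def meas_cat_simps(3,4))
qed

section \<open>Horizontal composition and constraints for measuring coalgebras\<close>

lemma measuring_comp_ob:
  assumes "k_algebra K A" "k_algebra K B" "k_algebra K C" "g \<in> ob (meas_cat K B C)" "f \<in> ob (meas_cat K A B)"
  shows "measuring_comp A C g f \<in> ob (meas_cat K A C)"
  using assms by (simp add: meas_cat_simps measuring_comp_def coalgebra_tensor measures_comp(3)[of A B C])

lemma measuring_unit_ob: "k_algebra K A \<Longrightarrow> measuring_unit A \<in> ob (meas_cat K A A)"
  unfolding meas_cat_simps(1) measuring_unit_def fst_conv snd_conv by (intro conjI coalgebra_unit measures_unit)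

lemma fst_measuring [simp]:
  "fst (measuring_comp A C g f) = coalg_tensor K (fst g) (fst f)"
  "fst (measuring_unit A) = unit_coalgebra K"
  by (simp_all add: measuring_comp_def measuring_unit_def)

lemma snd_measuring_comp:
  assumes "k_algebra K A" "k_algebra K B" "k_algebra K C" "g \<in> ob (meas_cat K B C)" "f \<in> ob (meas_cat K A B)"
  shows "snd (measuring_comp A C g f) \<in> lin_maps K (tensor K (fst g) (fst f)) (hom_module K A C)"
    and "\<lbrakk>y \<in> carrier (fst g); h \<in> carrier (fst f)\<rbrakk> \<Longrightarrow>
      snd (measuring_comp A C g f) (pure K (fst g) (fst f) y h) = compose (carrier A) (snd g y) (snd f h)"
  using assms by (simp_all add: meas_cat_simps measuring_comp_def measures_comp(1,2)[of A B C])

lemma meas_obD: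
  assumes "f \<in> ob (meas_cat K A B)"
  shows "coalgebra K (fst f)" and "measures K A B (fst f) (snd f)" and "module K (fst f)"
  using assms by (simp_all add: meas_cat_simps)

text \<open>On y \<otimes> h the composite measuring of the target gives the action of \<beta> y
  after that of \<alpha> h, which the conditions on \<beta> and \<alpha> turn into the action of y
  after that of h.\<close>

lemma meas_tensor_map_mor:
  assumes alg: "k_algebra K A" "k_algebra K B" "k_algebra K C"
    and ob: "g \<in> ob (meas_cat K B C)" "f \<in> ob (meas_cat K A B)" "g' \<in> ob (meas_cat K B C)" "f' \<in> ob (meas_cat K A B)"
    and \<beta>: "\<beta> \<in> mor (meas_cat K B C) g g'" and \<alpha>: "\<alpha> \<in> mor (meas_cat K A B) f f'"
  shows "tensor_map K (fst g) (fst f) (fst g') (fst f') \<beta> \<alpha> \<in>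
    mor (meas_cat K A C) (measuring_comp A C g f) (measuring_comp A C g' f')"
proof (rule meas_morI)
  note m [simp] = ob[THEN meas_obD(3)]
  note l = meas_morD(1)[OF \<beta>] meas_morD(1)[OF \<alpha>]
  note s = snd_measuring_comp[OF alg ob(1,2)] and s' = snd_measuring_comp[OF alg ob(3,4)]
  have mh: "module K (hom_module K A C)" using alg by (simp add: module_hom)
  show "tensor_map K (fst g) (fst f) (fst g') (fst f') \<beta> \<alpha> \<in>
      coalg_homs K (fst (measuring_comp A C g f)) (fst (measuring_comp A C g' f'))"
    using ob \<alpha> \<beta> by (simp add: coalg_homs_tensor_map meas_cat_simps)
  fix t assume "t \<in> carrier (fst (measuring_comp A C g f))"
  then have t: "t \<in> carrier (tensor K (fst g) (fst f))" by simp
  have lt: "linear_map K (tensor K (fst g) (fst f)) (tensor K (fst g') (fst f'))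
      (tensor_map K (fst g) (fst f) (fst g') (fst f') \<beta> \<alpha>)"
    using l by simp
  show "snd (measuring_comp A C g' f') (tensor_map K (fst g) (fst f) (fst g') (fst f') \<beta> \<alpha> t) = snd (measuring_comp A C g f) t"
    using l
    by (intro tensor_eqI[OF m(1,2) mh linear_compose[OF lt lin_maps_linear[OF s'(1)]] lin_maps_linear[OF s(1)] _ t])
      (simp add: s(2) s'(2) lin_maps_closed[OF l(1)] lin_maps_closed[OF l(2)] meas_morD(2)[OF \<beta>] meas_morD(2)[OF \<alpha>])
qed (use measuring_comp_ob assms in blast)+

text \<open>On triple pure tensors compatibility with the measurings is associativity of the
  composition of linear maps.\<close>

lemma meas_assoc_iso:
  assumes alg: "k_algebra K A" "k_algebra K B" "k_algebra K C" "k_algebra K D"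
    and ob: "h \<in> ob (meas_cat K C D)" "g \<in> ob (meas_cat K B C)" "f \<in> ob (meas_cat K A B)"
  shows "tensor_assoc K (fst h) (fst g) (fst f) \<in> isos (meas_cat K A D)
    (measuring_comp A D (measuring_comp B D h g) f) (measuring_comp A D h (measuring_comp A C g f))"
proof -
  note m [simp] = ob[THEN meas_obD(3)]
  note hg = measuring_comp_ob[OF alg(2,3,4) ob(1,2)] and gf = measuring_comp_ob[OF alg(1,2,3) ob(2,3)]
  note hgf = measuring_comp_ob[OF alg(1,2,4) hg ob(3)] measuring_comp_ob[OF alg(1,3,4) ob(1) gf]
  note s = snd_measuring_comp[OF alg(2,3,4) ob(1,2)] snd_measuring_comp[OF alg(1,2,3) ob(2,3)]
    snd_measuring_comp[OF alg(1,2,4) hg ob(3), simplified] snd_measuring_comp[OF alg(1,3,4) ob(1) gf, simplified]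
  note la = tensor_assoc_in_lin_maps[OF m]
  show ?thesis
  proof (rule meas_isosI[OF hgf])
    show "tensor_assoc K (fst h) (fst g) (fst f) \<in> mor (meas_cat K A D)
      (measuring_comp A D (measuring_comp B D h g) f) (measuring_comp A D h (measuring_comp A C g f))"
    proof (rule meas_morI[OF _ hgf])
      show "tensor_assoc K (fst h) (fst g) (fst f) \<in> coalg_homs K (fst (measuring_comp A D (measuring_comp B D h g) f))
          (fst (measuring_comp A D h (measuring_comp A C g f)))"
        using coalg_homs_tensor_assoc[OF ob[THEN meas_obD(1)]] by simp
      fix t assume "t \<in> carrier (fst (measuring_comp A D (measuring_comp B D h g) f))"
      then have t: "t \<in> carrier (tensor K (tensor K (fst h) (fst g)) (fst f))" by simp
      have mh: "module K (hom_module K A D)" using alg by (simp add: module_hom)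
      show "snd (measuring_comp A D h (measuring_comp A C g f)) (tensor_assoc K (fst h) (fst g) (fst f) t) =
        snd (measuring_comp A D (measuring_comp B D h g) f) t"
      proof (rule tensor3l_eqI[OF m mh linear_compose[OF lin_maps_linear[OF la] lin_maps_linear[OF s(7)]] lin_maps_linear[OF s(5)] _ t])
        fix x y z assume x: "x \<in> carrier (fst h)" and y: "y \<in> carrier (fst g)" and z: "z \<in> carrier (fst f)"
        \<comment> \<open>\<open>compose\<close> restricts to a carrier, so
          \<open>compose_assoc\<close> requires the innermost map to land in carrier B.\<close>
        have "snd f z \<in> carrier A \<rightarrow> carrier B"
          using lin_maps_closed[OF measuresD(2)[OF meas_obD(2)[OF ob(3)] z]] by blast
        then show "snd (measuring_comp A D h (measuring_comp A C g f)) (tensor_assoc K (fst h) (fst g) (fst f)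
            (pure K (tensor K (fst h) (fst g)) (fst f) (pure K (fst h) (fst g) x y) z)) =
          snd (measuring_comp A D (measuring_comp B D h g) f) (pure K (tensor K (fst h) (fst g)) (fst f) (pure K (fst h) (fst g) x y) z)"
          using x y z by (simp add: s compose_assoc)
      qed
    qed
    show "tensor_assoc_inv K (fst h) (fst g) (fst f) \<in> lin_maps K (fst (measuring_comp A D h (measuring_comp A C g f)))
        (fst (measuring_comp A D (measuring_comp B D h g) f))"
      by (simp add: tensor_assoc_inv_in_lin_maps)
  qed (simp_all add: tensor_assoc_inverse)
qed

text \<open>The unit contributes multiplication by c, after \<phi>(h) in the left case and before it
  in the right case. Linearity of each \<phi>(h) and of \<phi> itself identifies both with
  \<phi>(ch).\<close>

lemma meas_unitor_iso:
  assumes alg: "k_algebra K A" "k_algebra K B" and ob: "f \<in> ob (meas_cat K A B)"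
  shows "left_unitor (fst f) \<in> isos (meas_cat K A B) (measuring_comp A B (measuring_unit B) f) f"
    and "right_unitor (fst f) \<in> isos (meas_cat K A B) (measuring_comp A B f (measuring_unit A)) f"
proof -
  let ?I = "unit_algebra K :: ('k, ('k, 'a) univ) module"
  note m [simp] = meas_obD(3)[OF ob]
  note \<phi> = meas_obD(2)[OF ob]
  note ul = measuring_comp_ob[OF alg(1,2,2) measuring_unit_ob[OF alg(2)] ob]
    and ur = measuring_comp_ob[OF alg(1,1,2) ob measuring_unit_ob[OF alg(1)]]
  note s = snd_measuring_comp[OF alg(1,2,2) measuring_unit_ob[OF alg(2)] ob, simplified fst_measuring coalg_space]
    snd_measuring_comp[OF alg(1,1,2) ob measuring_unit_ob[OF alg(1)], simplified fst_measuring coalg_space]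
  have mh: "module K (hom_module K A B)" using alg by (simp add: module_hom)
  have unit: "snd (measuring_unit X) (Scal c) = (\<lambda>a\<in>carrier X. c \<odot>\<^bsub>X\<^esub> a)" if "c \<in> carrier K" for X :: "('k, ('k, 'a) univ) module" and c
    using that by (simp add: measuring_unit_def)
  have sm: "snd f (c \<odot>\<^bsub>fst f\<^esub> h) a = c \<odot>\<^bsub>B\<^esub> snd f h a" if "c \<in> carrier K" "h \<in> carrier (fst f)" "a \<in> carrier A" for c h a
    using linear_map_smult[OF measuresD(3)[OF \<phi> that(3)] that(1,2)] .
  have ext: "snd f h \<in> extensional (carrier A)" if "h \<in> carrier (fst f)" for h
    using measuresD(2)[OF \<phi> that] by (simp add: lin_maps_iff)
  show "left_unitor (fst f) \<in> isos (meas_cat K A B) (measuring_comp A B (measuring_unit B) f) f"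
  proof (rule meas_isosI[OF ul ob])
    show "left_unitor (fst f) \<in> mor (meas_cat K A B) (measuring_comp A B (measuring_unit B) f) f"
    proof (rule meas_morI[OF _ ul ob])
      show "left_unitor (fst f) \<in> coalg_homs K (fst (measuring_comp A B (measuring_unit B) f)) (fst f)"
        using coalg_homs_unitor(1)[OF meas_obD(1)[OF ob]] by simp
      fix t assume "t \<in> carrier (fst (measuring_comp A B (measuring_unit B) f))"
      then have t: "t \<in> carrier (tensor K ?I (fst f))" by simp
      show "snd f (left_unitor (fst f) t) = snd (measuring_comp A B (measuring_unit B) f) t"
      proof (rule tensor_eqI[OF module_unit m mh linear_compose[OF linear_unitor(1)[OF m] lin_maps_linear[OF measuresD(1)[OF \<phi>]]] lin_maps_linear[OF s(1)] _ t])
        fix x h assume "x \<in> carrier ?I" and h: "h \<in> carrier (fst f)"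
        then obtain c where c: "c \<in> carrier K" "x = Scal c" by auto
        have "snd (measuring_comp A B (measuring_unit B) f) (pure K ?I (fst f) x h) =
          compose (carrier A) (\<lambda>b\<in>carrier B. c \<odot>\<^bsub>B\<^esub> b) (snd f h)"
          using s(2)[of x h] c h by (simp add: unit)
        also have "\<dots> = snd f (c \<odot>\<^bsub>fst f\<^esub> h)"
          using c(1) h by (intro extensionalityI[of _ "carrier A"]) (simp_all add: ext compose_eq sm measuresD(4)[OF \<phi>])
        finally show "snd f (left_unitor (fst f) (pure K ?I (fst f) x h)) = snd (measuring_comp A B (measuring_unit B) f) (pure K ?I (fst f) x h)"
          using c h by simp
      qed
    qed
    show "(\<lambda>v\<in>carrier (fst f). pure K ?I (fst f) (Scal \<one>\<^bsub>K\<^esub>) v) \<in> lin_maps K (fst f) (fst (measuring_comp A B (measuring_unit B) f))"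
      using left_unitor_inverse(1)[OF m] by simp
  qed (simp_all only: fst_measuring coalg_space left_unitor_inverse[OF m])
  show "right_unitor (fst f) \<in> isos (meas_cat K A B) (measuring_comp A B f (measuring_unit A)) f"
  proof (rule meas_isosI[OF ur ob])
    show "right_unitor (fst f) \<in> mor (meas_cat K A B) (measuring_comp A B f (measuring_unit A)) f"
    proof (rule meas_morI[OF _ ur ob])
      show "right_unitor (fst f) \<in> coalg_homs K (fst (measuring_comp A B f (measuring_unit A))) (fst f)"
        using coalg_homs_unitor(2)[OF meas_obD(1)[OF ob]] by simp
      fix t assume "t \<in> carrier (fst (measuring_comp A B f (measuring_unit A)))"
      then have t: "t \<in> carrier (tensor K (fst f) ?I)" by simp
      show "snd f (right_unitor (fst f) t) = snd (measuring_comp A B f (measuring_unit A)) t"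
      proof (rule tensor_eqI[OF m module_unit mh linear_compose[OF linear_unitor(2)[OF m] lin_maps_linear[OF measuresD(1)[OF \<phi>]]] lin_maps_linear[OF s(3)] _ t])
        fix x h assume "x \<in> carrier ?I" and h: "h \<in> carrier (fst f)"
        then obtain c where c: "c \<in> carrier K" "x = Scal c" by auto
        have "snd (measuring_comp A B f (measuring_unit A)) (pure K (fst f) ?I h x) =
          compose (carrier A) (snd f h) (\<lambda>a\<in>carrier A. c \<odot>\<^bsub>A\<^esub> a)"
          using s(4)[of h x] c h by (simp add: unit)
        also have "\<dots> = snd f (c \<odot>\<^bsub>fst f\<^esub> h)"
          using c(1) h alg by (intro extensionalityI[of _ "carrier A"])
            (simp_all add: ext compose_eq sm linear_map_smult[OF lin_maps_linear[OF measuresD(2)[OF \<phi> h]]])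
        finally show "snd f (right_unitor (fst f) (pure K (fst f) ?I h x)) = snd (measuring_comp A B f (measuring_unit A)) (pure K (fst f) ?I h x)"
          using c h by simp
      qed
    qed
    show "(\<lambda>v\<in>carrier (fst f). pure K (fst f) ?I v (Scal \<one>\<^bsub>K\<^esub>)) \<in> lin_maps K (fst f) (fst (measuring_comp A B f (measuring_unit A)))"
      using right_unitor_inverse(1)[OF m] by simp
  qed (simp_all only: fst_measuring coalg_space right_unitor_inverse[OF m])
qed

lemma Alg_check_simps:
  "obj (Alg_check K) = {A. k_algebra K A}"
  "hom_cat (Alg_check K) = meas_cat K"
  "one_cell (Alg_check K) A = measuring_unit A"
  "hcomp (Alg_check K) A B C (g, f) = measuring_comp A C g f"
  "hcomp2 (Alg_check K) A B C (g, f) (g', f') (\<beta>, \<alpha>) = tensor_map K (fst g) (fst f) (fst g') (fst f') \<beta> \<alpha>"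
  "associator (Alg_check K) A B C D (h, g, f) = tensor_assoc K (fst h) (fst g) (fst f)"
  "lunitor (Alg_check K) A B f = left_unitor (fst f)"
  "runitor (Alg_check K) A B f = right_unitor (fst f)"
  by (simp_all add: Alg_check_def measuring_unit_def measuring_comp_def case_prod_beta)

lemma prod_cat_simps:
  "ob (prod_cat C D) = ob C \<times> ob D"
  "mor (prod_cat C D) (x, y) (x', y') = mor C x x' \<times> mor D y y'"
  "idn (prod_cat C D) (x, y) = (idn C x, idn D y)"
  "cmp (prod_cat C D) (x, y) (x', y') (x'', y'') (g, g') (f, f') = (cmp C x x' x'' g f, cmp D y y' y'' g' f')"
  by (simp_all add: prod_cat_def)

text \<open>Functoriality, naturality, pentagon and triangle are equations between underlying maps
  and thus instances of the tensor lemmas. The measuring structure enters in the membership claims: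
  cells are closed under composition and the constraints are isomorphisms.\<close>

lemma bicategory_Alg_check: "bicategory (Alg_check K :: ('k, 'a) meas_bicategory)"
\<comment> \<open>Objects, hom categories and units can be rewritten at once; \<open>hcomp\<close>,
  \<open>hcomp2\<close> and the constraints have rules for explicit pairs or cells and are resolved
  inside the individual goals.\<close>
proof (rule bicategory.intro, unfold Alg_check_simps(1-3) mem_Collect_eq)
  fix A B :: "('k, ('k, 'a) univ) module" assume alg: "k_algebra K A" "k_algebra K B"
  show "category (meas_cat K A B)" by (rule category_meas)
next
  fix A :: "('k, ('k, 'a) univ) module" assume "k_algebra K A"
  then show "measuring_unit A \<in> ob (meas_cat K A A)" by (rule measuring_unit_ob)
next
  fix A B C :: "('k, ('k, 'a) univ) module" assume alg: "k_algebra K A" "k_algebra K B" "k_algebra K C"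
  show "is_functor (prod_cat (meas_cat K B C) (meas_cat K A B)) (meas_cat K A C)
    (hcomp (Alg_check K) A B C) (hcomp2 (Alg_check K) A B C)"
    using alg
    by (auto simp: is_functor_def prod_cat_simps Alg_check_simps meas_cat_simps(3,4) tensor_map_ident meas_obD(3)
        tensor_map_compose meas_morD(1) intro: measuring_comp_ob meas_tensor_map_mor)
next
  fix A B C D :: "('k, ('k, 'a) univ) module" assume alg: "k_algebra K A" "k_algebra K B" "k_algebra K C" "k_algebra K D"
  show "is_natural_iso
          (prod_cat (meas_cat K C D) (prod_cat (meas_cat K B C) (meas_cat K A B))) (meas_cat K A D)
          (\<lambda>(h, g, f). hcomp (Alg_check K) A B D (hcomp (Alg_check K) B C D (h, g), f))
          (\<lambda>(h, g, f) (h', g', f') (\<gamma>, \<beta>, \<alpha>).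
            hcomp2 (Alg_check K) A B D (hcomp (Alg_check K) B C D (h, g), f) (hcomp (Alg_check K) B C D (h', g'), f')
              (hcomp2 (Alg_check K) B C D (h, g) (h', g') (\<gamma>, \<beta>), \<alpha>))
          (\<lambda>(h, g, f). hcomp (Alg_check K) A C D (h, hcomp (Alg_check K) A B C (g, f)))
          (\<lambda>(h, g, f) (h', g', f') (\<gamma>, \<beta>, \<alpha>).
            hcomp2 (Alg_check K) A C D (h, hcomp (Alg_check K) A B C (g, f)) (h', hcomp (Alg_check K) A B C (g', f'))
              (\<gamma>, hcomp2 (Alg_check K) A B C (g, f) (g', f') (\<beta>, \<alpha>)))
          (associator (Alg_check K) A B C D)"
    using alg
    by (auto simp: is_natural_iso_def prod_cat_simps Alg_check_simps meas_cat_simps(4) meas_obD(3) meas_assoc_iso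
        tensor_assoc_natural meas_morD(1))
next
  fix A B :: "('k, ('k, 'a) univ) module" assume alg: "k_algebra K A" "k_algebra K B"
  show "is_natural_iso (meas_cat K A B) (meas_cat K A B)
          (\<lambda>f. hcomp (Alg_check K) A B B (measuring_unit B, f))
          (\<lambda>f f' \<alpha>. hcomp2 (Alg_check K) A B B (measuring_unit B, f) (measuring_unit B, f')
            (idn (meas_cat K B B) (measuring_unit B), \<alpha>))
          (\<lambda>f. f) (\<lambda>f f' \<alpha>. \<alpha>) (lunitor (Alg_check K) A B)"
    using alg
    by (auto simp del: carrier_unit simp: is_natural_iso_def Alg_check_simps meas_cat_simps(3,4) meas_obD(3) meas_unitor_iso
        unitor_natural meas_morD(1))
  show "is_natural_iso (meas_cat K A B) (meas_cat K A B)
          (\<lambda>f. hcomp (Alg_check K) A A B (f, measuring_unit A))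
          (\<lambda>f f' \<alpha>. hcomp2 (Alg_check K) A A B (f, measuring_unit A) (f', measuring_unit A)
            (\<alpha>, idn (meas_cat K A A) (measuring_unit A)))
          (\<lambda>f. f) (\<lambda>f f' \<alpha>. \<alpha>) (runitor (Alg_check K) A B)"
    using alg
    by (auto simp del: carrier_unit simp: is_natural_iso_def Alg_check_simps meas_cat_simps(3,4) meas_obD(3) meas_unitor_iso
        unitor_natural meas_morD(1))
qed (simp_all add: Alg_check_simps meas_cat_simps(3,4) meas_obD(3) tensor_pentagon tensor_triangle del: carrier_unit)

section \<open>Algebras\<close>

text \<open>The product is defined by a comprehension over two stored lists. As a nested
  \<open>tensor_sum\<close> it falls under the bilinear calculus, which yields its values on pure
  tensors and its linearity in either argument.\<close>

lemma mult_tensor: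
  assumes S: "k_algebra K S" and T: "k_algebra K T" and x: "x \<in> carrier (tensor K S T)" and y: "y \<in> carrier (tensor K S T)"
  shows "x \<otimes>\<^bsub>tensor K S T\<^esub> y = tensor_sum (tensor K S T) (\<lambda>v w. tensor_sum (tensor K S T)
    (\<lambda>v' w'. pure K S T (v \<otimes>\<^bsub>S\<^esub> v') (w \<otimes>\<^bsub>T\<^esub> w')) y) x"
proof -
  let ?T = "tensor K S T"
  note m = k_algebra_module[OF S] k_algebra_module[OF T]
  have mT: "module K ?T" using m by simp
  define F where "F v w = map (\<lambda>p. (v \<otimes>\<^bsub>S\<^esub> fst p, w \<otimes>\<^bsub>T\<^esub> snd p)) (formal_sum y)" for v w
  have in_carrier: "set (F v w) \<subseteq> carrier S \<times> carrier T" if "v \<in> carrier S" "w \<in> carrier T" for v w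
    using formal_sum_set[OF m y] that S T by (auto simp: F_def)
  have F: "list_sum ?T (pure K S T) (F v w) = tensor_sum ?T (\<lambda>v' w'. pure K S T (v \<otimes>\<^bsub>S\<^esub> v') (w \<otimes>\<^bsub>T\<^esub> w')) y" for v w
    unfolding F_def tensor_sum_eq
    by (rule list_sum_map[of _ _ "\<lambda>v' w'. v \<otimes>\<^bsub>S\<^esub> v'" "\<lambda>v' w'. w \<otimes>\<^bsub>T\<^esub> w'"])
  \<comment> \<open>Membership in the carriers is proved along with the equation because
    \<open>list_sum_append\<close> needs it for the tail.\<close>
  have concat: "set (concat (map (\<lambda>p. F (fst p) (snd p)) xs)) \<subseteq> carrier S \<times> carrier T \<and>
      list_sum ?T (pure K S T) (concat (map (\<lambda>p. F (fst p) (snd p)) xs)) =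
      list_sum ?T (\<lambda>v w. list_sum ?T (pure K S T) (F v w)) xs"
    if "set xs \<subseteq> carrier S \<times> carrier T" for xs
    using that
  proof (induction xs)
    case (Cons p xs)
    then have IH: "set (concat (map (\<lambda>p. F (fst p) (snd p)) xs)) \<subseteq> carrier S \<times> carrier T"
      "list_sum ?T (pure K S T) (concat (map (\<lambda>p. F (fst p) (snd p)) xs)) =
      list_sum ?T (\<lambda>v w. list_sum ?T (pure K S T) (F v w)) xs"
      by simp_all
    have p: "set (F (fst p) (snd p)) \<subseteq> carrier S \<times> carrier T"
      using Cons.prems by (intro in_carrier) (simp_all add: mem_Times_iff)
    have "list_sum ?T (pure K S T) (F (fst p) (snd p) @ concat (map (\<lambda>p. F (fst p) (snd p)) xs)) =
      list_sum ?T (pure K S T) (F (fst p) (snd p)) \<oplus>\<^bsub>?T\<^esub> list_sum ?T (pure K S T) (concat (map (\<lambda>p. F (fst p) (snd p)) xs))"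
      using p IH(1) by (intro list_sum_append[OF mT]) (auto intro!: pure_closed)
    then show ?case using IH p by simp
  qed simp
  have "x \<otimes>\<^bsub>?T\<^esub> y = tclass K S T (concat (map (\<lambda>p. F (fst p) (snd p)) (formal_sum x)))"
    unfolding F_def tensor_def by (simp add: case_prod_unfold)
  also have "\<dots> = list_sum ?T (pure K S T) (concat (map (\<lambda>p. F (fst p) (snd p)) (formal_sum x)))"
    using concat[OF formal_sum_set[OF m x]] by (intro tclass_eq_list_sum) simp
  also have "\<dots> = list_sum ?T (\<lambda>v w. list_sum ?T (pure K S T) (F v w)) (formal_sum x)"
    using concat[OF formal_sum_set[OF m x]] by simp
  finally show ?thesis by (simp only: F tensor_sum_eq[of _ _ x])
qed

context
  fixes S T :: "('k, ('k, 'a) univ) module"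
  assumes S: "k_algebra K S" and T: "k_algebra K T"
begin

interpretation S: k_algebra K S by (rule S)
interpretation T: k_algebra K T by (rule T)

lemma bilinear_tensor_mult_inner:
  assumes "v \<in> carrier S" "w \<in> carrier T"
  shows "bilinear_map K S T (tensor K S T) (\<lambda>v' w'. pure K S T (v \<otimes>\<^bsub>S\<^esub> v') (w \<otimes>\<^bsub>T\<^esub> w'))"
  using assms S T by (intro bilinear_mapI linear_pure1 linear_pure2 linear_mult2) simp_all

lemma bilinear_tensor_mult:
  assumes "y \<in> carrier (tensor K S T)"
  shows "bilinear_map K S T (tensor K S T) (\<lambda>v w. tensor_sum (tensor K S T)
    (\<lambda>v' w'. pure K S T (v \<otimes>\<^bsub>S\<^esub> v') (w \<otimes>\<^bsub>T\<^esub> w')) y)"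
  using S T
  by (intro bilinear_mapI linear_tensor_sum_param[OF _ _ assms] linear_pure1 linear_pure2 linear_mult1) simp_all

lemma tensor_mult_pure:
  assumes "v \<in> carrier S" "w \<in> carrier T" "v' \<in> carrier S" "w' \<in> carrier T"
  shows "pure K S T v w \<otimes>\<^bsub>tensor K S T\<^esub> pure K S T v' w' = pure K S T (v \<otimes>\<^bsub>S\<^esub> v') (w \<otimes>\<^bsub>T\<^esub> w')"
  using assms S T
  by (simp add: mult_tensor tensor_sum_pure[OF _ _ _ bilinear_tensor_mult] tensor_sum_pure[OF _ _ _ bilinear_tensor_mult_inner])

text \<open>In \<open>mult_tensor\<close> the left argument indexes the outer sum and the right
  argument the inner one. Linearity in the former is that of an induced map, in the latter that of a
  sum with linearly varying summands.\<close>

lemma linear_tensor_mult: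
  assumes y: "y \<in> carrier (tensor K S T)"
  shows "linear_map K (tensor K S T) (tensor K S T) (\<lambda>x. x \<otimes>\<^bsub>tensor K S T\<^esub> y)"
    and "linear_map K (tensor K S T) (tensor K S T) (\<lambda>x. y \<otimes>\<^bsub>tensor K S T\<^esub> x)"
proof -
  let ?T = "tensor K S T"
  note m = k_algebra_module[OF S] k_algebra_module[OF T]
  have mT: "module K ?T" using m by simp
  show "linear_map K ?T ?T (\<lambda>x. x \<otimes>\<^bsub>?T\<^esub> y)"
    by (rule linear_map_cong[OF mT _ linear_tensor_sum[OF m mT bilinear_tensor_mult[OF y]]])
      (simp add: mult_tensor[OF S T _ y])
  have "linear_map K ?T ?T (\<lambda>x. tensor_sum ?T (\<lambda>v w. tensor_sum ?T
    (\<lambda>v' w'. pure K S T (v \<otimes>\<^bsub>S\<^esub> v') (w \<otimes>\<^bsub>T\<^esub> w')) x) y)"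
    by (intro linear_tensor_sum_param[OF m y mT] linear_tensor_sum[OF m mT] bilinear_tensor_mult_inner)
  then show "linear_map K ?T ?T (\<lambda>x. y \<otimes>\<^bsub>?T\<^esub> x)"
    by (rule linear_map_cong[OF mT, rotated]) (simp add: mult_tensor[OF S T y])
qed

lemma one_tensor: "\<one>\<^bsub>tensor K S T\<^esub> = pure K S T \<one>\<^bsub>S\<^esub> \<one>\<^bsub>T\<^esub>"
  by (simp add: tensor_def)

text \<open>Multiplication is linear in each argument, so associativity is reduced one argument at a
  time to pure tensors, where it holds factorwise; the unit laws take one such reduction
  each.\<close>

lemma k_algebra_tensor: "k_algebra K (tensor K S T)"
proof -
  let ?T = "tensor K S T"
  note m = k_algebra_module[OF S] k_algebra_module[OF T]
  have mT: "module K ?T" using m by simp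
  interpret V: module K ?T by (rule mT)
  note l1 = linear_tensor_mult(1) and l2 = linear_tensor_mult(2)
  have cl: "x \<otimes>\<^bsub>?T\<^esub> y \<in> carrier ?T" if "x \<in> carrier ?T" "y \<in> carrier ?T" for x y
    using linear_map_closed[OF l1[OF that(2)] that(1)] .
  have one: "\<one>\<^bsub>?T\<^esub> \<in> carrier ?T" by (simp add: one_tensor)
  have assoc: "(x \<otimes>\<^bsub>?T\<^esub> y) \<otimes>\<^bsub>?T\<^esub> z = x \<otimes>\<^bsub>?T\<^esub> (y \<otimes>\<^bsub>?T\<^esub> z)"
    if x: "x \<in> carrier ?T" and y: "y \<in> carrier ?T" and z: "z \<in> carrier ?T" for x y z
  proof (rule tensor_eqI[OF m mT linear_compose[OF l1[OF y] l1[OF z]] l1[OF cl[OF y z]] _ x])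
    fix v w assume vw: "v \<in> carrier S" "w \<in> carrier T"
    then have p: "pure K S T v w \<in> carrier ?T" by simp
    show "(pure K S T v w \<otimes>\<^bsub>?T\<^esub> y) \<otimes>\<^bsub>?T\<^esub> z = pure K S T v w \<otimes>\<^bsub>?T\<^esub> (y \<otimes>\<^bsub>?T\<^esub> z)"
    proof (rule tensor_eqI[OF m mT linear_compose[OF l2[OF p] l1[OF z]] linear_compose[OF l1[OF z] l2[OF p]] _ y])
      fix v' w' assume vw': "v' \<in> carrier S" "w' \<in> carrier T"
      then have p': "pure K S T v' w' \<in> carrier ?T" by simp
      show "(pure K S T v w \<otimes>\<^bsub>?T\<^esub> pure K S T v' w') \<otimes>\<^bsub>?T\<^esub> z = pure K S T v w \<otimes>\<^bsub>?T\<^esub> (pure K S T v' w' \<otimes>\<^bsub>?T\<^esub> z)"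
        by (rule tensor_eqI[OF m mT l2[OF cl[OF p p']] linear_compose[OF l2[OF p'] l2[OF p]] _ z])
          (use vw vw' in \<open>simp add: tensor_mult_pure S.A.m_assoc T.A.m_assoc\<close>)
    qed
  qed
  have id: "\<one>\<^bsub>?T\<^esub> \<otimes>\<^bsub>?T\<^esub> x = x" "x \<otimes>\<^bsub>?T\<^esub> \<one>\<^bsub>?T\<^esub> = x" if "x \<in> carrier ?T" for x
  proof -
    show "\<one>\<^bsub>?T\<^esub> \<otimes>\<^bsub>?T\<^esub> x = x"
      by (rule tensor_eqI[OF m mT l2[OF one] linear_ident _ that]) (simp add: one_tensor tensor_mult_pure)
    show "x \<otimes>\<^bsub>?T\<^esub> \<one>\<^bsub>?T\<^esub> = x"
      by (rule tensor_eqI[OF m mT l1[OF one] linear_ident _ that]) (simp add: one_tensor tensor_mult_pure)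
  qed
  have "ring ?T"
    by (intro ringI monoidI V.M.abelian_group_axioms)
      (simp_all add: cl one assoc id linear_map_add[OF l1] linear_map_add[OF l2])
  then show ?thesis
    by (intro k_algebra.intro k_algebra_axioms.intro mT)
      (simp_all add: linear_map_smult[OF l1] linear_map_smult[OF l2])
qed

end

section \<open>Algebra homomorphisms\<close>

lemma alg_homsI:
  assumes "f \<in> lin_maps K A B" "f \<one>\<^bsub>A\<^esub> = \<one>\<^bsub>B\<^esub>"
    and "\<And>x y. \<lbrakk>x \<in> carrier A; y \<in> carrier A\<rbrakk> \<Longrightarrow> f (x \<otimes>\<^bsub>A\<^esub> y) = f x \<otimes>\<^bsub>B\<^esub> f y"
  shows "f \<in> alg_homs K A B"
  using assms by (auto simp: alg_homs_def ring_hom_def lin_maps_iff linear_map_def)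

lemma alg_homsD:
  assumes "f \<in> alg_homs K A B"
  shows "f \<in> lin_maps K A B" and "f \<one>\<^bsub>A\<^esub> = \<one>\<^bsub>B\<^esub>"
    and "\<lbrakk>x \<in> carrier A; y \<in> carrier A\<rbrakk> \<Longrightarrow> f (x \<otimes>\<^bsub>A\<^esub> y) = f x \<otimes>\<^bsub>B\<^esub> f y"
    and "x \<in> carrier A \<Longrightarrow> f x \<in> carrier B"
  using assms by (auto simp: alg_homs_def ring_hom_def)

lemma alg_homs_ident: "k_algebra K A \<Longrightarrow> (\<lambda>x\<in>carrier A. x) \<in> alg_homs K A A"
  by (rule alg_homsI) simp_all

lemma alg_homs_compose:
  assumes "k_algebra K A" "f \<in> alg_homs K A B" "g \<in> alg_homs K B C"
  shows "compose (carrier A) g f \<in> alg_homs K A C"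
  using assms alg_homsD[OF assms(2)] alg_homsD[OF assms(3)]
  by (intro alg_homsI lin_maps_compose) (simp_all add: compose_eq)

text \<open>The element g(x)g(y) is fixed by g \<circ> f, and f sends it to xy; hence g(xy) =
  g(x)g(y).\<close>

lemma alg_homs_inverse:
  assumes "k_algebra K A" "k_algebra K B" "f \<in> alg_homs K A B" "g \<in> lin_maps K B A"
    and inv: "compose (carrier A) g f = (\<lambda>x\<in>carrier A. x)" "compose (carrier B) f g = (\<lambda>x\<in>carrier B. x)"
  shows "g \<in> alg_homs K B A"
proof (rule alg_homsI[OF assms(4)])
  note f = alg_homsD[OF assms(3)]
  have gf: "g (f x) = x" if "x \<in> carrier A" for x
    using fun_cong[OF inv(1), of x] that by (simp add: compose_eq)
  have fg: "f (g x) = x" if "x \<in> carrier B" for x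
    using fun_cong[OF inv(2), of x] that by (simp add: compose_eq)
  have g: "g x \<in> carrier A" if "x \<in> carrier B" for x using lin_maps_closed[OF assms(4) that] .
  show "g \<one>\<^bsub>B\<^esub> = \<one>\<^bsub>A\<^esub>" using gf[of "\<one>\<^bsub>A\<^esub>"] f(2) assms(1) by simp
  fix x y assume xy: "x \<in> carrier B" "y \<in> carrier B"
  then show "g (x \<otimes>\<^bsub>B\<^esub> y) = g x \<otimes>\<^bsub>A\<^esub> g y"
    using gf[of "g x \<otimes>\<^bsub>A\<^esub> g y"] assms(1) by (simp add: f(3) g fg)
qed

text \<open>f(xy) and f(x)f(y) are linear in x and in y separately, so multiplicativity is checked
  for pure x and then for pure y.\<close>

lemma alg_homs_tensorI:
  fixes S T E :: "('k, ('k, 'a) univ) module"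
  assumes S: "k_algebra K S" and T: "k_algebra K T" and E: "k_algebra K E"
    and f: "f \<in> lin_maps K (tensor K S T) E" and one: "f (pure K S T \<one>\<^bsub>S\<^esub> \<one>\<^bsub>T\<^esub>) = \<one>\<^bsub>E\<^esub>"
    and mult: "\<And>s t s' t'. \<lbrakk>s \<in> carrier S; t \<in> carrier T; s' \<in> carrier S; t' \<in> carrier T\<rbrakk> \<Longrightarrow>
      f (pure K S T (s \<otimes>\<^bsub>S\<^esub> s') (t \<otimes>\<^bsub>T\<^esub> t')) = f (pure K S T s t) \<otimes>\<^bsub>E\<^esub> f (pure K S T s' t')"
  shows "f \<in> alg_homs K (tensor K S T) E"
proof (rule alg_homsI[OF f])
  let ?T = "tensor K S T"
  note m = k_algebra_module[OF S] k_algebra_module[OF T] k_algebra_module[OF E]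
  note l = lin_maps_linear[OF f] and cl = lin_maps_closed[OF f]
  note l1 = linear_tensor_mult(1)[OF S T] and l2 = linear_tensor_mult(2)[OF S T]
  show "f \<one>\<^bsub>?T\<^esub> = \<one>\<^bsub>E\<^esub>" by (simp add: one_tensor[OF S T] one)
  fix x y assume x: "x \<in> carrier ?T" and y: "y \<in> carrier ?T"
  show "f (x \<otimes>\<^bsub>?T\<^esub> y) = f x \<otimes>\<^bsub>E\<^esub> f y"
  proof (rule tensor_eqI[OF m linear_compose[OF l1[OF y] l] linear_mult1[OF l E cl[OF y]] _ x])
    fix s t assume st: "s \<in> carrier S" "t \<in> carrier T"
    then have p: "pure K S T s t \<in> carrier ?T" by simp
    show "f (pure K S T s t \<otimes>\<^bsub>?T\<^esub> y) = f (pure K S T s t) \<otimes>\<^bsub>E\<^esub> f y"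
      by (rule tensor_eqI[OF m linear_compose[OF l2[OF p] l] linear_mult2[OF l E cl[OF p]] _ y])
        (simp add: st tensor_mult_pure[OF S T] mult)
  qed
qed

lemma alg_homs_tensor_map:
  fixes S T S' T' :: "('k, ('k, 'a) univ) module"
  assumes "k_algebra K S" "k_algebra K T" "k_algebra K S'" "k_algebra K T'"
    and "f \<in> alg_homs K S S'" "g \<in> alg_homs K T T'"
  shows "tensor_map K S T S' T' f g \<in> alg_homs K (tensor K S T) (tensor K S' T')"
  using assms alg_homsD[OF assms(5)] alg_homsD[OF assms(6)]
  by (intro alg_homs_tensorI k_algebra_tensor tensor_map_in_lin_maps)
    (simp_all add: one_tensor tensor_mult_pure)

text \<open>The criterion \<open>alg_homs_tensorI\<close> resolves the outer product only: p and p'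
  are still arbitrary elements of T \<otimes> U, and each is reduced to a pure tensor by a further
  use of \<open>tensor_eqI\<close>.\<close>

lemma alg_homs_tensor_assoc_inv:
  fixes S T U :: "('k, ('k, 'a) univ) module"
  assumes S: "k_algebra K S" and T: "k_algebra K T" and U: "k_algebra K U"
  shows "tensor_assoc_inv K S T U \<in> alg_homs K (tensor K S (tensor K T U)) (tensor K (tensor K S T) U)"
proof (rule alg_homs_tensorI[OF S k_algebra_tensor[OF T U] k_algebra_tensor[OF k_algebra_tensor[OF S T] U]])
  let ?a = "tensor_assoc_inv K S T U" and ?TU = "tensor K T U" and ?ST = "tensor K S T"
  let ?E = "tensor K ?ST U"
  note m [simp] = k_algebra_module[OF S] k_algebra_module[OF T] k_algebra_module[OF U]
  note ST = k_algebra_tensor[OF S T] and TU = k_algebra_tensor[OF T U]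
  note E = k_algebra_tensor[OF ST U]
  show l: "?a \<in> lin_maps K (tensor K S ?TU) ?E" by (simp add: tensor_assoc_inv_in_lin_maps)
  show "?a (pure K S ?TU \<one>\<^bsub>S\<^esub> \<one>\<^bsub>?TU\<^esub>) = \<one>\<^bsub>?E\<^esub>"
    using S T U by (simp add: one_tensor[OF T U] one_tensor[OF ST U] one_tensor[OF S T])
  fix s p s' p' assume s: "s \<in> carrier S" "s' \<in> carrier S" and p: "p \<in> carrier ?TU" and p': "p' \<in> carrier ?TU"
  have la: "linear_map K ?TU ?E (\<lambda>p. ?a (pure K S ?TU v p))" if "v \<in> carrier S" for v
    using that by (intro linear_map_pure_right[OF lin_maps_linear[OF l]]) simp_all
  have cl: "?a (pure K S ?TU v p) \<in> carrier ?E" if "v \<in> carrier S" "p \<in> carrier ?TU" for v p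
    using linear_map_closed[OF la[OF that(1)] that(2)] .
  have ss: "s \<otimes>\<^bsub>S\<^esub> s' \<in> carrier S" using s S by simp
  show "?a (pure K S ?TU (s \<otimes>\<^bsub>S\<^esub> s') (p \<otimes>\<^bsub>?TU\<^esub> p')) = ?a (pure K S ?TU s p) \<otimes>\<^bsub>?E\<^esub> ?a (pure K S ?TU s' p')"
  proof (rule tensor_eqI[OF m(2,3) k_algebra_module[OF E] linear_compose[OF linear_tensor_mult(1)[OF T U p'] la[OF ss]]
      linear_mult1[OF la[OF s(1)] E cl[OF s(2) p']] _ p])
    fix t u assume tu: "t \<in> carrier T" "u \<in> carrier U"
    then have q: "pure K T U t u \<in> carrier ?TU" by simp
    show "?a (pure K S ?TU (s \<otimes>\<^bsub>S\<^esub> s') (pure K T U t u \<otimes>\<^bsub>?TU\<^esub> p')) = ?a (pure K S ?TU s (pure K T U t u)) \<otimes>\<^bsub>?E\<^esub> ?a (pure K S ?TU s' p')"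
      by (rule tensor_eqI[OF m(2,3) k_algebra_module[OF E] linear_compose[OF linear_tensor_mult(2)[OF T U q] la[OF ss]]
        linear_mult2[OF la[OF s(2)] E cl[OF s(1) q]] _ p'])
        (use s tu S T U in \<open>simp add: tensor_mult_pure[OF T U] tensor_mult_pure[OF ST U] tensor_mult_pure[OF S T]\<close>)
  qed
qed

lemma alg_homs_unitor:
  fixes S :: "('k, ('k, 'a) univ) module"
  assumes S: "k_algebra K S"
  shows "left_unitor S \<in> alg_homs K (tensor K (unit_algebra K) S) S"
    and "right_unitor S \<in> alg_homs K (tensor K S (unit_algebra K)) S"
proof -
  interpret S: k_algebra K S by (rule S)
  \<comment> \<open>Multiplicativity of the unitors on pure tensors; it rests on scalars passing
    through products and on commutativity of K.\<close>
  have mult: "(a \<otimes>\<^bsub>K\<^esub> b) \<odot>\<^bsub>S\<^esub> (x \<otimes>\<^bsub>S\<^esub> y) = (a \<odot>\<^bsub>S\<^esub> x) \<otimes>\<^bsub>S\<^esub> (b \<odot>\<^bsub>S\<^esub> y)"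
    if "a \<in> carrier K" "b \<in> carrier K" "x \<in> carrier S" "y \<in> carrier S" for a b x y
    using that by (simp add: S.smult_mult_left S.smult_mult_right S.smult_assoc1[symmetric] S.R.m_comm)
  show "left_unitor S \<in> alg_homs K (tensor K (unit_algebra K) S) S"
    using S by (intro alg_homs_tensorI k_algebra_unit) (auto simp: mult)
  show "right_unitor S \<in> alg_homs K (tensor K S (unit_algebra K)) S"
    using S by (intro alg_homs_tensorI k_algebra_unit) (auto simp: mult)
qed

text \<open>Allows \<open>id\<close>, which occurs in the definition of extensions, to be exchanged
  for the restricted identity, which is a member of \<open>lin_maps\<close>.\<close>

lemma tensor_map_cong:
  assumes "module K V" "module K W" "\<And>v. v \<in> carrier V \<Longrightarrow> f v = f' v" "\<And>w. w \<in> carrier W \<Longrightarrow> g w = g' w"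
  shows "tensor_map K V W V' W' f g = tensor_map K V W V' W' f' g'"
  unfolding tensor_map_def tensor_lift_def
  by (intro restrict_ext tensor_sum_cong[OF assms(1,2)]) (simp_all add: assms(3,4))

lemma tensor_map_map:
  assumes "module K V" "module K W" "module K V'" "module K W'" "module K V''" "module K W''"
    and f: "linear_map K V V' f" "linear_map K V' V'' f'"
    and g: "linear_map K W W' g" "linear_map K W' W'' g'"
    and x: "x \<in> carrier (tensor K V W)"
  shows "tensor_map K V' W' V'' W'' f' g' (tensor_map K V W V' W' f g x) =
    tensor_map K V W V'' W'' (\<lambda>v. f' (f v)) (\<lambda>w. g' (g w)) x"
proof -
  note l = linear_compose[OF f] linear_compose[OF g]
  show ?thesis
    by (rule tensor_eqI[OF assms(1,2) module_tensor[OF assms(5,6)]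
        linear_compose[OF linear_tensor_map[OF f(1) g(1)] linear_tensor_map[OF f(2) g(2)]] linear_tensor_map[OF l] _ x])
      (use assms l in \<open>simp_all add: linear_map_closed[OF f(1)] linear_map_closed[OF g(1)]\<close>)
qed

lemma tensor_map_ident_apply:
  assumes "module K V" "module K W" "x \<in> carrier (tensor K V W)"
    and "\<And>v. v \<in> carrier V \<Longrightarrow> f v = v" "\<And>w. w \<in> carrier W \<Longrightarrow> g w = w"
  shows "tensor_map K V W V W f g x = x"
proof -
  have "tensor_map K V W V W f g = tensor_map K V W V W (\<lambda>v\<in>carrier V. v) (\<lambda>w\<in>carrier W. w)"
    using assms by (intro tensor_map_cong) simp_all
  then show ?thesis using assms by (simp add: tensor_map_ident)
qed

section \<open>Extensions\<close>

text \<open>As with \<open>measuring_comp\<close>, projections replace patterns. The middle algebra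
  B is an argument because \<open>tensor_map\<close> records its source.\<close>

definition extension_comp ::
    "('k, ('k, 'a) univ) module \<Rightarrow> ('k, ('k, 'a) univ) module \<Rightarrow> ('k, ('k, 'a) univ) module
      \<Rightarrow> ('k, 'a) ext_cell \<Rightarrow> ('k, 'a) ext_cell \<Rightarrow> ('k, 'a) ext_cell" where
  "extension_comp A B C g f = (tensor K (fst f) (fst g),
       compose (carrier A) (tensor_assoc_inv K (fst f) (fst g) C)
         (compose (carrier A) (tensor_map K (fst f) B (fst f) (tensor K (fst g) C) id (snd g)) (snd f)))"

definition extension_unit :: "('k, ('k, 'a) univ) module \<Rightarrow> ('k, 'a) ext_cell" where
  "extension_unit A = (unit_algebra K, \<lambda>a \<in> carrier A. pure K (unit_algebra K) A (Scal \<one>\<^bsub>K\<^esub>) a)"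

section \<open>The categories of extensions\<close>

lemma ext_cat_simps:
  "x \<in> ob (ext_cat K A B) \<longleftrightarrow> k_algebra K (fst x) \<and> snd x \<in> alg_homs K A (tensor K (fst x) B)"
  "\<theta> \<in> mor (ext_cat K A B) x y \<longleftrightarrow> \<theta> \<in> alg_homs K (fst x) (fst y) \<and>
    compose (carrier A) (tensor_map K (fst x) B (fst y) B \<theta> id) (snd x) = snd y"
  "idn (ext_cat K A B) x = (\<lambda>s\<in>carrier (fst x). s)"
  "cmp (ext_cat K A B) x y z \<theta>' \<theta> = compose (carrier (fst x)) \<theta>' \<theta>"
  by (simp_all add: ext_cat_def case_prod_beta)

lemma ext_obD:
  assumes "x \<in> ob (ext_cat K A B)"
  shows "k_algebra K (fst x)" and "module K (fst x)" and "snd x \<in> alg_homs K A (tensor K (fst x) B)"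
    and "snd x \<in> lin_maps K A (tensor K (fst x) B)"
    and "a \<in> carrier A \<Longrightarrow> snd x a \<in> carrier (tensor K (fst x) B)"
  using assms alg_homsD[of "snd x" A "tensor K (fst x) B"] by (simp_all add: ext_cat_simps)

lemma ext_morD:
  assumes "\<theta> \<in> mor (ext_cat K A B) x y"
  shows "\<theta> \<in> alg_homs K (fst x) (fst y)" and "\<theta> \<in> lin_maps K (fst x) (fst y)"
    and "s \<in> carrier (fst x) \<Longrightarrow> \<theta> s \<in> carrier (fst y)"
    and "a \<in> carrier A \<Longrightarrow> tensor_map K (fst x) B (fst y) B \<theta> id (snd x a) = snd y a"
proof -
  show 1: "\<theta> \<in> alg_homs K (fst x) (fst y)" using assms by (simp add: ext_cat_simps)
  show "\<theta> \<in> lin_maps K (fst x) (fst y)" "s \<in> carrier (fst x) \<Longrightarrow> \<theta> s \<in> carrier (fst y)"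
    using alg_homsD[OF 1] by simp_all
  have "compose (carrier A) (tensor_map K (fst x) B (fst y) B \<theta> id) (snd x) a = snd y a"
    using assms by (simp add: ext_cat_simps)
  then show "a \<in> carrier A \<Longrightarrow> tensor_map K (fst x) B (fst y) B \<theta> id (snd x a) = snd y a"
    by (simp add: compose_eq)
qed

lemma ext_morI:
  assumes "\<theta> \<in> alg_homs K (fst x) (fst y)" "y \<in> ob (ext_cat K A B)"
    and "\<And>a. a \<in> carrier A \<Longrightarrow> tensor_map K (fst x) B (fst y) B \<theta> id (snd x a) = snd y a"
  shows "\<theta> \<in> mor (ext_cat K A B) x y"
proof -
  have "snd y \<in> extensional (carrier A)"
    using ext_obD(4)[OF assms(2)] by (simp add: lin_maps_iff)
  then have "compose (carrier A) (tensor_map K (fst x) B (fst y) B \<theta> id) (snd x) = snd y"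
    by (rule extensionalityI[OF compose_extensional]) (simp add: assms(3) compose_eq)
  then show ?thesis using assms(1) by (simp add: ext_cat_simps)
qed

lemma category_ext:
  assumes B: "k_algebra K B"
  shows "category (ext_cat K A B)"
proof
  fix x assume x: "x \<in> ob (ext_cat K A B)"
  show "idn (ext_cat K A B) x \<in> mor (ext_cat K A B) x x"
  proof (rule ext_morI[OF _ x])
    show "idn (ext_cat K A B) x \<in> alg_homs K (fst x) (fst x)"
      using ext_obD(1)[OF x] by (simp add: ext_cat_simps alg_homs_ident)
    fix a assume "a \<in> carrier A"
    then show "tensor_map K (fst x) B (fst x) B (idn (ext_cat K A B) x) id (snd x a) = snd x a"
      using B by (intro tensor_map_ident_apply ext_obD(2,5)[OF x]) (simp_all add: ext_cat_simps)
  qed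
next
  fix x y z f g assume x: "x \<in> ob (ext_cat K A B)" and y: "y \<in> ob (ext_cat K A B)" and z: "z \<in> ob (ext_cat K A B)"
    and f: "f \<in> mor (ext_cat K A B) x y" and g: "g \<in> mor (ext_cat K A B) y z"
  note m [simp] = ext_obD(2)[OF x] ext_obD(2)[OF y] ext_obD(2)[OF z] k_algebra_module[OF B]
  show "cmp (ext_cat K A B) x y z g f \<in> mor (ext_cat K A B) x z"
  proof (rule ext_morI[OF _ z])
    show "cmp (ext_cat K A B) x y z g f \<in> alg_homs K (fst x) (fst z)"
      using alg_homs_compose[OF ext_obD(1)[OF x] ext_morD(1)[OF f] ext_morD(1)[OF g]] by (simp add: ext_cat_simps)
    fix a assume a: "a \<in> carrier A"
    have "tensor_map K (fst x) B (fst z) B (cmp (ext_cat K A B) x y z g f) id (snd x a) =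
      tensor_map K (fst x) B (fst z) B (\<lambda>s. g (f s)) (\<lambda>b. id (id b)) (snd x a)"
      by (intro fun_cong[OF tensor_map_cong]) (simp_all add: ext_cat_simps compose_eq)
    also have "\<dots> = tensor_map K (fst y) B (fst z) B g id (tensor_map K (fst x) B (fst y) B f id (snd x a))"
      by (intro tensor_map_map[symmetric]) (simp_all add: ext_morD(2)[OF f] ext_morD(2)[OF g] ext_obD(5)[OF x a])
    finally show "tensor_map K (fst x) B (fst z) B (cmp (ext_cat K A B) x y z g f) id (snd x a) = snd z a"
      by (simp add: ext_morD(4)[OF f a] ext_morD(4)[OF g a])
  qed
next
  fix x y f assume "x \<in> ob (ext_cat K A B)" and f: "f \<in> mor (ext_cat K A B) x y"
  note l = ext_morD(2)[OF f]
  show "cmp (ext_cat K A B) x y y (idn (ext_cat K A B) y) f = f"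
    "cmp (ext_cat K A B) x x y f (idn (ext_cat K A B) x) = f"
    using l lin_maps_closed[OF l]
    by (auto simp: ext_cat_simps lin_maps_iff compose_def intro!: extensionalityI[of _ "carrier (fst x)"])
next
  fix w x y z f g h
  assume f: "f \<in> mor (ext_cat K A B) w x" and g: "g \<in> mor (ext_cat K A B) x y"
  show "cmp (ext_cat K A B) w x z (cmp (ext_cat K A B) x y z h g) f =
    cmp (ext_cat K A B) w y z h (cmp (ext_cat K A B) w x y g f)"
    using ext_morD(3)[OF f] by (auto simp: ext_cat_simps compose_def)
qed

text \<open>The linear inverse is an algebra map by \<open>alg_homs_inverse\<close>. Applying
  \<theta>' \<otimes> 1 to the condition on \<theta> and composing the two tensor maps gives the
  condition on \<theta>'.\<close>

lemma ext_isosI: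
  assumes A: "k_algebra K A" and B: "k_algebra K B"
    and x: "x \<in> ob (ext_cat K A B)" and y: "y \<in> ob (ext_cat K A B)" and \<theta>: "\<theta> \<in> mor (ext_cat K A B) x y"
    and \<theta>': "\<theta>' \<in> lin_maps K (fst y) (fst x)"
    and inv: "compose (carrier (fst x)) \<theta>' \<theta> = (\<lambda>s\<in>carrier (fst x). s)"
      "compose (carrier (fst y)) \<theta> \<theta>' = (\<lambda>s\<in>carrier (fst y). s)"
  shows "\<theta> \<in> isos (ext_cat K A B) x y"
proof -
  note m [simp] = ext_obD(2)[OF x] ext_obD(2)[OF y] k_algebra_module[OF B]
  have "\<theta>' \<in> mor (ext_cat K A B) y x"
  proof (rule ext_morI[OF _ x])
    show "\<theta>' \<in> alg_homs K (fst y) (fst x)"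
      by (rule alg_homs_inverse[OF ext_obD(1)[OF x] ext_obD(1)[OF y] ext_morD(1)[OF \<theta>] \<theta>' inv])
    fix a assume a: "a \<in> carrier A"
    have "tensor_map K (fst y) B (fst x) B \<theta>' id (snd y a) =
      tensor_map K (fst y) B (fst x) B \<theta>' id (tensor_map K (fst x) B (fst y) B \<theta> id (snd x a))"
      by (simp add: ext_morD(4)[OF \<theta> a])
    also have "\<dots> = tensor_map K (fst x) B (fst x) B (\<lambda>s. \<theta>' (\<theta> s)) (\<lambda>b. id (id b)) (snd x a)"
      by (intro tensor_map_map) (simp_all add: ext_morD(2)[OF \<theta>] \<theta>' ext_obD(5)[OF x a])
    also have "\<dots> = snd x a"
    proof (rule tensor_map_ident_apply[OF m(1,3) ext_obD(5)[OF x a]])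
      show "\<theta>' (\<theta> s) = s" if "s \<in> carrier (fst x)" for s
        using fun_cong[OF inv(1), of s] that by (simp add: compose_eq)
    qed simp
    finally show "tensor_map K (fst y) B (fst x) B \<theta>' id (snd y a) = snd x a" .
  qed
  then show ?thesis
    using \<theta> inv by (auto simp: isos_def ext_cat_simps(3,4))
qed

section \<open>Horizontal composition and constraints for extensions\<close>

lemma extension_comp_simps:
  "fst (extension_comp A B C g f) = tensor K (fst f) (fst g)"
  "a \<in> carrier A \<Longrightarrow> snd (extension_comp A B C g f) a = tensor_assoc_inv K (fst f) (fst g) C
    (tensor_map K (fst f) B (fst f) (tensor K (fst g) C) id (snd g) (snd f a))"
  by (simp_all add: extension_comp_def compose_eq)

lemma extension_comp_ob:
  assumes A: "k_algebra K A" and B: "k_algebra K B" and C: "k_algebra K C"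
    and g: "g \<in> ob (ext_cat K B C)" and f: "f \<in> ob (ext_cat K A B)"
  shows "extension_comp A B C g f \<in> ob (ext_cat K A C)"
proof -
  note S = ext_obD(1)[OF f] and T = ext_obD(1)[OF g]
  \<comment> \<open>\<open>alg_homs_tensor_map\<close> asks for extensional homomorphisms, so
    \<open>id\<close> is replaced by the restricted identity.\<close>
  have "tensor_map K (fst f) B (fst f) (tensor K (fst g) C) id (snd g) =
    tensor_map K (fst f) B (fst f) (tensor K (fst g) C) (\<lambda>s\<in>carrier (fst f). s) (snd g)"
    using S B by (intro tensor_map_cong) simp_all
  moreover have "tensor_map K (fst f) B (fst f) (tensor K (fst g) C) (\<lambda>s\<in>carrier (fst f). s) (snd g) \<in>
    alg_homs K (tensor K (fst f) B) (tensor K (fst f) (tensor K (fst g) C))"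
    by (intro alg_homs_tensor_map S B k_algebra_tensor T C alg_homs_ident ext_obD(3)[OF g])
  ultimately have "compose (carrier A) (tensor_assoc_inv K (fst f) (fst g) C)
         (compose (carrier A) (tensor_map K (fst f) B (fst f) (tensor K (fst g) C) id (snd g)) (snd f))
       \<in> alg_homs K A (tensor K (tensor K (fst f) (fst g)) C)"
    by (simp only:) (intro alg_homs_compose[OF A _ alg_homs_tensor_assoc_inv[OF S T C]] alg_homs_compose[OF A ext_obD(3)[OF f]])
  then show ?thesis
    using k_algebra_tensor[OF S T] by (simp add: ext_cat_simps extension_comp_def)
qed

lemma extension_unit_ob:
  fixes A :: "('k, ('k, 'a) univ) module"
  assumes A: "k_algebra K A"
  shows "extension_unit A \<in> ob (ext_cat K A A)"
proof -
  let ?I = "unit_algebra K :: ('k, ('k, 'a) univ) module"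
  have "(\<lambda>a \<in> carrier A. pure K ?I A (Scal \<one>\<^bsub>K\<^esub>) a) \<in> alg_homs K A (tensor K ?I A)"
    using A left_unitor_inverse(1)[of A]
    by (intro alg_homsI) (simp_all add: one_tensor[OF k_algebra_unit A] tensor_mult_pure[OF k_algebra_unit A])
  then show ?thesis by (simp add: ext_cat_simps extension_unit_def k_algebra_unit)
qed

text \<open>Forms with a linear map already inside, so that \<open>intro\<close> removes the
  outermost map of a nested application.\<close>

lemmas linear_tensor_map_compose = linear_compose[OF _ linear_tensor_map]
  and linear_assoc_inv_compose = linear_compose[OF _ linear_tensor_assoc(2)]

text \<open>There are two layers of elements that need not be pure: \<sigma>(a) in S \<otimes> B
  and, once this is reduced to s \<otimes> b, the value \<tau>(b) in T \<otimes> C. Each is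
  generalised to a variable and tested on pure tensors.\<close>

lemma ext_tensor_map_mor:
  assumes A: "k_algebra K A" and B: "k_algebra K B" and C: "k_algebra K C"
    and ob: "g \<in> ob (ext_cat K B C)" "f \<in> ob (ext_cat K A B)" "g' \<in> ob (ext_cat K B C)" "f' \<in> ob (ext_cat K A B)"
    and \<beta>: "\<beta> \<in> mor (ext_cat K B C) g g'" and \<alpha>: "\<alpha> \<in> mor (ext_cat K A B) f f'"
  shows "tensor_map K (fst f) (fst g) (fst f') (fst g') \<alpha> \<beta> \<in>
    mor (ext_cat K A C) (extension_comp A B C g f) (extension_comp A B C g' f')"
proof (rule ext_morI)
  note m [simp] = ob[THEN ext_obD(2)] A[THEN k_algebra_module] B[THEN k_algebra_module] C[THEN k_algebra_module]
  note l [simp] = lin_maps_linear[OF ext_morD(2)[OF \<beta>]] lin_maps_linear[OF ext_morD(2)[OF \<alpha>]]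
    lin_maps_linear[OF ext_obD(4)[OF ob(1)]] lin_maps_linear[OF ext_obD(4)[OF ob(3)]]
  note cl [simp] = ext_morD(3)[OF \<alpha>] ext_morD(3)[OF \<beta>] ext_obD(5)[OF ob(1)] ext_obD(5)[OF ob(3)]
  show "tensor_map K (fst f) (fst g) (fst f') (fst g') \<alpha> \<beta> \<in>
    alg_homs K (fst (extension_comp A B C g f)) (fst (extension_comp A B C g' f'))"
    unfolding extension_comp_simps
    by (intro alg_homs_tensor_map ob[THEN ext_obD(1)] ext_morD(1)[OF \<alpha>] ext_morD(1)[OF \<beta>])
  show "extension_comp A B C g' f' \<in> ob (ext_cat K A C)"
    by (rule extension_comp_ob[OF A B C ob(3,4)])
  fix a assume a: "a \<in> carrier A"
  let ?\<alpha>\<beta> = "tensor_map K (fst f) (fst g) (fst f') (fst g') \<alpha> \<beta>"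
  let ?L = "\<lambda>w. tensor_map K (tensor K (fst f) (fst g)) C (tensor K (fst f') (fst g')) C ?\<alpha>\<beta> id (tensor_assoc_inv K (fst f) (fst g) C w)"
  let ?\<tau> = "\<lambda>h u. tensor_map K (fst u) B (fst u) (tensor K (fst h) C) id (snd h)"
  let ?M = "tensor K (tensor K (fst f') (fst g')) C"
  \<comment> \<open>Stated with \<alpha> \<otimes> 1 still applied to \<sigma>(a), so that both
    sides are linear in \<sigma>(a); the morphism condition on \<alpha> is used at the very
    end.\<close>
  have "?L (?\<tau> g f (snd f a)) = tensor_assoc_inv K (fst f') (fst g') C (?\<tau> g' f' (tensor_map K (fst f) B (fst f') B \<alpha> id (snd f a)))"
  proof (rule tensor_eqI[OF m(2,6) _ _ _ _ ext_obD(5)[OF ob(2) a], where M = ?M])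
    show "linear_map K (tensor K (fst f) B) ?M (\<lambda>z. ?L (?\<tau> g f z))"
      by (intro linear_tensor_map_compose linear_assoc_inv_compose linear_tensor_map) simp_all
    show "linear_map K (tensor K (fst f) B) ?M (\<lambda>z. tensor_assoc_inv K (fst f') (fst g') C (?\<tau> g' f' (tensor_map K (fst f) B (fst f') B \<alpha> id z)))"
      by (intro linear_tensor_map_compose linear_assoc_inv_compose linear_tensor_map) simp_all
    fix s b assume s: "s \<in> carrier (fst f)" and b: "b \<in> carrier B"
    \<comment> \<open>The second layer, linear in \<tau>(b). The condition on \<beta> at b converts
      the right side into the shape of the outer goal.\<close>
    have "?L (pure K (fst f) (tensor K (fst g) C) s (snd g b)) =
      tensor_assoc_inv K (fst f') (fst g') C (pure K (fst f') (tensor K (fst g') C) (\<alpha> s) (tensor_map K (fst g) C (fst g') C \<beta> id (snd g b)))"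
    proof (rule tensor_eqI[OF m(1,7) _ _ _ _ ext_obD(5)[OF ob(1) b], where M = ?M])
      show "linear_map K (tensor K (fst g) C) ?M (\<lambda>w. ?L (pure K (fst f) (tensor K (fst g) C) s w))"
        using s by (intro linear_tensor_map_compose linear_assoc_inv_compose pure_linear_right) simp_all
      show "linear_map K (tensor K (fst g) C) ?M (\<lambda>w. tensor_assoc_inv K (fst f') (fst g') C
          (pure K (fst f') (tensor K (fst g') C) (\<alpha> s) (tensor_map K (fst g) C (fst g') C \<beta> id w)))"
        using s by (intro linear_assoc_inv_compose linear_pure2 linear_tensor_map) simp_all
    qed (use s in simp_all)
    then show "?L (?\<tau> g f (pure K (fst f) B s b)) =
      tensor_assoc_inv K (fst f') (fst g') C (?\<tau> g' f' (tensor_map K (fst f) B (fst f') B \<alpha> id (pure K (fst f) B s b)))"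
      using s b by (simp add: ext_morD(4)[OF \<beta> b])
  qed simp
  then show "tensor_map K (fst (extension_comp A B C g f)) C (fst (extension_comp A B C g' f')) C ?\<alpha>\<beta> id (snd (extension_comp A B C g f) a) =
    snd (extension_comp A B C g' f') a"
    using a by (simp add: extension_comp_simps ext_morD(4)[OF \<alpha> a])
qed

text \<open>Three layers are generalised in turn: \<sigma>(a), \<tau>(b) and \<upsilon>(c). At the
  innermost level the claim is the agreement of two rebracketings of s, t, u and d.\<close>

lemma ext_assoc_iso:
  assumes alg: "k_algebra K A" "k_algebra K B" "k_algebra K C" "k_algebra K D"
    and ob: "h \<in> ob (ext_cat K C D)" "g \<in> ob (ext_cat K B C)" "f \<in> ob (ext_cat K A B)"
  shows "tensor_assoc_inv K (fst f) (fst g) (fst h) \<in> isos (ext_cat K A D)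
    (extension_comp A B D (extension_comp B C D h g) f) (extension_comp A C D h (extension_comp A B C g f))"
proof -
  note m [simp] = ob[THEN ext_obD(2)] alg[THEN k_algebra_module]
  note hg = extension_comp_ob[OF alg(2,3,4) ob(1,2)] and gf = extension_comp_ob[OF alg(1,2,3) ob(2,3)]
  note hgf = extension_comp_ob[OF alg(1,2,4) hg ob(3)] extension_comp_ob[OF alg(1,3,4) ob(1) gf]
  note l [simp] = lin_maps_linear[OF ext_obD(4)[OF ob(1)]] lin_maps_linear[OF ext_obD(4)[OF ob(2)]]
  note cl [simp] = ext_obD(5)[OF ob(1)] ext_obD(5)[OF ob(2)]
  let ?S = "fst f" and ?T = "fst g" and ?U = "fst h"
  let ?a = "tensor_assoc_inv K ?S ?T ?U"
  let ?M = "tensor K (tensor K (tensor K ?S ?T) ?U) D"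
  show ?thesis
  proof (rule ext_isosI[OF alg(1,4) hgf])
    show "?a \<in> mor (ext_cat K A D)
      (extension_comp A B D (extension_comp B C D h g) f) (extension_comp A C D h (extension_comp A B C g f))"
    proof (rule ext_morI[OF _ hgf(2)])
      show "?a \<in> alg_homs K (fst (extension_comp A B D (extension_comp B C D h g) f))
          (fst (extension_comp A C D h (extension_comp A B C g f)))"
        unfolding extension_comp_simps by (intro alg_homs_tensor_assoc_inv ob[THEN ext_obD(1)])
      let ?F = "tensor_map K (tensor K ?S (tensor K ?T ?U)) D (tensor K (tensor K ?S ?T) ?U) D ?a id"
      let ?G = "\<lambda>w. ?F (tensor_assoc_inv K ?S (tensor K ?T ?U) D w)"
      let ?hg = "snd (extension_comp B C D h g)"
      let ?\<upsilon> = "tensor_map K (tensor K ?S ?T) C (tensor K ?S ?T) (tensor K ?U D) id (snd h)"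
      let ?\<upsilon>' = "tensor_map K ?T C ?T (tensor K ?U D) id (snd h)"
      let ?\<tau> = "tensor_map K ?S B ?S (tensor K ?T C) id (snd g)"
      have lhg [simp]: "linear_map K B (tensor K (tensor K ?T ?U) D) ?hg"
        using lin_maps_linear[OF ext_obD(4)[OF hg]] by (simp add: extension_comp_simps)
      fix a assume a: "a \<in> carrier A"
      have "?G (tensor_map K ?S B ?S (tensor K (tensor K ?T ?U) D) id ?hg (snd f a)) =
        tensor_assoc_inv K (tensor K ?S ?T) ?U D (?\<upsilon> (tensor_assoc_inv K ?S ?T C (?\<tau> (snd f a))))"
      proof (rule tensor_eqI[OF m(3,5) _ _ _ _ ext_obD(5)[OF ob(3) a], where M = ?M])
        show "linear_map K (tensor K ?S B) ?M (\<lambda>z. ?G (tensor_map K ?S B ?S (tensor K (tensor K ?T ?U) D) id ?hg z))"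
          by (intro linear_tensor_map_compose linear_assoc_inv_compose linear_tensor_map) simp_all
        show "linear_map K (tensor K ?S B) ?M (\<lambda>z. tensor_assoc_inv K (tensor K ?S ?T) ?U D (?\<upsilon> (tensor_assoc_inv K ?S ?T C (?\<tau> z))))"
          by (intro linear_tensor_map_compose linear_assoc_inv_compose linear_tensor_map) simp_all
        fix s b assume s: "s \<in> carrier ?S" and b: "b \<in> carrier B"
        have "?G (pure K ?S (tensor K (tensor K ?T ?U) D) s (tensor_assoc_inv K ?T ?U D (?\<upsilon>' (snd g b)))) =
          tensor_assoc_inv K (tensor K ?S ?T) ?U D (?\<upsilon> (tensor_assoc_inv K ?S ?T C (pure K ?S (tensor K ?T C) s (snd g b))))"
        proof (rule tensor_eqI[OF m(2,6) _ _ _ _ ext_obD(5)[OF ob(2) b], where M = ?M])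
          show "linear_map K (tensor K ?T C) ?M (\<lambda>w. ?G (pure K ?S (tensor K (tensor K ?T ?U) D) s (tensor_assoc_inv K ?T ?U D (?\<upsilon>' w))))"
            using s by (intro linear_tensor_map_compose linear_assoc_inv_compose linear_tensor_map linear_pure2) simp_all
          show "linear_map K (tensor K ?T C) ?M (\<lambda>w. tensor_assoc_inv K (tensor K ?S ?T) ?U D (?\<upsilon> (tensor_assoc_inv K ?S ?T C (pure K ?S (tensor K ?T C) s w))))"
            using s by (intro linear_tensor_map_compose linear_assoc_inv_compose pure_linear_right) simp_all
          fix t c assume t: "t \<in> carrier ?T" and c: "c \<in> carrier C"
          have "?G (pure K ?S (tensor K (tensor K ?T ?U) D) s (tensor_assoc_inv K ?T ?U D (pure K ?T (tensor K ?U D) t (snd h c)))) =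
            tensor_assoc_inv K (tensor K ?S ?T) ?U D (pure K (tensor K ?S ?T) (tensor K ?U D) (pure K ?S ?T s t) (snd h c))"
          proof (rule tensor_eqI[OF m(1,7) _ _ _ _ ext_obD(5)[OF ob(1) c], where M = ?M])
            show "linear_map K (tensor K ?U D) ?M (\<lambda>y. ?G (pure K ?S (tensor K (tensor K ?T ?U) D) s (tensor_assoc_inv K ?T ?U D (pure K ?T (tensor K ?U D) t y))))"
              using s t by (intro linear_tensor_map_compose linear_assoc_inv_compose linear_pure2 pure_linear_right) simp_all
            show "linear_map K (tensor K ?U D) ?M (\<lambda>y. tensor_assoc_inv K (tensor K ?S ?T) ?U D (pure K (tensor K ?S ?T) (tensor K ?U D) (pure K ?S ?T s t) y))"
              using s t by (intro linear_assoc_inv_compose pure_linear_right) simp_all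
          qed (use s t in simp_all)
          then show "?G (pure K ?S (tensor K (tensor K ?T ?U) D) s (tensor_assoc_inv K ?T ?U D (?\<upsilon>' (pure K ?T C t c)))) =
            tensor_assoc_inv K (tensor K ?S ?T) ?U D (?\<upsilon> (tensor_assoc_inv K ?S ?T C (pure K ?S (tensor K ?T C) s (pure K ?T C t c))))"
            using s t c by simp
        qed simp
        then show "?G (tensor_map K ?S B ?S (tensor K (tensor K ?T ?U) D) id ?hg (pure K ?S B s b)) =
          tensor_assoc_inv K (tensor K ?S ?T) ?U D (?\<upsilon> (tensor_assoc_inv K ?S ?T C (?\<tau> (pure K ?S B s b))))"
          using s b by (simp add: extension_comp_simps(2)[OF b])
      qed simp
      then show "tensor_map K (fst (extension_comp A B D (extension_comp B C D h g) f)) D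
          (fst (extension_comp A C D h (extension_comp A B C g f))) D ?a id
          (snd (extension_comp A B D (extension_comp B C D h g) f) a) =
        snd (extension_comp A C D h (extension_comp A B C g f)) a"
        using a by (simp add: extension_comp_simps)
    qed
    show "tensor_assoc K ?S ?T ?U \<in> lin_maps K (fst (extension_comp A C D h (extension_comp A B C g f)))
        (fst (extension_comp A B D (extension_comp B C D h g) f))"
      by (simp add: extension_comp_simps tensor_assoc_in_lin_maps)
  qed (simp_all add: extension_comp_simps tensor_assoc_inverse)
qed

text \<open>A unit extension inserts a factor 1 next to S, and the unitor removes it again.
  Composing with the unit of B places the 1 to the right of S, hence \<open>right_unitor\<close>
  there.\<close>

lemma ext_unitor_iso:
  fixes A B :: "('k, ('k, 'a) univ) module"
  assumes alg: "k_algebra K A" "k_algebra K B" and ob: "f \<in> ob (ext_cat K A B)"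
  shows "right_unitor (fst f) \<in> isos (ext_cat K A B) (extension_comp A B B (extension_unit B) f) f"
    and "left_unitor (fst f) \<in> isos (ext_cat K A B) (extension_comp A A B f (extension_unit A)) f"
proof -
  let ?I = "unit_algebra K :: ('k, ('k, 'a) univ) module" and ?S = "fst f"
  note [simp del] = carrier_unit
  have one [simp]: "Scal \<one>\<^bsub>K\<^esub> \<in> carrier ?I" by (simp add: carrier_unit)
  note m [simp] = ext_obD(2)[OF ob] k_algebra_module[OF alg(1)] k_algebra_module[OF alg(2)]
  note S = ext_obD(1)[OF ob]
  note ul = extension_comp_ob[OF alg(1,2,2) extension_unit_ob[OF alg(2)] ob]
    and ur = extension_comp_ob[OF alg(1,1,2) ob extension_unit_ob[OF alg(1)]]
  have u: "fst (extension_unit X) = ?I" "snd (extension_unit X) = (\<lambda>a \<in> carrier X. pure K ?I X (Scal \<one>\<^bsub>K\<^esub>) a)"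
    for X :: "('k, ('k, 'a) univ) module" by (simp_all add: extension_unit_def)
  have lu: "linear_map K X (tensor K ?I X) (\<lambda>a \<in> carrier X. pure K ?I X (Scal \<one>\<^bsub>K\<^esub>) a)" if "module K X" for X :: "('k, ('k, 'a) univ) module"
    using left_unitor_inverse(1)[OF that] by (rule lin_maps_linear)
  note lf = lin_maps_linear[OF ext_obD(4)[OF ob]]
  show "right_unitor ?S \<in> isos (ext_cat K A B) (extension_comp A B B (extension_unit B) f) f"
  proof (rule ext_isosI[OF alg ul ob])
    show "right_unitor ?S \<in> mor (ext_cat K A B) (extension_comp A B B (extension_unit B) f) f"
    proof (rule ext_morI[OF _ ob])
      show "right_unitor ?S \<in> alg_homs K (fst (extension_comp A B B (extension_unit B) f)) ?S"
        using alg_homs_unitor(2)[OF S] by (simp add: extension_comp_simps u)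
      fix a assume a: "a \<in> carrier A"
      let ?L = "\<lambda>z. tensor_map K (tensor K ?S ?I) B ?S B (right_unitor ?S) id (tensor_assoc_inv K ?S ?I B
        (tensor_map K ?S B ?S (tensor K ?I B) id (\<lambda>a \<in> carrier B. pure K ?I B (Scal \<one>\<^bsub>K\<^esub>) a) z))"
      have "?L (snd f a) = snd f a"
      proof (rule tensor_eqI[OF m(1,3) _ _ linear_ident _ ext_obD(5)[OF ob a]])
        show "linear_map K (tensor K ?S B) (tensor K ?S B) ?L"
          using lu[OF m(3)] by (intro linear_tensor_map_compose linear_assoc_inv_compose linear_tensor_map) simp_all
        show "?L (pure K ?S B s b) = pure K ?S B s b" if "s \<in> carrier ?S" "b \<in> carrier B" for s b
          using that lu[OF m(3)] by simp
      qed simp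
      then show "tensor_map K (fst (extension_comp A B B (extension_unit B) f)) B ?S B (right_unitor ?S) id
          (snd (extension_comp A B B (extension_unit B) f) a) = snd f a"
        using a by (simp add: extension_comp_simps u)
    qed
    show "(\<lambda>v\<in>carrier ?S. pure K ?S ?I v (Scal \<one>\<^bsub>K\<^esub>)) \<in> lin_maps K ?S (fst (extension_comp A B B (extension_unit B) f))"
      using right_unitor_inverse(1)[OF m(1)] by (simp add: extension_comp_simps u)
  qed (simp_all only: extension_comp_simps u right_unitor_inverse[OF m(1)])
  show "left_unitor ?S \<in> isos (ext_cat K A B) (extension_comp A A B f (extension_unit A)) f"
  proof (rule ext_isosI[OF alg ur ob])
    show "left_unitor ?S \<in> mor (ext_cat K A B) (extension_comp A A B f (extension_unit A)) f"
    proof (rule ext_morI[OF _ ob])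
      show "left_unitor ?S \<in> alg_homs K (fst (extension_comp A A B f (extension_unit A))) ?S"
        using alg_homs_unitor(1)[OF S] by (simp add: extension_comp_simps u)
      fix a assume a: "a \<in> carrier A"
      \<comment> \<open>The unit is applied before \<sigma> here and yields the pure tensor 1
        \<otimes> a, so \<sigma>(a) enters as the second factor of 1 \<otimes> \<sigma>(a); that
        factor is the variable w.\<close>
      let ?L = "\<lambda>w. tensor_map K (tensor K ?I ?S) B ?S B (left_unitor ?S) id (tensor_assoc_inv K ?I ?S B
        (pure K ?I (tensor K ?S B) (Scal \<one>\<^bsub>K\<^esub>) w))"
      have "?L (snd f a) = snd f a"
      proof (rule tensor_eqI[OF m(1,3) _ _ linear_ident _ ext_obD(5)[OF ob a]])
        show "linear_map K (tensor K ?S B) (tensor K ?S B) ?L"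
          by (intro linear_tensor_map_compose linear_assoc_inv_compose pure_linear_right) simp_all
        show "?L (pure K ?S B s b) = pure K ?S B s b" if "s \<in> carrier ?S" "b \<in> carrier B" for s b
          using that by simp
      qed simp
      then show "tensor_map K (fst (extension_comp A A B f (extension_unit A))) B ?S B (left_unitor ?S) id
          (snd (extension_comp A A B f (extension_unit A)) a) = snd f a"
        using a lf by (simp add: extension_comp_simps u)
    qed
    show "(\<lambda>v\<in>carrier ?S. pure K ?I ?S (Scal \<one>\<^bsub>K\<^esub>) v) \<in> lin_maps K ?S (fst (extension_comp A A B f (extension_unit A)))"
      using left_unitor_inverse(1)[OF m(1)] by (simp add: extension_comp_simps u)
  qed (simp_all only: extension_comp_simps u left_unitor_inverse[OF m(1)])
qed

lemma Alg_hat_simps: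
  "obj (Alg_hat K) = {A. k_algebra K A}"
  "hom_cat (Alg_hat K) = ext_cat K"
  "one_cell (Alg_hat K) A = extension_unit A"
  "hcomp (Alg_hat K) A B C (g, f) = extension_comp A B C g f"
  "hcomp2 (Alg_hat K) A B C (g, f) (g', f') (\<beta>, \<alpha>) = tensor_map K (fst f) (fst g) (fst f') (fst g') \<alpha> \<beta>"
  "associator (Alg_hat K) A B C D (h, g, f) = tensor_assoc_inv K (fst f) (fst g) (fst h)"
  "lunitor (Alg_hat K) A B f = right_unitor (fst f)"
  "runitor (Alg_hat K) A B f = left_unitor (fst f)"
  by (simp_all add: Alg_hat_def extension_unit_def extension_comp_def case_prod_beta)

lemma fst_extension_unit: "fst (extension_unit A) = unit_algebra K"
  by (simp add: extension_unit_def)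

text \<open>Parallel to the case of measuring coalgebras, with the tensor factors reversed: the
  inverse pentagon and the second triangle apply, and left and right unitors change places.\<close>

lemma bicategory_Alg_hat: "bicategory (Alg_hat K :: ('k, 'a) ext_bicategory)"
proof (rule bicategory.intro, unfold Alg_hat_simps(1-3) mem_Collect_eq)
  fix A B :: "('k, ('k, 'a) univ) module" assume alg: "k_algebra K A" "k_algebra K B"
  show "category (ext_cat K A B)" by (rule category_ext[OF alg(2)])
next
  fix A :: "('k, ('k, 'a) univ) module" assume "k_algebra K A"
  then show "extension_unit A \<in> ob (ext_cat K A A)" by (rule extension_unit_ob)
next
  fix A B C :: "('k, ('k, 'a) univ) module" assume alg: "k_algebra K A" "k_algebra K B" "k_algebra K C"
  show "is_functor (prod_cat (ext_cat K B C) (ext_cat K A B)) (ext_cat K A C)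
    (hcomp (Alg_hat K) A B C) (hcomp2 (Alg_hat K) A B C)"
    using alg
    by (auto simp: is_functor_def prod_cat_simps Alg_hat_simps ext_cat_simps(3,4) extension_comp_simps(1)
        tensor_map_ident ext_obD(2) tensor_map_compose ext_morD(2) intro: extension_comp_ob ext_tensor_map_mor)
next
  fix A B C D :: "('k, ('k, 'a) univ) module" assume alg: "k_algebra K A" "k_algebra K B" "k_algebra K C" "k_algebra K D"
  show "is_natural_iso
          (prod_cat (ext_cat K C D) (prod_cat (ext_cat K B C) (ext_cat K A B))) (ext_cat K A D)
          (\<lambda>(h, g, f). hcomp (Alg_hat K) A B D (hcomp (Alg_hat K) B C D (h, g), f))
          (\<lambda>(h, g, f) (h', g', f') (\<gamma>, \<beta>, \<alpha>).
            hcomp2 (Alg_hat K) A B D (hcomp (Alg_hat K) B C D (h, g), f) (hcomp (Alg_hat K) B C D (h', g'), f')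
              (hcomp2 (Alg_hat K) B C D (h, g) (h', g') (\<gamma>, \<beta>), \<alpha>))
          (\<lambda>(h, g, f). hcomp (Alg_hat K) A C D (h, hcomp (Alg_hat K) A B C (g, f)))
          (\<lambda>(h, g, f) (h', g', f') (\<gamma>, \<beta>, \<alpha>).
            hcomp2 (Alg_hat K) A C D (h, hcomp (Alg_hat K) A B C (g, f)) (h', hcomp (Alg_hat K) A B C (g', f'))
              (\<gamma>, hcomp2 (Alg_hat K) A B C (g, f) (g', f') (\<beta>, \<alpha>)))
          (associator (Alg_hat K) A B C D)"
    using alg
    by (auto simp: is_natural_iso_def prod_cat_simps Alg_hat_simps ext_cat_simps(4) extension_comp_simps(1)
        ext_obD(2) ext_assoc_iso tensor_assoc_inv_natural ext_morD(2))
next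
  fix A B :: "('k, ('k, 'a) univ) module" assume alg: "k_algebra K A" "k_algebra K B"
  show "is_natural_iso (ext_cat K A B) (ext_cat K A B)
          (\<lambda>f. hcomp (Alg_hat K) A B B (extension_unit B, f))
          (\<lambda>f f' \<alpha>. hcomp2 (Alg_hat K) A B B (extension_unit B, f) (extension_unit B, f')
            (idn (ext_cat K B B) (extension_unit B), \<alpha>))
          (\<lambda>f. f) (\<lambda>f f' \<alpha>. \<alpha>) (lunitor (Alg_hat K) A B)"
    using alg
    by (auto simp del: carrier_unit simp: is_natural_iso_def Alg_hat_simps ext_cat_simps(3,4) extension_comp_simps(1)
        fst_extension_unit ext_obD(2) ext_unitor_iso unitor_natural ext_morD(2))
  show "is_natural_iso (ext_cat K A B) (ext_cat K A B)
          (\<lambda>f. hcomp (Alg_hat K) A A B (f, extension_unit A))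
          (\<lambda>f f' \<alpha>. hcomp2 (Alg_hat K) A A B (f, extension_unit A) (f', extension_unit A)
            (\<alpha>, idn (ext_cat K A A) (extension_unit A)))
          (\<lambda>f. f) (\<lambda>f f' \<alpha>. \<alpha>) (runitor (Alg_hat K) A B)"
    using alg
    by (auto simp del: carrier_unit simp: is_natural_iso_def Alg_hat_simps ext_cat_simps(3,4) extension_comp_simps(1)
        fst_extension_unit ext_obD(2) ext_unitor_iso unitor_natural ext_morD(2))
qed (simp_all add: Alg_hat_simps ext_cat_simps(3,4) extension_comp_simps(1) fst_extension_unit ext_obD(2)
    tensor_pentagon_inv tensor_triangle del: carrier_unit)

end

theorem proposition1p9:
  fixes K :: "('k, 'r) ring_scheme"
  assumes "field K"
  shows
    "(bicategory (Alg_check K :: ('k, 'a) meas_bicategory) \<and>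
      obj (Alg_check K :: ('k, 'a) meas_bicategory) = {A. k_algebra K A} \<and>
      (\<forall>A B. k_algebra K A \<and> k_algebra K B \<longrightarrow>
        hom_cat (Alg_check K :: ('k, 'a) meas_bicategory) A B = meas_cat K A B)) \<and>
     (bicategory (Alg_hat K :: ('k, 'a) ext_bicategory) \<and>
      obj (Alg_hat K :: ('k, 'a) ext_bicategory) = {A. k_algebra K A} \<and>
      (\<forall>A B. k_algebra K A \<and> k_algebra K B \<longrightarrow>
        hom_cat (Alg_hat K :: ('k, 'a) ext_bicategory) A B = ext_cat K A B))"
proof -
  interpret cring K using assms by (rule field.axioms(1)[THEN domain.axioms(1)])
  interpret linear_calculus K by unfold_locales
  show ?thesis
    using bicategory_Alg_check bicategory_Alg_hat by (simp add: Alg_check_simps(1,2) Alg_hat_simps(1,2))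
qed

end
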